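(* The adjunction $\Sigma_i\dashv\Delta_i$ between $\widetilde{\mathrm{Int}}_N$ and $\widetilde{\mathrm{Int}}$ factors through a geometric morphism $$\Sigma_i'\colon\widetilde{\mathrm{Int}}_N\rightleftarrows\widetilde{\mathrm{Int}}/\mathsf{Sync}\colon\Delta_i',\qquad\Sigma_i'\dashv\Delta_i',$$ in which the left adjoint $\Sigma_i'$ is fully faithful. That is, $\Sigma'_i$ preserves finite limits and is fully faithful, and $\Sigma_i\dashv\Delta_i$ is the composite of $\Sigma_i'\dashv\Delta_i'$ with the adjunction $\Sigma_{\mathsf{Sync}!}\dashv\Delta_{\mathsf{Sync}!}$ between $\widetilde{\mathrm{Int}}/\mathsf{Sync}$ and $\widetilde{\mathrm{Int}}$.
   Context: $\mathrm{Int}$ is the category with objects $\ell\in\mathbb{R}_{\ge0}$, morphisms $\ell'\to\ell$ the symbols $\mathrm{Tr}_p$ with $p\in\mathbb{R}_{\ge0}$, $p\le\ell-\ell'$, composition $\mathrm{Tr}_p\circ\mathrm{Tr}_{p'}=\mathrm{Tr}_{p+p'}$, identities $\mathrm{Tr}_0$. For a presheaf $X$ and $x\in X(\ell)$, write $x|_{[p,p+\ell']}=X(\mathrm{Tr}_p)(x)$. An $\mathrm{Int}$-sheaf is a presheaf $X$ such that for all $x_1\in X(\ell_1)$, $x_2\in X(\ell_2)$ with $x_1|_{[\ell_1,\ell_1]}=x_2|_{[0,0]}$ there is a unique element of $X(\ell_1+\ell_2)$ restricting to $x_1$ on $[0,\ell_1]$ and to $x_2$ on $[\ell_1,\ell_1+\ell_2]$.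 $\widetilde{\mathrm{Int}}$ is the full subcategory (a topos) of sheaves. $\mathrm{Int}_N$ and $\widetilde{\mathrm{Int}}_N$ are defined in the same way with $\mathbb{N}$ in place of $\mathbb{R}_{\ge0}$. $\Delta_i\colon\widetilde{\mathrm{Int}}\to\widetilde{\mathrm{Int}}_N$ is precomposition with (the opposite of) the inclusion $i\colon\mathrm{Int}_N\to\mathrm{Int}$, and $\Sigma_i$ is its left adjoint. $\mathsf{Sync}\in\widetilde{\mathrm{Int}}$ is the sheaf with $\mathsf{Sync}(\ell)=\mathbb{R}/\mathbb{Z}$ for all $\ell$, with restriction along $\mathrm{Tr}_p\colon\ell'\to\ell$ given by $[\theta]\mapsto[\theta+p]$. $\Sigma_i$ sends the terminal sheaf to (an isomorphic copy of) $\mathsf{Sync}$. $\Sigma_{\mathsf{Sync}!}\colon\widetilde{\mathrm{Int}}/\mathsf{Sync}\to\widetilde{\mathrm{Int}}$ sends $(X\to\mathsf{Sync})$ to $X$ and $\Delta_{\mathsf{Sync}!}$ sends $Y$ to the projection $(Y\times\mathsf{Sync}\to\mathsf{Sync})$. A geometric morphism here means an adjunction between toposes whose left adjoint preserves finite limits. *)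

theory Defs
  imports Complex_Main "HOL-Library.FuncSet"
begin

section \<open>Categories, functors, limits, adjunctions\<close>

record ('o, 'a) cat =
  Obj :: "'o set"
  Arr :: "'a set"
  Dom :: "'a \<Rightarrow> 'o"
  Cod :: "'a \<Rightarrow> 'o"
  Ide :: "'o \<Rightarrow> 'a"
  Comp :: "'a \<Rightarrow> 'a \<Rightarrow> 'a" (infixr \<open>\<cdot>\<index>\<close> 70)

definition hom :: "('o, 'a, 'm) cat_scheme \<Rightarrow> 'o \<Rightarrow> 'o \<Rightarrow> 'a set" where
  "hom C A B = {f \<in> Arr C. Dom C f = A \<and> Cod C f = B}"

locale category =
  fixes C :: "('o, 'a) cat" (structure)
  assumes Dom_Obj: "f \<in> Arr C \<Longrightarrow> Dom C f \<in> Obj C"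
    and Cod_Obj: "f \<in> Arr C \<Longrightarrow> Cod C f \<in> Obj C"
    and Ide_hom: "A \<in> Obj C \<Longrightarrow> Ide C A \<in> hom C A A"
    and Comp_hom: "\<lbrakk>f \<in> hom C A B; g \<in> hom C B D\<rbrakk> \<Longrightarrow> g \<cdot> f \<in> hom C A D"
    and Comp_Ide_right: "f \<in> hom C A B \<Longrightarrow> f \<cdot> Ide C A = f"
    and Comp_Ide_left: "f \<in> hom C A B \<Longrightarrow> Ide C B \<cdot> f = f"
    and Comp_assoc: "\<lbrakk>f \<in> hom C A B; g \<in> hom C B D; h \<in> hom C D E\<rbrakk>
      \<Longrightarrow> (h \<cdot> g) \<cdot> f = h \<cdot> (g \<cdot> f)"

definition isomorphism :: "('o, 'a) cat \<Rightarrow> 'o \<Rightarrow> 'o \<Rightarrow> 'a \<Rightarrow> bool" where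
  "isomorphism C A B f \<longleftrightarrow> f \<in> hom C A B \<and>
     (\<exists>g \<in> hom C B A. g \<cdot>\<^bsub>C\<^esub> f = Ide C A \<and> f \<cdot>\<^bsub>C\<^esub> g = Ide C B)"

definition full_subcategory :: "('o, 'a) cat \<Rightarrow> ('o \<Rightarrow> bool) \<Rightarrow> ('o, 'a) cat" where
  "full_subcategory C P =
     C\<lparr>Obj := {A \<in> Obj C. P A}, Arr := {f \<in> Arr C. P (Dom C f) \<and> P (Cod C f)}\<rparr>"

record ('o, 'a, 'p, 'b) ftr =
  omap :: "'o \<Rightarrow> 'p"
  amap :: "'a \<Rightarrow> 'b"

definition is_functor :: "('o, 'a) cat \<Rightarrow> ('p, 'b) cat \<Rightarrow> ('o, 'a, 'p, 'b) ftr \<Rightarrow> bool" where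
  "is_functor C D F \<longleftrightarrow> category C \<and> category D \<and>
     (\<forall>A \<in> Obj C. omap F A \<in> Obj D) \<and>
     (\<forall>A B. \<forall>f \<in> hom C A B. amap F f \<in> hom D (omap F A) (omap F B)) \<and>
     (\<forall>A \<in> Obj C. amap F (Ide C A) = Ide D (omap F A)) \<and>
     (\<forall>A B E. \<forall>f \<in> hom C A B. \<forall>g \<in> hom C B E.
        amap F (g \<cdot>\<^bsub>C\<^esub> f) = amap F g \<cdot>\<^bsub>D\<^esub> amap F f)"

definition id_functor :: "('o, 'a, 'o, 'a) ftr" where
  "id_functor = \<lparr>omap = (\<lambda>A. A), amap = (\<lambda>f. f)\<rparr>"

definition functor_comp ::
  "('p, 'b, 'q, 'c) ftr \<Rightarrow> ('o, 'a, 'p, 'b) ftr \<Rightarrow> ('o, 'a, 'q, 'c) ftr" (infixr \<open>\<circ>\<^sub>F\<close> 70) where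
  "G \<circ>\<^sub>F F = \<lparr>omap = omap G \<circ> omap F, amap = amap G \<circ> amap F\<rparr>"

definition fully_faithful ::
  "('o, 'a) cat \<Rightarrow> ('p, 'b) cat \<Rightarrow> ('o, 'a, 'p, 'b) ftr \<Rightarrow> bool" where
  "fully_faithful C D F \<longleftrightarrow> is_functor C D F \<and>
     (\<forall>A \<in> Obj C. \<forall>B \<in> Obj C. bij_betw (amap F) (hom C A B) (hom D (omap F A) (omap F B)))"

definition nat_trans ::
  "('o, 'a) cat \<Rightarrow> ('p, 'b) cat \<Rightarrow> ('o, 'a, 'p, 'b) ftr \<Rightarrow> ('o, 'a, 'p, 'b) ftr
     \<Rightarrow> ('o \<Rightarrow> 'b) \<Rightarrow> bool" where
  "nat_trans C D F G \<tau> \<longleftrightarrow>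
     (\<forall>A \<in> Obj C. \<tau> A \<in> hom D (omap F A) (omap G A)) \<and>
     (\<forall>A B. \<forall>f \<in> hom C A B. \<tau> B \<cdot>\<^bsub>D\<^esub> amap F f = amap G f \<cdot>\<^bsub>D\<^esub> \<tau> A)"

definition nat_iso ::
  "('o, 'a) cat \<Rightarrow> ('p, 'b) cat \<Rightarrow> ('o, 'a, 'p, 'b) ftr \<Rightarrow> ('o, 'a, 'p, 'b) ftr
     \<Rightarrow> ('o \<Rightarrow> 'b) \<Rightarrow> bool" where
  "nat_iso C D F G \<tau> \<longleftrightarrow> nat_trans C D F G \<tau> \<and>
     (\<forall>A \<in> Obj C. isomorphism D (omap F A) (omap G A) (\<tau> A))"

definition is_cone ::
  "('j, 'k) cat \<Rightarrow> ('o, 'a) cat \<Rightarrow> ('j, 'k, 'o, 'a) ftr \<Rightarrow> 'o \<Rightarrow> ('j \<Rightarrow> 'a) \<Rightarrow> bool" where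
  "is_cone J C D A \<pi> \<longleftrightarrow> A \<in> Obj C \<and>
     (\<forall>j \<in> Obj J. \<pi> j \<in> hom C A (omap D j)) \<and>
     (\<forall>i j. \<forall>u \<in> hom J i j. amap D u \<cdot>\<^bsub>C\<^esub> \<pi> i = \<pi> j)"

definition is_limit ::
  "('j, 'k) cat \<Rightarrow> ('o, 'a) cat \<Rightarrow> ('j, 'k, 'o, 'a) ftr \<Rightarrow> 'o \<Rightarrow> ('j \<Rightarrow> 'a) \<Rightarrow> bool" where
  "is_limit J C D A \<pi> \<longleftrightarrow> is_cone J C D A \<pi> \<and>
     (\<forall>B \<mu>. is_cone J C D B \<mu> \<longrightarrow> (\<exists>!h. h \<in> hom C B A \<and> (\<forall>j \<in> Obj J. \<pi> j \<cdot>\<^bsub>C\<^esub> h = \<mu> j)))"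

text \<open>Every finite category is isomorphic to one whose objects and arrows are natural
  numbers, so it suffices to let the index category range over those.\<close>

definition preserves_finite_limits ::
  "('o, 'a) cat \<Rightarrow> ('p, 'b) cat \<Rightarrow> ('o, 'a, 'p, 'b) ftr \<Rightarrow> bool" where
  "preserves_finite_limits C D F \<longleftrightarrow>
     (\<forall>(J :: (nat, nat) cat) K A \<pi>.
        finite (Obj J) \<and> finite (Arr J) \<and> is_functor J C K \<and> is_limit J C K A \<pi> \<longrightarrow>
        is_limit J D (F \<circ>\<^sub>F K) (omap F A) (\<lambda>j. amap F (\<pi> j)))"

record ('o, 'a, 'p, 'b) adj =
  ladj :: "('o, 'a, 'p, 'b) ftr"
  radj :: "('p, 'b, 'o, 'a) ftr"
  adj_unit :: "'o \<Rightarrow> 'a"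
  adj_counit :: "'p \<Rightarrow> 'b"

definition adjunction ::
  "('o, 'a) cat \<Rightarrow> ('p, 'b) cat \<Rightarrow> ('o, 'a, 'p, 'b) adj \<Rightarrow> bool" where
  "adjunction C D T \<longleftrightarrow>
     is_functor C D (ladj T) \<and> is_functor D C (radj T) \<and>
     nat_trans C C id_functor (radj T \<circ>\<^sub>F ladj T) (adj_unit T) \<and>
     nat_trans D D (ladj T \<circ>\<^sub>F radj T) id_functor (adj_counit T) \<and>
     (\<forall>A \<in> Obj C. adj_counit T (omap (ladj T) A) \<cdot>\<^bsub>D\<^esub> amap (ladj T) (adj_unit T A)
        = Ide D (omap (ladj T) A)) \<and>
     (\<forall>B \<in> Obj D. amap (radj T) (adj_counit T B) \<cdot>\<^bsub>C\<^esub> adj_unit T (omap (radj T) B)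
        = Ide C (omap (radj T) B))"

definition geometric_morphism ::
  "('o, 'a) cat \<Rightarrow> ('p, 'b) cat \<Rightarrow> ('o, 'a, 'p, 'b) adj \<Rightarrow> bool" where
  "geometric_morphism C D T \<longleftrightarrow> adjunction C D T \<and> preserves_finite_limits C D (ladj T)"

text \<open>The composite of \<open>T : C \<rightleftarrows> D\<close> followed by \<open>T' : D \<rightleftarrows> E\<close>.\<close>

definition adj_comp ::
  "('o, 'a) cat \<Rightarrow> ('q, 'c) cat \<Rightarrow> ('o, 'a, 'p, 'b) adj \<Rightarrow> ('p, 'b, 'q, 'c) adj
     \<Rightarrow> ('o, 'a, 'q, 'c) adj" where
  "adj_comp C E T T' =
     \<lparr>ladj = ladj T' \<circ>\<^sub>F ladj T,
      radj = radj T \<circ>\<^sub>F radj T',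
      adj_unit = (\<lambda>A. amap (radj T) (adj_unit T' (omap (ladj T) A)) \<cdot>\<^bsub>C\<^esub> adj_unit T A),
      adj_counit = (\<lambda>Z. adj_counit T' Z \<cdot>\<^bsub>E\<^esub> amap (ladj T') (adj_counit T (omap (radj T') Z)))\<rparr>"

text \<open>Two adjunctions between the same categories agree if their left adjoints and their right
  adjoints are naturally isomorphic in a way that is compatible with units and counits.\<close>

definition adj_iso ::
  "('o, 'a) cat \<Rightarrow> ('p, 'b) cat \<Rightarrow> ('o, 'a, 'p, 'b) adj \<Rightarrow> ('o, 'a, 'p, 'b) adj \<Rightarrow> bool" where
  "adj_iso C D S T \<longleftrightarrow>
     (\<exists>\<phi> \<psi>. nat_iso C D (ladj S) (ladj T) \<phi> \<and> nat_iso D C (radj S) (radj T) \<psi> \<and>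
        (\<forall>A \<in> Obj C. adj_unit T A =
           \<psi> (omap (ladj T) A) \<cdot>\<^bsub>C\<^esub> amap (radj S) (\<phi> A) \<cdot>\<^bsub>C\<^esub> adj_unit S A) \<and>
        (\<forall>B \<in> Obj D. adj_counit S B =
           adj_counit T B \<cdot>\<^bsub>D\<^esub> \<phi> (omap (radj T) B) \<cdot>\<^bsub>D\<^esub> amap (ladj S) (\<psi> B)))"

definition slice :: "('o, 'a) cat \<Rightarrow> 'o \<Rightarrow> ('a, 'a \<times> 'a \<times> 'a) cat" where
  "slice C S =
     \<lparr>Obj = {f \<in> Arr C. Cod C f = S},
      Arr = {(f, h, g). f \<in> Arr C \<and> Cod C f = S \<and> g \<in> Arr C \<and> Cod C g = S \<and>
               h \<in> hom C (Dom C f) (Dom C g) \<and> g \<cdot>\<^bsub>C\<^esub> h = f},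
      Dom = (\<lambda>(f, h, g). f),
      Cod = (\<lambda>(f, h, g). g),
      Ide = (\<lambda>f. (f, Ide C (Dom C f), f)),
      Comp = (\<lambda>(_, k, g) (f, h, _). (f, k \<cdot>\<^bsub>C\<^esub> h, g))\<rparr>"

definition slice_forget :: "('o, 'a) cat \<Rightarrow> ('a, 'a \<times> 'a \<times> 'a, 'o, 'a) ftr" where
  "slice_forget C = \<lparr>omap = Dom C, amap = (\<lambda>(f, h, g). h)\<rparr>"


section \<open>Presheaves of small sets\<close>

definition RmodZ :: "real set set" where
  "RmodZ = UNIV // {(s, t). s - t \<in> \<int>}"

text \<open>
  The sets and functions in which presheaves take values are the small subsets of a type \<open>'u\<close> and
  the functions between them.  Nothing is assumed about smallness beyond closure under subsets,
  images and binary products and the existence of a small copy of the circle \<open>\<real>/\<int>\<close>.  This covers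
  a Grothendieck universe (where closure under power sets and unions is available as well), but
  also, say, \<open>'u = real\<close> with all subsets small.  The injections \<open>pr\<close> and \<open>crc\<close> encode pairs and
  elements of the circle as elements of \<open>'u\<close>.
\<close>

locale set_universe =
  fixes small :: "'u set \<Rightarrow> bool"
    and pr :: "'u \<times> 'u \<Rightarrow> 'u"
    and crc :: "real set \<Rightarrow> 'u"
  assumes small_subset: "\<lbrakk>small A; B \<subseteq> A\<rbrakk> \<Longrightarrow> small B"
    and small_image: "small A \<Longrightarrow> small (f ` A)"
    and inj_pr: "inj pr"
    and small_product: "\<lbrakk>small A; small B\<rbrakk> \<Longrightarrow> small (pr ` (A \<times> B))"
    and inj_crc: "inj_on crc RmodZ"
    and small_circle: "small (crc ` RmodZ)"

text \<open>A presheaf is given by its sets of sections and its restriction maps;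
  \<open>Res X m\<close> maps \<open>Sec X (Cod C m)\<close> to \<open>Sec X (Dom C m)\<close>.\<close>

record ('o, 'a, 'u) psh =
  Sec :: "'o \<Rightarrow> 'u set"
  Res :: "'a \<Rightarrow> 'u \<Rightarrow> 'u"

definition presheaf :: "('u set \<Rightarrow> bool) \<Rightarrow> ('o, 'a) cat \<Rightarrow> ('o, 'a, 'u) psh \<Rightarrow> bool" where
  "presheaf small C X \<longleftrightarrow>
     Sec X \<in> extensional (Obj C) \<and> Res X \<in> extensional (Arr C) \<and>
     (\<forall>c \<in> Obj C. small (Sec X c)) \<and>
     (\<forall>m \<in> Arr C. Res X m \<in> Sec X (Cod C m) \<rightarrow>\<^sub>E Sec X (Dom C m)) \<and>
     (\<forall>c \<in> Obj C. \<forall>x \<in> Sec X c. Res X (Ide C c) x = x) \<and>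
     (\<forall>a b c. \<forall>f \<in> hom C a b. \<forall>g \<in> hom C b c. \<forall>x \<in> Sec X c.
        Res X (g \<cdot>\<^bsub>C\<^esub> f) x = Res X f (Res X g x))"

type_synonym ('o, 'a, 'u) psh_arr = "('o, 'a, 'u) psh \<times> ('o \<Rightarrow> 'u \<Rightarrow> 'u) \<times> ('o, 'a, 'u) psh"

definition psh_hom ::
  "('o, 'a) cat \<Rightarrow> ('o, 'a, 'u) psh \<Rightarrow> ('o, 'a, 'u) psh \<Rightarrow> ('o \<Rightarrow> 'u \<Rightarrow> 'u) set" where
  "psh_hom C X Y =
     {\<alpha> \<in> (\<Pi>\<^sub>E c \<in> Obj C. Sec X c \<rightarrow>\<^sub>E Sec Y c).
        \<forall>m \<in> Arr C. \<forall>x \<in> Sec X (Cod C m). \<alpha> (Dom C m) (Res X m x) = Res Y m (\<alpha> (Cod C m) x)}"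

definition psh_cat ::
  "('u set \<Rightarrow> bool) \<Rightarrow> ('o, 'a) cat \<Rightarrow> (('o, 'a, 'u) psh, ('o, 'a, 'u) psh_arr) cat" where
  "psh_cat small C =
     \<lparr>Obj = {X. presheaf small C X},
      Arr = {(X, \<alpha>, Y). presheaf small C X \<and> presheaf small C Y \<and> \<alpha> \<in> psh_hom C X Y},
      Dom = (\<lambda>(X, \<alpha>, Y). X),
      Cod = (\<lambda>(X, \<alpha>, Y). Y),
      Ide = (\<lambda>X. (X, \<lambda>c \<in> Obj C. \<lambda>x \<in> Sec X c. x, X)),
      Comp = (\<lambda>(_, \<beta>, Z) (X, \<alpha>, _). (X, \<lambda>c \<in> Obj C. \<lambda>x \<in> Sec X c. \<beta> c (\<alpha> c x), Z))\<rparr>"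

text \<open>Precomposition with (the opposite of) a functor \<open>F\<close> out of \<open>B\<close>.\<close>

definition precomp_psh ::
  "('p, 'b) cat \<Rightarrow> ('p, 'b, 'o, 'a) ftr \<Rightarrow> ('o, 'a, 'u) psh \<Rightarrow> ('p, 'b, 'u) psh" where
  "precomp_psh B F X =
     \<lparr>Sec = (\<lambda>b \<in> Obj B. Sec X (omap F b)), Res = (\<lambda>m \<in> Arr B. Res X (amap F m))\<rparr>"

definition precomp_functor ::
  "('p, 'b) cat \<Rightarrow> ('p, 'b, 'o, 'a) ftr
     \<Rightarrow> (('o, 'a, 'u) psh, ('o, 'a, 'u) psh_arr, ('p, 'b, 'u) psh, ('p, 'b, 'u) psh_arr) ftr" where
  "precomp_functor B F =
     \<lparr>omap = precomp_psh B F,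
      amap = (\<lambda>(X, \<alpha>, Y). (precomp_psh B F X, \<lambda>b \<in> Obj B. \<alpha> (omap F b), precomp_psh B F Y))\<rparr>"

definition psh_prod ::
  "('u \<times> 'u \<Rightarrow> 'u) \<Rightarrow> ('o, 'a) cat \<Rightarrow> ('o, 'a, 'u) psh \<Rightarrow> ('o, 'a, 'u) psh \<Rightarrow> ('o, 'a, 'u) psh" where
  "psh_prod pr C X Y =
     \<lparr>Sec = (\<lambda>c \<in> Obj C. pr ` (Sec X c \<times> Sec Y c)),
      Res = (\<lambda>m \<in> Arr C. \<lambda>z \<in> pr ` (Sec X (Cod C m) \<times> Sec Y (Cod C m)).
               pr (map_prod (Res X m) (Res Y m) (inv pr z)))\<rparr>"

definition psh_fst ::
  "('u \<times> 'u \<Rightarrow> 'u) \<Rightarrow> ('o, 'a) cat \<Rightarrow> ('o, 'a, 'u) psh \<Rightarrow> ('o, 'a, 'u) psh \<Rightarrow> ('o, 'a, 'u) psh_arr" where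
  "psh_fst pr C X Y =
     (psh_prod pr C X Y, \<lambda>c \<in> Obj C. \<lambda>z \<in> pr ` (Sec X c \<times> Sec Y c). fst (inv pr z), X)"

definition psh_snd ::
  "('u \<times> 'u \<Rightarrow> 'u) \<Rightarrow> ('o, 'a) cat \<Rightarrow> ('o, 'a, 'u) psh \<Rightarrow> ('o, 'a, 'u) psh \<Rightarrow> ('o, 'a, 'u) psh_arr" where
  "psh_snd pr C X Y =
     (psh_prod pr C X Y, \<lambda>c \<in> Obj C. \<lambda>z \<in> pr ` (Sec X c \<times> Sec Y c). snd (inv pr z), Y)"

text \<open>The functor sending \<open>Y\<close> to the projection from \<open>Y \<times> S\<close> to \<open>S\<close>.\<close>

definition slice_product ::
  "('u \<times> 'u \<Rightarrow> 'u) \<Rightarrow> ('o, 'a) cat \<Rightarrow> ('o, 'a, 'u) psh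
     \<Rightarrow> (('o, 'a, 'u) psh, ('o, 'a, 'u) psh_arr, ('o, 'a, 'u) psh_arr,
         ('o, 'a, 'u) psh_arr \<times> ('o, 'a, 'u) psh_arr \<times> ('o, 'a, 'u) psh_arr) ftr" where
  "slice_product pr C S =
     \<lparr>omap = (\<lambda>Y. psh_snd pr C Y S),
      amap = (\<lambda>(Y, \<alpha>, Y').
        (psh_snd pr C Y S,
         (psh_prod pr C Y S,
          \<lambda>c \<in> Obj C. \<lambda>z \<in> pr ` (Sec Y c \<times> Sec S c). pr (apfst (\<alpha> c) (inv pr z)),
          psh_prod pr C Y' S),
         psh_snd pr C Y' S))\<rparr>"

text \<open>Its unit at \<open>f : X \<rightarrow> S\<close> is \<open>(id, f) : X \<rightarrow> X \<times> S\<close>, and its counit at \<open>Y\<close> is the projection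
  from \<open>Y \<times> S\<close> to \<open>Y\<close>.\<close>

definition slice_adj ::
  "('u set \<Rightarrow> bool) \<Rightarrow> ('u \<times> 'u \<Rightarrow> 'u) \<Rightarrow> ('o, 'a) cat \<Rightarrow> ('o, 'a, 'u) psh
     \<Rightarrow> (('o, 'a, 'u) psh_arr,
         ('o, 'a, 'u) psh_arr \<times> ('o, 'a, 'u) psh_arr \<times> ('o, 'a, 'u) psh_arr,
         ('o, 'a, 'u) psh, ('o, 'a, 'u) psh_arr) adj" where
  "slice_adj small pr C S =
     \<lparr>ladj = slice_forget (psh_cat small C),
      radj = slice_product pr C S,
      adj_unit = (\<lambda>(X, \<phi>, T).
        ((X, \<phi>, T),
         (X, \<lambda>c \<in> Obj C. \<lambda>x \<in> Sec X c. pr (x, \<phi> c x), psh_prod pr C X S),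
         psh_snd pr C X S)),
      adj_counit = (\<lambda>Y. psh_fst pr C Y S)\<rparr>"


section \<open>Interval sheaves\<close>

text \<open>The triple \<open>(l', p, l)\<close> is the arrow \<open>Tr\<^sub>p\<close> from \<open>l'\<close> to \<open>l\<close>.  The set \<open>R\<close> of lengths will be
  either the nonnegative reals or the natural numbers inside the reals.\<close>

definition int_cat :: "real set \<Rightarrow> (real, real \<times> real \<times> real) cat" where
  "int_cat R =
     \<lparr>Obj = R,
      Arr = {(l', p, l). l' \<in> R \<and> p \<in> R \<and> l \<in> R \<and> p \<le> l - l'},
      Dom = (\<lambda>(l', p, l). l'),
      Cod = (\<lambda>(l', p, l). l),
      Ide = (\<lambda>l. (l, 0, l)),
      Comp = (\<lambda>(_, p, l) (l'', p', _). (l'', p + p', l))\<rparr>"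

abbreviation IntC :: "(real, real \<times> real \<times> real) cat" where
  "IntC \<equiv> int_cat {0..}"

abbreviation IntNC :: "(real, real \<times> real \<times> real) cat" where
  "IntNC \<equiv> int_cat \<nat>"

type_synonym 'u ipsh = "(real, real \<times> real \<times> real, 'u) psh"
type_synonym 'u ipsh_arr = "(real, real \<times> real \<times> real, 'u) psh_arr"

definition is_sheaf :: "real set \<Rightarrow> 'u ipsh \<Rightarrow> bool" where
  "is_sheaf R X \<longleftrightarrow>
     (\<forall>l\<^sub>1 \<in> R. \<forall>l\<^sub>2 \<in> R. \<forall>x\<^sub>1 \<in> Sec X l\<^sub>1. \<forall>x\<^sub>2 \<in> Sec X l\<^sub>2.
        Res X (0, l\<^sub>1, l\<^sub>1) x\<^sub>1 = Res X (0, 0, l\<^sub>2) x\<^sub>2 \<longrightarrow>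
        (\<exists>!x. x \<in> Sec X (l\<^sub>1 + l\<^sub>2) \<and>
           Res X (l\<^sub>1, 0, l\<^sub>1 + l\<^sub>2) x = x\<^sub>1 \<and> Res X (l\<^sub>2, l\<^sub>1, l\<^sub>1 + l\<^sub>2) x = x\<^sub>2))"

definition sheaf_cat :: "('u set \<Rightarrow> bool) \<Rightarrow> real set \<Rightarrow> ('u ipsh, 'u ipsh_arr) cat" where
  "sheaf_cat small R = full_subcategory (psh_cat small (int_cat R)) (is_sheaf R)"

abbreviation IntSh :: "('u set \<Rightarrow> bool) \<Rightarrow> ('u ipsh, 'u ipsh_arr) cat" where
  "IntSh small \<equiv> sheaf_cat small {0..}"

abbreviation IntNSh :: "('u set \<Rightarrow> bool) \<Rightarrow> ('u ipsh, 'u ipsh_arr) cat" where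
  "IntNSh small \<equiv> sheaf_cat small \<nat>"

text \<open>\<open>IntNC\<close> is literally a subcategory of \<open>IntC\<close>, so its inclusion acts as the identity.\<close>

definition incl :: "(real, real \<times> real \<times> real, real, real \<times> real \<times> real) ftr" where
  "incl = \<lparr>omap = (\<lambda>l. l), amap = (\<lambda>m. m)\<rparr>"

definition Delta_i :: "('u ipsh, 'u ipsh_arr, 'u ipsh, 'u ipsh_arr) ftr" where
  "Delta_i = precomp_functor IntNC incl"

text \<open>The class \<open>[\<theta> + p]\<close> is the translate by \<open>p\<close> of the coset \<open>[\<theta>]\<close>.\<close>

definition Sync :: "(real set \<Rightarrow> 'u) \<Rightarrow> 'u ipsh" where
  "Sync crc =
     \<lparr>Sec = (\<lambda>l \<in> Obj IntC. crc ` RmodZ),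
      Res = restrict (\<lambda>(l', p, l). \<lambda>u \<in> crc ` RmodZ.
               crc ((\<lambda>t. t + p) ` inv_into RmodZ crc u)) (Arr IntC)\<rparr>"

end

theory Submission
  imports Defs
begin

text \<open>
  A sheaf \<open>Y\<close> on integer lengths is a graph, and \<open>Y n\<close> is the set of its paths of length \<open>n\<close>.  Its
  extension \<open>lan Y\<close> to real lengths consists of paths that may start and stop inside an edge: a
  section of length \<open>l\<close> is a phase \<open>\<theta>\<close>, telling how far inside the first edge the path starts,
  together with the shortest integer path covering the interval from \<open>\<theta>\<close> to \<open>\<theta> + l\<close>, which has
  length \<open>\<lceil>\<theta> + l\<rceil>\<close>.  The phase is a morphism from \<open>lan Y\<close> to \<open>Sync\<close>, and remembering it
  gives the functor \<open>lan_functor\<close> into the slice.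

  Its right adjoint takes \<open>\<phi> : X \<rightarrow> Sync\<close> to the sheaf of sections of \<open>X\<close> that have integer length and
  phase \<open>0\<close> (lemma \<open>adjunction_lan_fiber\<close>).  In \<open>lan Y\<close> these are just the sections of \<open>Y\<close>, and every
  section of \<open>lan Y\<close> is a restriction of one of them; so \<open>lan_functor\<close> is fully faithful.  It
  preserves limits because, once phase and length are fixed, a section of \<open>lan Y\<close> is nothing but
  an element of one set \<open>Y n\<close>, and limits of sheaves on integer lengths are computed separately for
  each \<open>n\<close>, by the Yoneda lemma.

  The fiber of the projection \<open>X \<times> Sync \<rightarrow> Sync\<close> over phase \<open>0\<close> is the restriction of \<open>X\<close> to integer
  lengths.  The composite of the two right adjoints is therefore isomorphic to \<open>Delta_i\<close>.  It
  follows formally that \<open>Delta_i\<close> has a left adjoint (\<open>adjunction_transport\<close>) and, adjoints being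
  unique, that any adjunction with right adjoint \<open>Delta_i\<close> is isomorphic to the composite
  adjunction (\<open>adj_iso_of_radj_iso\<close>).
\<close>

section \<open>Adjunctions and their mates\<close>

lemma homD:
  assumes "category C" "f \<in> hom C A B"
  shows "A \<in> Obj C" "B \<in> Obj C"
  using assms category.Dom_Obj[of C f] category.Cod_Obj[of C f] by (auto simp: hom_def)

lemma functor_obj: "is_functor C D F \<Longrightarrow> A \<in> Obj C \<Longrightarrow> omap F A \<in> Obj D"
  by (simp add: is_functor_def)

lemma functor_hom:
  "is_functor C D F \<Longrightarrow> f \<in> hom C A B \<Longrightarrow> amap F f \<in> hom D (omap F A) (omap F B)"
  by (simp add: is_functor_def)

lemma functor_ide: "is_functor C D F \<Longrightarrow> A \<in> Obj C \<Longrightarrow> amap F (Ide C A) = Ide D (omap F A)"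
  by (simp add: is_functor_def)

lemma functor_compose:
  "is_functor C D F \<Longrightarrow> f \<in> hom C A B \<Longrightarrow> g \<in> hom C B E \<Longrightarrow>
    amap F (g \<cdot>\<^bsub>C\<^esub> f) = amap F g \<cdot>\<^bsub>D\<^esub> amap F f"
  unfolding is_functor_def by blast

lemma functor_cats: "is_functor C D F \<Longrightarrow> category C" "is_functor C D F \<Longrightarrow> category D"
  by (simp_all add: is_functor_def)

lemma functor_comp_simps [simp]:
  "omap (G \<circ>\<^sub>F F) A = omap G (omap F A)" "amap (G \<circ>\<^sub>F F) f = amap G (amap F f)"
  "omap id_functor A = A" "amap id_functor f = f"
  by (simp_all add: functor_comp_def id_functor_def)

lemma is_functor_comp:
  assumes "is_functor C D F" "is_functor D E G"
  shows "is_functor C E (G \<circ>\<^sub>F F)"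
proof -
  have "amap G (amap F (g \<cdot>\<^bsub>C\<^esub> f)) = amap G (amap F g) \<cdot>\<^bsub>E\<^esub> amap G (amap F f)"
    if "f \<in> hom C A B" "g \<in> hom C B K" for A B K f g
    using that functor_compose[OF assms(1) that]
      functor_compose[OF assms(2) functor_hom[OF assms(1) that(1)] functor_hom[OF assms(1) that(2)]]
    by simp
  then show ?thesis
    using assms functor_hom[OF assms(2) functor_hom[OF assms(1)]]
    unfolding is_functor_def by auto
qed

lemma nat_transD:
  "nat_trans C D F G \<tau> \<Longrightarrow> A \<in> Obj C \<Longrightarrow> \<tau> A \<in> hom D (omap F A) (omap G A)"
  "nat_trans C D F G \<tau> \<Longrightarrow> f \<in> hom C A B \<Longrightarrow> \<tau> B \<cdot>\<^bsub>D\<^esub> amap F f = amap G f \<cdot>\<^bsub>D\<^esub> \<tau> A"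
  by (simp_all add: nat_trans_def)

lemma nat_iso_inverse:
  assumes F: "is_functor C D F" and G: "is_functor C D G" and iso: "nat_iso C D F G \<tau>"
  obtains \<sigma> where "nat_trans C D G F \<sigma>"
    and "\<And>A. A \<in> Obj C \<Longrightarrow> \<sigma> A \<cdot>\<^bsub>D\<^esub> \<tau> A = Ide D (omap F A)"
    and "\<And>A. A \<in> Obj C \<Longrightarrow> \<tau> A \<cdot>\<^bsub>D\<^esub> \<sigma> A = Ide D (omap G A)"
proof -
  interpret D: category D using F by (rule functor_cats)
  have C: "category C" using F by (rule functor_cats)
  have nt: "nat_trans C D F G \<tau>" using iso by (simp add: nat_iso_def)
  have "\<forall>A\<in>Obj C. \<exists>g. g \<in> hom D (omap G A) (omap F A) \<and>
      g \<cdot>\<^bsub>D\<^esub> \<tau> A = Ide D (omap F A) \<and> \<tau> A \<cdot>\<^bsub>D\<^esub> g = Ide D (omap G A)"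
    using iso by (auto simp: nat_iso_def isomorphism_def)
  then obtain \<sigma> where \<sigma>: "\<And>A. A \<in> Obj C \<Longrightarrow> \<sigma> A \<in> hom D (omap G A) (omap F A) \<and>
      \<sigma> A \<cdot>\<^bsub>D\<^esub> \<tau> A = Ide D (omap F A) \<and> \<tau> A \<cdot>\<^bsub>D\<^esub> \<sigma> A = Ide D (omap G A)"
    by metis
  have "\<sigma> B \<cdot>\<^bsub>D\<^esub> amap G f = amap F f \<cdot>\<^bsub>D\<^esub> \<sigma> A" if f: "f \<in> hom C A B" for A B f
  proof -
    note AB = homD[OF C f]
    have s: "\<sigma> A \<in> hom D (omap G A) (omap F A)" "\<sigma> B \<in> hom D (omap G B) (omap F B)"
      using \<sigma> AB by simp_all
    note t = nat_transD(1)[OF nt AB(1)] nat_transD(1)[OF nt AB(2)]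
    note Ff = functor_hom[OF F f] and Gf = functor_hom[OF G f]
    have "\<sigma> B \<cdot>\<^bsub>D\<^esub> amap G f = \<sigma> B \<cdot>\<^bsub>D\<^esub> (amap G f \<cdot>\<^bsub>D\<^esub> (\<tau> A \<cdot>\<^bsub>D\<^esub> \<sigma> A))"
      using \<sigma>[OF AB(1)] D.Comp_Ide_right[OF Gf] by simp
    also have "\<dots> = \<sigma> B \<cdot>\<^bsub>D\<^esub> ((\<tau> B \<cdot>\<^bsub>D\<^esub> amap F f) \<cdot>\<^bsub>D\<^esub> \<sigma> A)"
      using D.Comp_assoc[OF s(1) t(1) Gf] nat_transD(2)[OF nt f] by simp
    also have "\<dots> = (\<sigma> B \<cdot>\<^bsub>D\<^esub> \<tau> B) \<cdot>\<^bsub>D\<^esub> (amap F f \<cdot>\<^bsub>D\<^esub> \<sigma> A)"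
      using D.Comp_assoc[OF s(1) Ff t(2)] D.Comp_assoc[OF D.Comp_hom[OF s(1) Ff] t(2) s(2)] by simp
    also have "\<dots> = amap F f \<cdot>\<^bsub>D\<^esub> \<sigma> A"
      using \<sigma>[OF AB(2)] D.Comp_Ide_left[OF D.Comp_hom[OF s(1) Ff]] by simp
    finally show ?thesis .
  qed
  then have "nat_trans C D G F \<sigma>" using \<sigma> by (simp add: nat_trans_def)
  then show ?thesis using that \<sigma> by blast
qed

text \<open>
  Below, the transpose of \<open>f : L A \<rightarrow> B\<close> is \<open>R f \<cdot> \<eta> A\<close>, and that of \<open>g : A \<rightarrow> R B\<close> in the other
  direction is \<open>\<epsilon> B \<cdot> L g\<close>.  Most equations between maps out of \<open>L A\<close> are proved by comparing
  transposes.
\<close>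

locale adjoint_pair =
  fixes C :: "('o, 'a) cat" and D :: "('p, 'b) cat" and T :: "('o, 'a, 'p, 'b) adj"
  assumes adj: "adjunction C D T"
begin

abbreviation "L \<equiv> ladj T"
abbreviation "R \<equiv> radj T"
abbreviation "\<eta> \<equiv> adj_unit T"
abbreviation "\<epsilon> \<equiv> adj_counit T"

lemma L: "is_functor C D L" and R: "is_functor D C R"
  using adj by (simp_all add: adjunction_def)

sublocale C: category C using L by (rule functor_cats)
sublocale D: category D using L by (rule functor_cats)

lemma unit_hom: "A \<in> Obj C \<Longrightarrow> \<eta> A \<in> hom C A (omap R (omap L A))"
  and unit_natural: "f \<in> hom C A A' \<Longrightarrow> \<eta> A' \<cdot>\<^bsub>C\<^esub> f = amap R (amap L f) \<cdot>\<^bsub>C\<^esub> \<eta> A"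
  and counit_hom: "B \<in> Obj D \<Longrightarrow> \<epsilon> B \<in> hom D (omap L (omap R B)) B"
  and counit_natural: "g \<in> hom D B B' \<Longrightarrow> \<epsilon> B' \<cdot>\<^bsub>D\<^esub> amap L (amap R g) = g \<cdot>\<^bsub>D\<^esub> \<epsilon> B"
  and triangle_left: "A \<in> Obj C \<Longrightarrow> \<epsilon> (omap L A) \<cdot>\<^bsub>D\<^esub> amap L (\<eta> A) = Ide D (omap L A)"
  and triangle_right: "B \<in> Obj D \<Longrightarrow> amap R (\<epsilon> B) \<cdot>\<^bsub>C\<^esub> \<eta> (omap R B) = Ide C (omap R B)"
  using adj by (simp_all add: adjunction_def nat_trans_def)

lemma transpose_untranspose:
  assumes B: "B \<in> Obj D" and g: "g \<in> hom C A (omap R B)"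
  shows "amap R (\<epsilon> B \<cdot>\<^bsub>D\<^esub> amap L g) \<cdot>\<^bsub>C\<^esub> \<eta> A = g"
proof -
  note A = homD(1)[OF C.category_axioms g]
  note RB = functor_obj[OF R B]
  note Lg = functor_hom[OF L g]
  have "amap R (\<epsilon> B \<cdot>\<^bsub>D\<^esub> amap L g) \<cdot>\<^bsub>C\<^esub> \<eta> A
      = (amap R (\<epsilon> B) \<cdot>\<^bsub>C\<^esub> amap R (amap L g)) \<cdot>\<^bsub>C\<^esub> \<eta> A"
    using functor_compose[OF R Lg counit_hom[OF B]] by simp
  also have "\<dots> = amap R (\<epsilon> B) \<cdot>\<^bsub>C\<^esub> (amap R (amap L g) \<cdot>\<^bsub>C\<^esub> \<eta> A)"
    by (rule C.Comp_assoc[OF unit_hom[OF A] functor_hom[OF R Lg]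
          functor_hom[OF R counit_hom[OF B]]])
  also have "\<dots> = amap R (\<epsilon> B) \<cdot>\<^bsub>C\<^esub> (\<eta> (omap R B) \<cdot>\<^bsub>C\<^esub> g)"
    using unit_natural[OF g] by simp
  also have "\<dots> = (amap R (\<epsilon> B) \<cdot>\<^bsub>C\<^esub> \<eta> (omap R B)) \<cdot>\<^bsub>C\<^esub> g"
    by (rule C.Comp_assoc[OF g unit_hom[OF RB] functor_hom[OF R counit_hom[OF B]], symmetric])
  also have "\<dots> = g" using triangle_right[OF B] C.Comp_Ide_left[OF g] by simp
  finally show ?thesis .
qed

lemma untranspose_transpose:
  assumes A: "A \<in> Obj C" and f: "f \<in> hom D (omap L A) B"
  shows "\<epsilon> B \<cdot>\<^bsub>D\<^esub> amap L (amap R f \<cdot>\<^bsub>C\<^esub> \<eta> A) = f"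
proof -
  note B = homD(2)[OF D.category_axioms f]
  note LA = functor_obj[OF L A]
  note Rf = functor_hom[OF R f]
  have "\<epsilon> B \<cdot>\<^bsub>D\<^esub> amap L (amap R f \<cdot>\<^bsub>C\<^esub> \<eta> A)
      = \<epsilon> B \<cdot>\<^bsub>D\<^esub> (amap L (amap R f) \<cdot>\<^bsub>D\<^esub> amap L (\<eta> A))"
    using functor_compose[OF L unit_hom[OF A] Rf] by simp
  also have "\<dots> = (\<epsilon> B \<cdot>\<^bsub>D\<^esub> amap L (amap R f)) \<cdot>\<^bsub>D\<^esub> amap L (\<eta> A)"
    by (rule D.Comp_assoc[OF functor_hom[OF L unit_hom[OF A]] functor_hom[OF L Rf]
          counit_hom[OF B], symmetric])
  also have "\<dots> = (f \<cdot>\<^bsub>D\<^esub> \<epsilon> (omap L A)) \<cdot>\<^bsub>D\<^esub> amap L (\<eta> A)"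
    using counit_natural[OF f] by simp
  also have "\<dots> = f \<cdot>\<^bsub>D\<^esub> (\<epsilon> (omap L A) \<cdot>\<^bsub>D\<^esub> amap L (\<eta> A))"
    by (rule D.Comp_assoc[OF functor_hom[OF L unit_hom[OF A]] counit_hom[OF LA] f])
  also have "\<dots> = f" using triangle_left[OF A] D.Comp_Ide_right[OF f] by simp
  finally show ?thesis .
qed

lemma transpose_inj:
  assumes "A \<in> Obj C" "f \<in> hom D (omap L A) B" "f' \<in> hom D (omap L A) B"
    and "amap R f \<cdot>\<^bsub>C\<^esub> \<eta> A = amap R f' \<cdot>\<^bsub>C\<^esub> \<eta> A"
  shows "f = f'"
  using untranspose_transpose[OF assms(1,2)] untranspose_transpose[OF assms(1,3)] assms(4) by metis

lemma transpose_precompose: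
  assumes a: "a \<in> hom C A A'" and f: "f \<in> hom D (omap L A') B"
  shows "amap R (f \<cdot>\<^bsub>D\<^esub> amap L a) \<cdot>\<^bsub>C\<^esub> \<eta> A = (amap R f \<cdot>\<^bsub>C\<^esub> \<eta> A') \<cdot>\<^bsub>C\<^esub> a"
proof -
  note AA = homD[OF C.category_axioms a]
  note La = functor_hom[OF L a]
  have "amap R (f \<cdot>\<^bsub>D\<^esub> amap L a) \<cdot>\<^bsub>C\<^esub> \<eta> A = (amap R f \<cdot>\<^bsub>C\<^esub> amap R (amap L a)) \<cdot>\<^bsub>C\<^esub> \<eta> A"
    using functor_compose[OF R La f] by simp
  also have "\<dots> = amap R f \<cdot>\<^bsub>C\<^esub> (amap R (amap L a) \<cdot>\<^bsub>C\<^esub> \<eta> A)"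
    by (rule C.Comp_assoc[OF unit_hom[OF AA(1)] functor_hom[OF R La] functor_hom[OF R f]])
  also have "\<dots> = amap R f \<cdot>\<^bsub>C\<^esub> (\<eta> A' \<cdot>\<^bsub>C\<^esub> a)"
    using unit_natural[OF a] by simp
  also have "\<dots> = (amap R f \<cdot>\<^bsub>C\<^esub> \<eta> A') \<cdot>\<^bsub>C\<^esub> a"
    by (rule C.Comp_assoc[OF a unit_hom[OF AA(2)] functor_hom[OF R f], symmetric])
  finally show ?thesis .
qed

lemma transpose_postcompose:
  assumes A: "A \<in> Obj C" and f: "f \<in> hom D (omap L A) B" and g: "g \<in> hom D B B'"
  shows "amap R (g \<cdot>\<^bsub>D\<^esub> f) \<cdot>\<^bsub>C\<^esub> \<eta> A = amap R g \<cdot>\<^bsub>C\<^esub> (amap R f \<cdot>\<^bsub>C\<^esub> \<eta> A)"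
  using functor_compose[OF R f g]
    C.Comp_assoc[OF unit_hom[OF A] functor_hom[OF R f] functor_hom[OF R g]] by simp

lemma transpose_hom:
  assumes "A \<in> Obj C" "f \<in> hom D (omap L A) B"
  shows "amap R f \<cdot>\<^bsub>C\<^esub> \<eta> A \<in> hom C A (omap R B)"
  by (rule C.Comp_hom[OF unit_hom[OF assms(1)] functor_hom[OF R assms(2)]])

lemma transpose_ide:
  assumes "A \<in> Obj C"
  shows "amap R (Ide D (omap L A)) \<cdot>\<^bsub>C\<^esub> \<eta> A = \<eta> A"
  using functor_ide[OF R functor_obj[OF L assms]] C.Comp_Ide_left[OF unit_hom[OF assms]] by simp

end

text \<open>
  Two maps out of \<open>L A\<close> agree as soon as their transposes do.  Naturality of the counit and the
  triangle identity at \<open>L A\<close> are equations between such maps, and after transposition they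
  become consequences of the other triangle identity.
\<close>

lemma adjunctionI_universal:
  fixes C :: "('o, 'a) cat" and D :: "('p, 'b) cat" and T :: "('o, 'a, 'p, 'b) adj"
  assumes L: "is_functor C D (ladj T)" and R: "is_functor D C (radj T)"
    and unit: "nat_trans C C id_functor (radj T \<circ>\<^sub>F ladj T) (adj_unit T)"
    and counit: "\<And>B. B \<in> Obj D \<Longrightarrow> adj_counit T B \<in> hom D (omap (ladj T) (omap (radj T) B)) B"
    and tri: "\<And>B. B \<in> Obj D \<Longrightarrow>
      amap (radj T) (adj_counit T B) \<cdot>\<^bsub>C\<^esub> adj_unit T (omap (radj T) B) = Ide C (omap (radj T) B)"
    and inj: "\<And>A B f f'. A \<in> Obj C \<Longrightarrow> f \<in> hom D (omap (ladj T) A) B \<Longrightarrow>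
      f' \<in> hom D (omap (ladj T) A) B \<Longrightarrow>
      amap (radj T) f \<cdot>\<^bsub>C\<^esub> adj_unit T A = amap (radj T) f' \<cdot>\<^bsub>C\<^esub> adj_unit T A \<Longrightarrow> f = f'"
  shows "adjunction C D T"
proof -
  interpret C: category C using L by (rule functor_cats)
  interpret D: category D using L by (rule functor_cats)
  let ?L = "ladj T" and ?R = "radj T" and ?h = "adj_unit T" and ?e = "adj_counit T"
  have h: "A \<in> Obj C \<Longrightarrow> ?h A \<in> hom C A (omap ?R (omap ?L A))" for A
    using nat_transD(1)[OF unit] by simp
  have hn: "f \<in> hom C A A' \<Longrightarrow> ?h A' \<cdot>\<^bsub>C\<^esub> f = amap ?R (amap ?L f) \<cdot>\<^bsub>C\<^esub> ?h A" for f A A'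
    using nat_transD(2)[OF unit] by simp
  have pre: "amap ?R (f \<cdot>\<^bsub>D\<^esub> amap ?L a) \<cdot>\<^bsub>C\<^esub> ?h A = (amap ?R f \<cdot>\<^bsub>C\<^esub> ?h A') \<cdot>\<^bsub>C\<^esub> a"
    if a: "a \<in> hom C A A'" and f: "f \<in> hom D (omap ?L A') B" for a A A' f B
  proof -
    note AA = homD[OF C.category_axioms a]
    note La = functor_hom[OF L a]
    have "amap ?R (f \<cdot>\<^bsub>D\<^esub> amap ?L a) \<cdot>\<^bsub>C\<^esub> ?h A
        = (amap ?R f \<cdot>\<^bsub>C\<^esub> amap ?R (amap ?L a)) \<cdot>\<^bsub>C\<^esub> ?h A"
      using functor_compose[OF R La f] by simp
    also have "\<dots> = amap ?R f \<cdot>\<^bsub>C\<^esub> (amap ?R (amap ?L a) \<cdot>\<^bsub>C\<^esub> ?h A)"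
      by (rule C.Comp_assoc[OF h[OF AA(1)] functor_hom[OF R La] functor_hom[OF R f]])
    also have "\<dots> = amap ?R f \<cdot>\<^bsub>C\<^esub> (?h A' \<cdot>\<^bsub>C\<^esub> a)"
      using hn[OF a] by simp
    also have "\<dots> = (amap ?R f \<cdot>\<^bsub>C\<^esub> ?h A') \<cdot>\<^bsub>C\<^esub> a"
      by (rule C.Comp_assoc[OF a h[OF AA(2)] functor_hom[OF R f], symmetric])
    finally show ?thesis .
  qed
  have "?e B' \<cdot>\<^bsub>D\<^esub> amap ?L (amap ?R g) = g \<cdot>\<^bsub>D\<^esub> ?e B" if g: "g \<in> hom D B B'" for g B B'
  proof (rule inj)
    note BB = homD[OF D.category_axioms g]
    note Rg = functor_hom[OF R g]
    note RB = functor_obj[OF R BB(1)]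
    show "omap ?R B \<in> Obj C" by (rule RB)
    show "?e B' \<cdot>\<^bsub>D\<^esub> amap ?L (amap ?R g) \<in> hom D (omap ?L (omap ?R B)) B'"
      by (rule D.Comp_hom[OF functor_hom[OF L Rg] counit[OF BB(2)]])
    show "g \<cdot>\<^bsub>D\<^esub> ?e B \<in> hom D (omap ?L (omap ?R B)) B'"
      by (rule D.Comp_hom[OF counit[OF BB(1)] g])
    have "amap ?R (?e B' \<cdot>\<^bsub>D\<^esub> amap ?L (amap ?R g)) \<cdot>\<^bsub>C\<^esub> ?h (omap ?R B) = amap ?R g"
      using pre[OF Rg counit[OF BB(2)]] tri[OF BB(2)] C.Comp_Ide_left[OF Rg] by simp
    moreover have "amap ?R (g \<cdot>\<^bsub>D\<^esub> ?e B) \<cdot>\<^bsub>C\<^esub> ?h (omap ?R B) = amap ?R g"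
      using functor_compose[OF R counit[OF BB(1)] g] tri[OF BB(1)] C.Comp_Ide_right[OF Rg]
        C.Comp_assoc[OF h[OF RB] functor_hom[OF R counit[OF BB(1)]] Rg] by simp
    ultimately show "amap ?R (?e B' \<cdot>\<^bsub>D\<^esub> amap ?L (amap ?R g)) \<cdot>\<^bsub>C\<^esub> ?h (omap ?R B)
        = amap ?R (g \<cdot>\<^bsub>D\<^esub> ?e B) \<cdot>\<^bsub>C\<^esub> ?h (omap ?R B)" by simp
  qed
  moreover have "?e (omap ?L A) \<cdot>\<^bsub>D\<^esub> amap ?L (?h A) = Ide D (omap ?L A)" if A: "A \<in> Obj C" for A
  proof (rule inj[OF A])
    note LA = functor_obj[OF L A]
    show "?e (omap ?L A) \<cdot>\<^bsub>D\<^esub> amap ?L (?h A) \<in> hom D (omap ?L A) (omap ?L A)"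
      by (rule D.Comp_hom[OF functor_hom[OF L h[OF A]] counit[OF LA]])
    show "Ide D (omap ?L A) \<in> hom D (omap ?L A) (omap ?L A)" by (rule D.Ide_hom[OF LA])
    show "amap ?R (?e (omap ?L A) \<cdot>\<^bsub>D\<^esub> amap ?L (?h A)) \<cdot>\<^bsub>C\<^esub> ?h A
        = amap ?R (Ide D (omap ?L A)) \<cdot>\<^bsub>C\<^esub> ?h A"
      using pre[OF h[OF A] counit[OF LA]] tri[OF LA] functor_ide[OF R LA] by simp
  qed
  ultimately show ?thesis
    using L R unit counit tri by (simp add: adjunction_def nat_trans_def)
qed

lemma adj_comp_simps [simp]:
  "ladj (adj_comp C E T T') = ladj T' \<circ>\<^sub>F ladj T"
  "radj (adj_comp C E T T') = radj T \<circ>\<^sub>F radj T'"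
  "adj_unit (adj_comp C E T T') A = amap (radj T) (adj_unit T' (omap (ladj T) A)) \<cdot>\<^bsub>C\<^esub> adj_unit T A"
  "adj_counit (adj_comp C E T T') Z =
     adj_counit T' Z \<cdot>\<^bsub>E\<^esub> amap (ladj T') (adj_counit T (omap (radj T') Z))"
  by (simp_all add: adj_comp_def)

lemma adjunction_comp:
  assumes "adjunction C D T" "adjunction D E T'"
  shows "adjunction C E (adj_comp C E T T')"
proof -
  interpret T: adjoint_pair C D T by unfold_locales fact
  interpret T': adjoint_pair D E T' by unfold_locales fact
  have unit_hom: "amap T.R (T'.\<eta> (omap T.L A)) \<cdot>\<^bsub>C\<^esub> T.\<eta> A
      \<in> hom C A (omap T.R (omap T'.R (omap T'.L (omap T.L A))))" if "A \<in> Obj C" for A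
    by (rule T.transpose_hom[OF that T'.unit_hom[OF functor_obj[OF T.L that]]])
  \<comment> \<open>transposing along the composite is transposing twice\<close>
  have twice: "amap T.R (amap T'.R f) \<cdot>\<^bsub>C\<^esub> (amap T.R (T'.\<eta> (omap T.L A)) \<cdot>\<^bsub>C\<^esub> T.\<eta> A)
      = amap T.R (amap T'.R f \<cdot>\<^bsub>D\<^esub> T'.\<eta> (omap T.L A)) \<cdot>\<^bsub>C\<^esub> T.\<eta> A"
    if A: "A \<in> Obj C" and f: "f \<in> hom E (omap T'.L (omap T.L A)) B" for A B f
    by (rule T.transpose_postcompose[OF A T'.unit_hom[OF functor_obj[OF T.L A]]
          functor_hom[OF T'.R f], symmetric])
  let ?T = "adj_comp C E T T'"
  have unit: "nat_trans C C id_functor (radj ?T \<circ>\<^sub>F ladj ?T) (adj_unit ?T)"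
  proof -
    have "(amap T.R (T'.\<eta> (omap T.L A')) \<cdot>\<^bsub>C\<^esub> T.\<eta> A') \<cdot>\<^bsub>C\<^esub> f
      = amap T.R (amap T'.R (amap T'.L (amap T.L f))) \<cdot>\<^bsub>C\<^esub>
          (amap T.R (T'.\<eta> (omap T.L A)) \<cdot>\<^bsub>C\<^esub> T.\<eta> A)" if f: "f \<in> hom C A A'" for f A A'
    proof -
      note AA = homD[OF T.C.category_axioms f]
      note Lf = functor_hom[OF T.L f]
      have "(amap T.R (T'.\<eta> (omap T.L A')) \<cdot>\<^bsub>C\<^esub> T.\<eta> A') \<cdot>\<^bsub>C\<^esub> f
          = amap T.R (T'.\<eta> (omap T.L A') \<cdot>\<^bsub>D\<^esub> amap T.L f) \<cdot>\<^bsub>C\<^esub> T.\<eta> A"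
        by (rule T.transpose_precompose[OF f T'.unit_hom[OF functor_obj[OF T.L AA(2)]], symmetric])
      then show ?thesis
        using twice[OF AA(1) functor_hom[OF T'.L Lf]] T'.unit_natural[OF Lf] by simp
    qed
    then show ?thesis using unit_hom by (simp add: nat_trans_def)
  qed
  have counit: "adj_counit ?T B \<in> hom E (omap (ladj ?T) (omap (radj ?T) B)) B" if B: "B \<in> Obj E" for B
    using T'.D.Comp_hom[OF functor_hom[OF T'.L T.counit_hom[OF functor_obj[OF T'.R B]]] T'.counit_hom[OF B]]
    by simp
  have tri: "amap (radj ?T) (adj_counit ?T B) \<cdot>\<^bsub>C\<^esub> adj_unit ?T (omap (radj ?T) B)
      = Ide C (omap (radj ?T) B)" if B: "B \<in> Obj E" for B
  proof -
    note RB = functor_obj[OF T'.R B]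
    note ceh = T.counit_hom[OF RB]
    note ty = T'.D.Comp_hom[OF functor_hom[OF T'.L ceh] T'.counit_hom[OF B]]
    show ?thesis
      using twice[OF functor_obj[OF T.R RB] ty] T'.transpose_untranspose[OF B ceh]
        T.triangle_right[OF RB] by simp
  qed
  have inj: "f = f'"
    if A: "A \<in> Obj C" and "f \<in> hom E (omap (ladj ?T) A) B" "f' \<in> hom E (omap (ladj ?T) A) B"
      and "amap (radj ?T) f \<cdot>\<^bsub>C\<^esub> adj_unit ?T A = amap (radj ?T) f' \<cdot>\<^bsub>C\<^esub> adj_unit ?T A" for A B f f'
  proof -
    note LA = functor_obj[OF T.L A]
    have f: "f \<in> hom E (omap T'.L (omap T.L A)) B" "f' \<in> hom E (omap T'.L (omap T.L A)) B"
      using that by simp_all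
    have "amap T.R (amap T'.R f \<cdot>\<^bsub>D\<^esub> T'.\<eta> (omap T.L A)) \<cdot>\<^bsub>C\<^esub> T.\<eta> A
        = amap T.R (amap T'.R f' \<cdot>\<^bsub>D\<^esub> T'.\<eta> (omap T.L A)) \<cdot>\<^bsub>C\<^esub> T.\<eta> A"
      using that(4) twice[OF A f(1)] twice[OF A f(2)] by simp
    then have "amap T'.R f \<cdot>\<^bsub>D\<^esub> T'.\<eta> (omap T.L A) = amap T'.R f' \<cdot>\<^bsub>D\<^esub> T'.\<eta> (omap T.L A)"
      by (rule T.transpose_inj[OF A T'.transpose_hom[OF LA f(1)] T'.transpose_hom[OF LA f(2)]])
    then show ?thesis by (rule T'.transpose_inj[OF LA f])
  qed
  show ?thesis
    by (rule adjunctionI_universal[OF _ _ unit counit tri inj])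
      (simp_all add: is_functor_comp[OF T.L T'.L] is_functor_comp[OF T'.R T.R])
qed

text \<open>
  Keep the left adjoint and compose its unit and counit with the isomorphism \<open>\<psi>\<close> and its inverse
  \<open>\<chi>\<close>: the transpose for \<open>G\<close> is then the old transpose followed by \<open>\<psi>\<close>.
\<close>

lemma adjunction_transport:
  assumes adj: "adjunction C D S" and G: "is_functor D C G"
    and \<psi>: "nat_iso D C (radj S) G \<psi>"
  shows "\<exists>T. adjunction C D T \<and> radj T = G"
proof -
  interpret S: adjoint_pair C D S by unfold_locales fact
  obtain \<chi> where \<chi>: "nat_trans D C G S.R \<chi>"
    and left: "\<And>B. B \<in> Obj D \<Longrightarrow> \<chi> B \<cdot>\<^bsub>C\<^esub> \<psi> B = Ide C (omap S.R B)"
    and right: "\<And>B. B \<in> Obj D \<Longrightarrow> \<psi> B \<cdot>\<^bsub>C\<^esub> \<chi> B = Ide C (omap G B)"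
    using nat_iso_inverse[OF S.R G \<psi>] by blast
  have \<psi>': "nat_trans D C S.R G \<psi>" using \<psi> by (simp add: nat_iso_def)
  note \<psi>h = nat_transD(1)[OF \<psi>'] and \<chi>h = nat_transD(1)[OF \<chi>]
  let ?T = "\<lparr>ladj = S.L, radj = G, adj_unit = (\<lambda>A. \<psi> (omap S.L A) \<cdot>\<^bsub>C\<^esub> S.\<eta> A),
    adj_counit = (\<lambda>B. S.\<epsilon> B \<cdot>\<^bsub>D\<^esub> amap S.L (\<chi> B))\<rparr>"
  have tr: "amap G f \<cdot>\<^bsub>C\<^esub> (\<psi> (omap S.L A) \<cdot>\<^bsub>C\<^esub> S.\<eta> A) = \<psi> B \<cdot>\<^bsub>C\<^esub> (amap S.R f \<cdot>\<^bsub>C\<^esub> S.\<eta> A)"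
    if A: "A \<in> Obj C" and f: "f \<in> hom D (omap S.L A) B" for A B f
  proof -
    note LA = functor_obj[OF S.L A] and B = homD(2)[OF S.D.category_axioms f]
    show ?thesis
      using S.C.Comp_assoc[OF S.unit_hom[OF A] \<psi>h[OF LA] functor_hom[OF G f]]
        S.C.Comp_assoc[OF S.unit_hom[OF A] functor_hom[OF S.R f] \<psi>h[OF B]]
        nat_transD(2)[OF \<psi>' f] by simp
  qed
  have "adjunction C D ?T"
  proof (rule adjunctionI_universal; (unfold adj.simps functor_comp_simps)?)
    show "is_functor C D S.L" by (rule S.L)
    show "is_functor D C G" by (rule G)
    have "(\<psi> (omap S.L A') \<cdot>\<^bsub>C\<^esub> S.\<eta> A') \<cdot>\<^bsub>C\<^esub> f = amap G (amap S.L f) \<cdot>\<^bsub>C\<^esub> (\<psi> (omap S.L A) \<cdot>\<^bsub>C\<^esub> S.\<eta> A)"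
      if f: "f \<in> hom C A A'" for f A A'
    proof -
      note AA = homD[OF S.C.category_axioms f]
      show ?thesis
        using tr[OF AA(1) functor_hom[OF S.L f]] S.unit_natural[OF f]
          S.C.Comp_assoc[OF f S.unit_hom[OF AA(2)] \<psi>h[OF functor_obj[OF S.L AA(2)]]] by simp
    qed
    moreover have "\<psi> (omap S.L A) \<cdot>\<^bsub>C\<^esub> S.\<eta> A \<in> hom C A (omap G (omap S.L A))" if "A \<in> Obj C" for A
      by (rule S.C.Comp_hom[OF S.unit_hom[OF that] \<psi>h[OF functor_obj[OF S.L that]]])
    ultimately show "nat_trans C C id_functor (G \<circ>\<^sub>F S.L) (\<lambda>A. \<psi> (omap S.L A) \<cdot>\<^bsub>C\<^esub> S.\<eta> A)"
      by (simp add: nat_trans_def)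
  next
    fix B assume B: "B \<in> Obj D"
    show ty: "S.\<epsilon> B \<cdot>\<^bsub>D\<^esub> amap S.L (\<chi> B) \<in> hom D (omap S.L (omap G B)) B"
      by (rule S.D.Comp_hom[OF functor_hom[OF S.L \<chi>h[OF B]] S.counit_hom[OF B]])
    show "amap G (S.\<epsilon> B \<cdot>\<^bsub>D\<^esub> amap S.L (\<chi> B)) \<cdot>\<^bsub>C\<^esub> (\<psi> (omap S.L (omap G B)) \<cdot>\<^bsub>C\<^esub> S.\<eta> (omap G B))
        = Ide C (omap G B)"
      using tr[OF functor_obj[OF G B] ty] S.transpose_untranspose[OF B \<chi>h[OF B]] right[OF B] by simp
  next
    fix A B f f'
    assume A: "A \<in> Obj C" and f: "f \<in> hom D (omap S.L A) B" and f': "f' \<in> hom D (omap S.L A) B"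
      and eq: "amap G f \<cdot>\<^bsub>C\<^esub> (\<psi> (omap S.L A) \<cdot>\<^bsub>C\<^esub> S.\<eta> A) = amap G f' \<cdot>\<^bsub>C\<^esub> (\<psi> (omap S.L A) \<cdot>\<^bsub>C\<^esub> S.\<eta> A)"
    note B = homD(2)[OF S.D.category_axioms f]
    have cancel: "g = \<chi> B \<cdot>\<^bsub>C\<^esub> (\<psi> B \<cdot>\<^bsub>C\<^esub> g)" if "g \<in> hom C A (omap S.R B)" for g
      using S.C.Comp_assoc[OF that \<psi>h[OF B] \<chi>h[OF B]] left[OF B] S.C.Comp_Ide_left[OF that] by simp
    have "amap S.R f \<cdot>\<^bsub>C\<^esub> S.\<eta> A = amap S.R f' \<cdot>\<^bsub>C\<^esub> S.\<eta> A"
      using cancel[OF S.transpose_hom[OF A f]] cancel[OF S.transpose_hom[OF A f']]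
        eq tr[OF A f] tr[OF A f'] by simp
    then show "f = f'" by (rule S.transpose_inj[OF A f f'])
  qed
  then show ?thesis by (intro exI[of _ ?T]) simp
qed

text \<open>
  Left adjoints are unique: the component \<open>\<phi> A\<close> is the map \<open>L\<^sub>S A \<rightarrow> L\<^sub>T A\<close> whose transpose under \<open>S\<close>
  is the unit of \<open>T\<close> at \<open>A\<close> followed by the inverse of \<open>\<psi>\<close>, and its inverse arises in the same way
  with \<open>S\<close> and \<open>T\<close> exchanged.
\<close>

lemma adj_iso_of_radj_iso:
  assumes "adjunction C D S" "adjunction C D T" and \<psi>: "nat_iso D C (radj S) (radj T) \<psi>"
  shows "adj_iso C D S T"
proof -
  interpret S: adjoint_pair C D S by unfold_locales fact
  interpret T: adjoint_pair C D T by unfold_locales fact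
  obtain \<chi> where \<chi>: "nat_trans D C T.R S.R \<chi>"
    and left: "\<And>B. B \<in> Obj D \<Longrightarrow> \<chi> B \<cdot>\<^bsub>C\<^esub> \<psi> B = Ide C (omap S.R B)"
    and right: "\<And>B. B \<in> Obj D \<Longrightarrow> \<psi> B \<cdot>\<^bsub>C\<^esub> \<chi> B = Ide C (omap T.R B)"
    using nat_iso_inverse[OF S.R T.R \<psi>] by blast
  have \<psi>': "nat_trans D C S.R T.R \<psi>" using \<psi> by (simp add: nat_iso_def)
  note \<psi>h = nat_transD(1)[OF \<psi>'] and \<chi>h = nat_transD(1)[OF \<chi>]
  define \<phi> where "\<phi> A = S.\<epsilon> (omap T.L A) \<cdot>\<^bsub>D\<^esub> amap S.L (\<chi> (omap T.L A) \<cdot>\<^bsub>C\<^esub> T.\<eta> A)" for A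
  define \<phi>' where "\<phi>' A = T.\<epsilon> (omap S.L A) \<cdot>\<^bsub>D\<^esub> amap T.L (\<psi> (omap S.L A) \<cdot>\<^bsub>C\<^esub> S.\<eta> A)" for A
  have \<chi>\<eta>: "\<chi> (omap T.L A) \<cdot>\<^bsub>C\<^esub> T.\<eta> A \<in> hom C A (omap S.R (omap T.L A))" if "A \<in> Obj C" for A
    by (rule S.C.Comp_hom[OF T.unit_hom[OF that] \<chi>h[OF functor_obj[OF T.L that]]])
  have \<psi>\<eta>: "\<psi> (omap S.L A) \<cdot>\<^bsub>C\<^esub> S.\<eta> A \<in> hom C A (omap T.R (omap S.L A))" if "A \<in> Obj C" for A
    by (rule S.C.Comp_hom[OF S.unit_hom[OF that] \<psi>h[OF functor_obj[OF S.L that]]])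
  have \<phi>h: "\<phi> A \<in> hom D (omap S.L A) (omap T.L A)" if "A \<in> Obj C" for A
    unfolding \<phi>_def
    by (rule S.D.Comp_hom[OF functor_hom[OF S.L \<chi>\<eta>[OF that]] S.counit_hom[OF functor_obj[OF T.L that]]])
  have \<phi>'h: "\<phi>' A \<in> hom D (omap T.L A) (omap S.L A)" if "A \<in> Obj C" for A
    unfolding \<phi>'_def
    by (rule S.D.Comp_hom[OF functor_hom[OF T.L \<psi>\<eta>[OF that]] T.counit_hom[OF functor_obj[OF S.L that]]])
  have t\<phi>: "amap S.R (\<phi> A) \<cdot>\<^bsub>C\<^esub> S.\<eta> A = \<chi> (omap T.L A) \<cdot>\<^bsub>C\<^esub> T.\<eta> A" if "A \<in> Obj C" for A
    unfolding \<phi>_def by (rule S.transpose_untranspose[OF functor_obj[OF T.L that] \<chi>\<eta>[OF that]])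
  have t\<phi>': "amap T.R (\<phi>' A) \<cdot>\<^bsub>C\<^esub> T.\<eta> A = \<psi> (omap S.L A) \<cdot>\<^bsub>C\<^esub> S.\<eta> A" if "A \<in> Obj C" for A
    unfolding \<phi>'_def by (rule T.transpose_untranspose[OF functor_obj[OF S.L that] \<psi>\<eta>[OF that]])
  have \<psi>\<chi>: "\<psi> B \<cdot>\<^bsub>C\<^esub> (\<chi> B \<cdot>\<^bsub>C\<^esub> g) = g" if "B \<in> Obj D" "g \<in> hom C A (omap T.R B)" for A B g
    using S.C.Comp_assoc[OF that(2) \<chi>h[OF that(1)] \<psi>h[OF that(1)]] right[OF that(1)]
      S.C.Comp_Ide_left[OF that(2)] by simp
  have \<chi>\<psi>: "\<chi> B \<cdot>\<^bsub>C\<^esub> (\<psi> B \<cdot>\<^bsub>C\<^esub> g) = g" if "B \<in> Obj D" "g \<in> hom C A (omap S.R B)" for A B g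
    using S.C.Comp_assoc[OF that(2) \<psi>h[OF that(1)] \<chi>h[OF that(1)]] left[OF that(1)]
      S.C.Comp_Ide_left[OF that(2)] by simp
  have \<chi>move: "amap S.R f \<cdot>\<^bsub>C\<^esub> (\<chi> B \<cdot>\<^bsub>C\<^esub> g) = \<chi> B' \<cdot>\<^bsub>C\<^esub> (amap T.R f \<cdot>\<^bsub>C\<^esub> g)"
    if f: "f \<in> hom D B B'" and g: "g \<in> hom C A (omap T.R B)" for f g A B B'
  proof -
    note BB = homD[OF S.D.category_axioms f]
    show ?thesis
      using S.C.Comp_assoc[OF g \<chi>h[OF BB(1)] functor_hom[OF S.R f]]
        S.C.Comp_assoc[OF g functor_hom[OF T.R f] \<chi>h[OF BB(2)]] nat_transD(2)[OF \<chi> f] by simp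
  qed
  have \<psi>move: "amap T.R f \<cdot>\<^bsub>C\<^esub> (\<psi> B \<cdot>\<^bsub>C\<^esub> g) = \<psi> B' \<cdot>\<^bsub>C\<^esub> (amap S.R f \<cdot>\<^bsub>C\<^esub> g)"
    if f: "f \<in> hom D B B'" and g: "g \<in> hom C A (omap S.R B)" for f g A B B'
  proof -
    note BB = homD[OF S.D.category_axioms f]
    show ?thesis
      using S.C.Comp_assoc[OF g \<psi>h[OF BB(1)] functor_hom[OF T.R f]]
        S.C.Comp_assoc[OF g functor_hom[OF S.R f] \<psi>h[OF BB(2)]] nat_transD(2)[OF \<psi>' f] by simp
  qed
  have unit: "T.\<eta> A = \<psi> (omap T.L A) \<cdot>\<^bsub>C\<^esub> amap S.R (\<phi> A) \<cdot>\<^bsub>C\<^esub> S.\<eta> A" if A: "A \<in> Obj C" for A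
    using t\<phi>[OF A] \<psi>\<chi>[OF functor_obj[OF T.L A] T.unit_hom[OF A]] by simp
  have natural: "\<phi> A' \<cdot>\<^bsub>D\<^esub> amap S.L a = amap T.L a \<cdot>\<^bsub>D\<^esub> \<phi> A" if a: "a \<in> hom C A A'" for a A A'
  proof -
    note A = homD[OF S.C.category_axioms a]
    note Ta = functor_hom[OF T.L a]
    note TA' = functor_obj[OF T.L A(2)]
    have "amap S.R (\<phi> A' \<cdot>\<^bsub>D\<^esub> amap S.L a) \<cdot>\<^bsub>C\<^esub> S.\<eta> A = \<chi> (omap T.L A') \<cdot>\<^bsub>C\<^esub> (T.\<eta> A' \<cdot>\<^bsub>C\<^esub> a)"
      using S.transpose_precompose[OF a \<phi>h[OF A(2)]] t\<phi>[OF A(2)]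
        S.C.Comp_assoc[OF a T.unit_hom[OF A(2)] \<chi>h[OF TA']] by simp
    also have "\<dots> = amap S.R (amap T.L a \<cdot>\<^bsub>D\<^esub> \<phi> A) \<cdot>\<^bsub>C\<^esub> S.\<eta> A"
      using S.transpose_postcompose[OF A(1) \<phi>h[OF A(1)] Ta] t\<phi>[OF A(1)]
        \<chi>move[OF Ta T.unit_hom[OF A(1)]] T.unit_natural[OF a] by simp
    finally show ?thesis
      by (rule S.transpose_inj[OF A(1) S.D.Comp_hom[OF functor_hom[OF S.L a] \<phi>h[OF A(2)]]
            S.D.Comp_hom[OF \<phi>h[OF A(1)] Ta]])
  qed
  have inv1: "\<phi>' A \<cdot>\<^bsub>D\<^esub> \<phi> A = Ide D (omap S.L A)" if A: "A \<in> Obj C" for A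
  proof (rule S.transpose_inj[OF A])
    show "\<phi>' A \<cdot>\<^bsub>D\<^esub> \<phi> A \<in> hom D (omap S.L A) (omap S.L A)"
      by (rule S.D.Comp_hom[OF \<phi>h[OF A] \<phi>'h[OF A]])
    show "Ide D (omap S.L A) \<in> hom D (omap S.L A) (omap S.L A)"
      by (rule S.D.Ide_hom[OF functor_obj[OF S.L A]])
    show "amap S.R (\<phi>' A \<cdot>\<^bsub>D\<^esub> \<phi> A) \<cdot>\<^bsub>C\<^esub> S.\<eta> A = amap S.R (Ide D (omap S.L A)) \<cdot>\<^bsub>C\<^esub> S.\<eta> A"
      using S.transpose_postcompose[OF A \<phi>h[OF A] \<phi>'h[OF A]] t\<phi>[OF A]
        \<chi>move[OF \<phi>'h[OF A] T.unit_hom[OF A]] t\<phi>'[OF A]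
        \<chi>\<psi>[OF functor_obj[OF S.L A] S.unit_hom[OF A]] S.transpose_ide[OF A] by simp
  qed
  have inv2: "\<phi> A \<cdot>\<^bsub>D\<^esub> \<phi>' A = Ide D (omap T.L A)" if A: "A \<in> Obj C" for A
  proof (rule T.transpose_inj[OF A])
    show "\<phi> A \<cdot>\<^bsub>D\<^esub> \<phi>' A \<in> hom D (omap T.L A) (omap T.L A)"
      by (rule S.D.Comp_hom[OF \<phi>'h[OF A] \<phi>h[OF A]])
    show "Ide D (omap T.L A) \<in> hom D (omap T.L A) (omap T.L A)"
      by (rule S.D.Ide_hom[OF functor_obj[OF T.L A]])
    show "amap T.R (\<phi> A \<cdot>\<^bsub>D\<^esub> \<phi>' A) \<cdot>\<^bsub>C\<^esub> T.\<eta> A = amap T.R (Ide D (omap T.L A)) \<cdot>\<^bsub>C\<^esub> T.\<eta> A"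
      using T.transpose_postcompose[OF A \<phi>'h[OF A] \<phi>h[OF A]] t\<phi>'[OF A]
        \<psi>move[OF \<phi>h[OF A] S.unit_hom[OF A]] t\<phi>[OF A]
        \<psi>\<chi>[OF functor_obj[OF T.L A] T.unit_hom[OF A]] T.transpose_ide[OF A] by simp
  qed
  have iso: "nat_iso C D S.L T.L \<phi>"
    using \<phi>h \<phi>'h natural inv1 inv2 unfolding nat_iso_def nat_trans_def isomorphism_def by blast
  have counit: "S.\<epsilon> B = T.\<epsilon> B \<cdot>\<^bsub>D\<^esub> \<phi> (omap T.R B) \<cdot>\<^bsub>D\<^esub> amap S.L (\<psi> B)" if B: "B \<in> Obj D" for B
  proof -
    note SB = functor_obj[OF S.R B] and TB = functor_obj[OF T.R B]
    note p = \<phi>h[OF TB] and e = T.counit_hom[OF B] and L\<psi> = functor_hom[OF S.L \<psi>h[OF B]]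
    note pL = S.D.Comp_hom[OF L\<psi> p]
    have "amap S.R (T.\<epsilon> B \<cdot>\<^bsub>D\<^esub> \<phi> (omap T.R B) \<cdot>\<^bsub>D\<^esub> amap S.L (\<psi> B)) \<cdot>\<^bsub>C\<^esub> S.\<eta> (omap S.R B)
        = amap S.R (T.\<epsilon> B) \<cdot>\<^bsub>C\<^esub> ((\<chi> (omap T.L (omap T.R B)) \<cdot>\<^bsub>C\<^esub> T.\<eta> (omap T.R B)) \<cdot>\<^bsub>C\<^esub> \<psi> B)"
      using S.transpose_postcompose[OF SB pL e] S.transpose_precompose[OF \<psi>h[OF B] p] t\<phi>[OF TB]
      by simp
    also have "\<dots> = (amap S.R (T.\<epsilon> B) \<cdot>\<^bsub>C\<^esub> (\<chi> (omap T.L (omap T.R B)) \<cdot>\<^bsub>C\<^esub> T.\<eta> (omap T.R B))) \<cdot>\<^bsub>C\<^esub> \<psi> B"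
      by (rule S.C.Comp_assoc[OF \<psi>h[OF B] \<chi>\<eta>[OF TB] functor_hom[OF S.R e], symmetric])
    also have "\<dots> = \<chi> B \<cdot>\<^bsub>C\<^esub> \<psi> B"
      using \<chi>move[OF e T.unit_hom[OF TB]] T.triangle_right[OF B] S.C.Comp_Ide_right[OF \<chi>h[OF B]] by simp
    also have "\<dots> = amap S.R (S.\<epsilon> B) \<cdot>\<^bsub>C\<^esub> S.\<eta> (omap S.R B)"
      using left[OF B] S.triangle_right[OF B] by simp
    finally show ?thesis
      by (intro S.transpose_inj[OF SB S.counit_hom[OF B] S.D.Comp_hom[OF pL e]]) simp
  qed
  show ?thesis
    unfolding adj_iso_def using iso \<psi> unit counit by blast
qed

section \<open>Categories of presheaves and slice categories\<close>

lemma category_full_subcategory: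
  assumes "category C"
  shows "category (full_subcategory C P)"
proof -
  interpret category C by fact
  have hom_iff [simp]: "f \<in> hom (full_subcategory C P) A B \<longleftrightarrow> f \<in> hom C A B \<and> P A \<and> P B" for f A B
    by (auto simp: hom_def full_subcategory_def)
  have simps [simp]: "Obj (full_subcategory C P) = {A \<in> Obj C. P A}"
    "Arr (full_subcategory C P) = {f \<in> Arr C. P (Dom C f) \<and> P (Cod C f)}"
    "Dom (full_subcategory C P) = Dom C" "Cod (full_subcategory C P) = Cod C"
    "Ide (full_subcategory C P) = Ide C" "Comp (full_subcategory C P) = Comp C"
    by (simp_all add: full_subcategory_def)
  show ?thesis
    by unfold_locales (auto intro: Ide_hom Comp_hom Comp_Ide_right Comp_Ide_left Comp_assoc Dom_Obj Cod_Obj)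
qed

lemma slice_obj: "f \<in> Obj (slice C S) \<longleftrightarrow> f \<in> Arr C \<and> Cod C f = S"
  by (simp add: slice_def)

lemma slice_simps [simp]:
  "Ide (slice C S) f = (f, Ide C (Dom C f), f)"
  "Comp (slice C S) (f', k, g) (f, h, g') = (f, k \<cdot>\<^bsub>C\<^esub> h, g)"
  by (simp_all add: slice_def)

lemma slice_hom_iff:
  "F \<in> hom (slice C S) f g \<longleftrightarrow>
    (\<exists>h. F = (f, h, g) \<and> f \<in> Arr C \<and> Cod C f = S \<and> g \<in> Arr C \<and> Cod C g = S \<and>
      h \<in> hom C (Dom C f) (Dom C g) \<and> g \<cdot>\<^bsub>C\<^esub> h = f)"
  by (auto simp: slice_def hom_def)

lemma category_slice:
  assumes "category C"
  shows "category (slice C S)"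
proof -
  interpret category C by fact
  have arr: "f \<in> hom C (Dom C f) (Cod C f)" if "f \<in> Arr C" for f
    using that by (simp add: hom_def)
  show ?thesis
  proof
    fix F f g E h H k
    show "Dom (slice C S) F \<in> Obj (slice C S)" "Cod (slice C S) F \<in> Obj (slice C S)"
      if "F \<in> Arr (slice C S)"
      using that by (auto simp: slice_def)
    show "Ide (slice C S) f \<in> hom (slice C S) f f" if "f \<in> Obj (slice C S)"
      using that Ide_hom[OF Dom_Obj] Comp_Ide_right[OF arr] by (auto simp: slice_hom_iff slice_obj)
    assume F: "F \<in> hom (slice C S) f g"
    show "Comp (slice C S) F (Ide (slice C S) f) = F" "Comp (slice C S) (Ide (slice C S) g) F = F"
      using F Comp_Ide_right Comp_Ide_left by (auto simp: slice_hom_iff)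
    assume E: "E \<in> hom (slice C S) g h"
    show "Comp (slice C S) E F \<in> hom (slice C S) f h"
    proof -
      obtain a b where ab: "F = (f, a, g)" "E = (g, b, h)" "f \<in> Arr C" "Cod C f = S" "g \<in> Arr C"
        "h \<in> Arr C" "Cod C h = S" "a \<in> hom C (Dom C f) (Dom C g)" "b \<in> hom C (Dom C g) (Dom C h)"
        "g \<cdot>\<^bsub>C\<^esub> a = f" "h \<cdot>\<^bsub>C\<^esub> b = g"
        using E F unfolding slice_hom_iff by blast
      have "h \<cdot>\<^bsub>C\<^esub> (b \<cdot>\<^bsub>C\<^esub> a) = f"
        using Comp_assoc[OF ab(8,9) arr[OF ab(6)]] ab(10,11) by simp
      then show ?thesis using ab Comp_hom[OF ab(8,9)] by (simp add: slice_hom_iff)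
    qed
    assume "H \<in> hom (slice C S) h k"
    with E F show "Comp (slice C S) (Comp (slice C S) H E) F = Comp (slice C S) H (Comp (slice C S) E F)"
      by (auto simp: slice_hom_iff intro: Comp_assoc)
  qed
qed

lemma psh_hom_in: "\<alpha> \<in> psh_hom C X Y \<Longrightarrow> c \<in> Obj C \<Longrightarrow> x \<in> Sec X c \<Longrightarrow> \<alpha> c x \<in> Sec Y c"
  by (auto simp: psh_hom_def PiE_iff)

lemma psh_hom_natural:
  "\<alpha> \<in> psh_hom C X Y \<Longrightarrow> m \<in> Arr C \<Longrightarrow> x \<in> Sec X (Cod C m) \<Longrightarrow>
    \<alpha> (Dom C m) (Res X m x) = Res Y m (\<alpha> (Cod C m) x)"
  by (auto simp: psh_hom_def)

lemma psh_hom_eqI: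
  assumes "\<alpha> \<in> psh_hom C X Y" "\<beta> \<in> psh_hom C X Y'"
    and "\<And>c x. c \<in> Obj C \<Longrightarrow> x \<in> Sec X c \<Longrightarrow> \<alpha> c x = \<beta> c x"
  shows "\<alpha> = \<beta>"
proof
  fix c
  show "\<alpha> c = \<beta> c"
  proof (cases "c \<in> Obj C")
    case True
    show ?thesis
    proof
      fix x
      have e: "\<alpha> c \<in> extensional (Sec X c)" "\<beta> c \<in> extensional (Sec X c)"
        using assms(1,2) True by (auto simp: psh_hom_def PiE_iff)
      show "\<alpha> c x = \<beta> c x"
      proof (cases "x \<in> Sec X c")
        case False
        then show ?thesis using e by (simp add: extensional_def)
      qed (simp add: assms(3) True)
    qed
  next
    case False
    then show ?thesis using assms(1,2) by (auto simp: psh_hom_def PiE_iff extensional_def)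
  qed
qed

lemma psh_hom_restrict: "\<alpha> \<in> psh_hom C X Y \<Longrightarrow> (\<lambda>c\<in>Obj C. \<lambda>x\<in>Sec X c. \<alpha> c x) = \<alpha>"
proof -
  assume a: "\<alpha> \<in> psh_hom C X Y"
  then have "c \<in> Obj C \<Longrightarrow> (\<lambda>x\<in>Sec X c. \<alpha> c x) = \<alpha> c" for c
    by (auto simp: psh_hom_def PiE_iff extensional_restrict)
  moreover have "\<alpha> \<in> extensional (Obj C)" using a by (auto simp: psh_hom_def PiE_iff)
  ultimately show ?thesis by (auto simp: extensional_def restrict_def)
qed

lemma presheaf_small: "presheaf small C X \<Longrightarrow> c \<in> Obj C \<Longrightarrow> small (Sec X c)"
  by (simp add: presheaf_def)

lemma presheaf_res_in:
  "presheaf small C X \<Longrightarrow> m \<in> Arr C \<Longrightarrow> x \<in> Sec X (Cod C m) \<Longrightarrow> Res X m x \<in> Sec X (Dom C m)"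
  by (auto simp: presheaf_def)

lemma presheaf_res_ide:
  "presheaf small C X \<Longrightarrow> c \<in> Obj C \<Longrightarrow> x \<in> Sec X c \<Longrightarrow> Res X (Ide C c) x = x"
  by (simp add: presheaf_def)

lemma presheaf_res_comp:
  "category C \<Longrightarrow> presheaf small C X \<Longrightarrow> f \<in> hom C a b \<Longrightarrow> g \<in> hom C b c \<Longrightarrow> x \<in> Sec X c \<Longrightarrow>
    Res X (g \<cdot>\<^bsub>C\<^esub> f) x = Res X f (Res X g x)"
  using homD[of C] unfolding presheaf_def by blast

lemma psh_homI:
  assumes C: "category C" and X: "presheaf small C X"
    and "\<And>c x. c \<in> Obj C \<Longrightarrow> x \<in> Sec X c \<Longrightarrow> a c x \<in> Sec Y c"
    and "\<And>m x. m \<in> Arr C \<Longrightarrow> x \<in> Sec X (Cod C m) \<Longrightarrow>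
      a (Dom C m) (Res X m x) = Res Y m (a (Cod C m) x)"
  shows "(\<lambda>c\<in>Obj C. \<lambda>x\<in>Sec X c. a c x) \<in> psh_hom C X Y"
  using assms presheaf_res_in[OF X] category.Dom_Obj[OF C] category.Cod_Obj[OF C]
  by (auto simp: psh_hom_def)

lemma psh_hom_comp:
  assumes "category C" "presheaf small C X" "\<alpha> \<in> psh_hom C X Y" "\<beta> \<in> psh_hom C Y Z"
  shows "(\<lambda>c\<in>Obj C. \<lambda>x\<in>Sec X c. \<beta> c (\<alpha> c x)) \<in> psh_hom C X Z"
  using assms by (intro psh_homI)
    (auto simp: psh_hom_natural psh_hom_in category.Cod_Obj category.Dom_Obj)

lemma psh_hom_ide:
  assumes "category C" "presheaf small C X"
  shows "(\<lambda>c\<in>Obj C. \<lambda>x\<in>Sec X c. x) \<in> psh_hom C X X"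
  using assms by (intro psh_homI) auto

lemma psh_cat_simps [simp]:
  "X \<in> Obj (psh_cat small C) \<longleftrightarrow> presheaf small C X"
  "Ide (psh_cat small C) X = (X, \<lambda>c\<in>Obj C. \<lambda>x\<in>Sec X c. x, X)"
  "Comp (psh_cat small C) (Y', \<beta>, Z) (X, \<alpha>, Y) = (X, \<lambda>c\<in>Obj C. \<lambda>x\<in>Sec X c. \<beta> c (\<alpha> c x), Z)"
  "Dom (psh_cat small C) (X, \<alpha>, Y) = X" "Cod (psh_cat small C) (X, \<alpha>, Y) = Y"
  "(X, \<alpha>, Y) \<in> Arr (psh_cat small C) \<longleftrightarrow>
    presheaf small C X \<and> presheaf small C Y \<and> \<alpha> \<in> psh_hom C X Y"
  by (simp_all add: psh_cat_def)

lemma psh_cat_hom_iff: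
  "f \<in> hom (psh_cat small C) X Y \<longleftrightarrow>
    (\<exists>\<alpha>. f = (X, \<alpha>, Y) \<and> presheaf small C X \<and> presheaf small C Y \<and> \<alpha> \<in> psh_hom C X Y)"
  by (cases f) (auto simp: hom_def)

lemma category_psh_cat:
  assumes "category C"
  shows "category (psh_cat small C)"
proof
  fix f X Y g Z h W
  show "Dom (psh_cat small C) f \<in> Obj (psh_cat small C)"
    "Cod (psh_cat small C) f \<in> Obj (psh_cat small C)" if "f \<in> Arr (psh_cat small C)"
    using that by (cases f; simp)+
  show "Ide (psh_cat small C) X \<in> hom (psh_cat small C) X X" if "X \<in> Obj (psh_cat small C)"
    using that psh_hom_ide[OF assms] by (auto simp: psh_cat_hom_iff)
  assume f: "f \<in> hom (psh_cat small C) X Y"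
  show "Comp (psh_cat small C) f (Ide (psh_cat small C) X) = f"
    "Comp (psh_cat small C) (Ide (psh_cat small C) Y) f = f"
    using f by (auto simp: psh_cat_hom_iff psh_hom_in psh_hom_restrict cong: restrict_cong)
  assume g: "g \<in> hom (psh_cat small C) Y Z"
  show "Comp (psh_cat small C) g f \<in> hom (psh_cat small C) X Z"
    using f g psh_hom_comp[OF assms] by (auto simp: psh_cat_hom_iff)
  assume "h \<in> hom (psh_cat small C) Z W"
  with f g show "Comp (psh_cat small C) (Comp (psh_cat small C) h g) f
      = Comp (psh_cat small C) h (Comp (psh_cat small C) g f)"
    by (auto simp: psh_cat_hom_iff psh_hom_in cong: restrict_cong)
qed

lemma presheafI:
  assumes "category C"
    and "Sec X = (\<lambda>c\<in>Obj C. S c)" and "Res X = (\<lambda>m\<in>Arr C. \<lambda>x\<in>S (Cod C m). r m x)"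
    and "\<And>c. c \<in> Obj C \<Longrightarrow> small (S c)"
    and "\<And>m x. m \<in> Arr C \<Longrightarrow> x \<in> S (Cod C m) \<Longrightarrow> r m x \<in> S (Dom C m)"
    and "\<And>c x. c \<in> Obj C \<Longrightarrow> x \<in> S c \<Longrightarrow> r (Ide C c) x = x"
    and "\<And>a b c f g x. f \<in> hom C a b \<Longrightarrow> g \<in> hom C b c \<Longrightarrow> x \<in> S c \<Longrightarrow> r (g \<cdot>\<^bsub>C\<^esub> f) x = r f (r g x)"
  shows "presheaf small C X"
proof -
  interpret category C by fact
  have ide: "Ide C c \<in> Arr C" "Cod C (Ide C c) = c" if "c \<in> Obj C" for c
    using Ide_hom[OF that] by (simp_all add: hom_def)
  have comp: "g \<cdot>\<^bsub>C\<^esub> f \<in> Arr C" "Cod C (g \<cdot>\<^bsub>C\<^esub> f) = c" if "f \<in> hom C a b" "g \<in> hom C b c" for a b c f g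
    using Comp_hom[OF that] by (simp_all add: hom_def)
  have "Res X (g \<cdot>\<^bsub>C\<^esub> f) x = Res X f (Res X g x)"
    if f: "f \<in> hom C a b" and g: "g \<in> hom C b c" and x: "x \<in> Sec X c" for a b c f g x
  proof -
    have c: "c \<in> Obj C" "g \<in> Arr C" "Cod C g = c" "Dom C g = b" "f \<in> Arr C" "Cod C f = b"
      using f g Cod_Obj by (auto simp: hom_def)
    then have "x \<in> S c" "r g x \<in> S b" using x assms(2) assms(5)[of g x] by auto
    then show ?thesis using assms(3) comp[OF f g] c assms(7)[OF f g] by simp
  qed
  then show ?thesis
    unfolding presheaf_def using assms(2-6) ide Dom_Obj Cod_Obj by (auto simp: PiE_iff)
qed

section \<open>Interval presheaves and sheaves\<close>

text \<open>
  The nonnegative reals and the natural numbers are treated together, as a set \<open>R\<close> of lengths that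
  contains \<open>0\<close> and is closed under addition.
\<close>

locale lengths =
  fixes R :: "real set"
  assumes zero: "0 \<in> R" and add: "a \<in> R \<Longrightarrow> b \<in> R \<Longrightarrow> a + b \<in> R" and nonneg: "a \<in> R \<Longrightarrow> 0 \<le> a"
begin

lemma int_cat_simps [simp]:
  "Obj (int_cat R) = R" "Dom (int_cat R) (l', p, l) = l'" "Cod (int_cat R) (l', p, l) = l"
  "Ide (int_cat R) l = (l, 0, l)"
  "(l', p, l) \<in> Arr (int_cat R) \<longleftrightarrow> l' \<in> R \<and> p \<in> R \<and> l \<in> R \<and> p + l' \<le> l"
  "Comp (int_cat R) (a, p, l) (l'', p', b) = (l'', p + p', l)"
  by (auto simp: int_cat_def)

lemma int_hom_iff:
  "m \<in> hom (int_cat R) l' l \<longleftrightarrow> (\<exists>p. m = (l', p, l) \<and> l' \<in> R \<and> p \<in> R \<and> l \<in> R \<and> p + l' \<le> l)"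
  by (cases m) (auto simp: hom_def)

lemma category_int: "category (int_cat R)"
proof
  fix f A B g D h E
  show "f \<in> Arr (int_cat R) \<Longrightarrow> Dom (int_cat R) f \<in> Obj (int_cat R)"
    "f \<in> Arr (int_cat R) \<Longrightarrow> Cod (int_cat R) f \<in> Obj (int_cat R)"
    by (cases f; simp)+
qed (auto simp: int_hom_iff zero add)

abbreviation psh where "psh small \<equiv> presheaf small (int_cat R)"
abbreviation hm where "hm \<equiv> psh_hom (int_cat R)"

lemma hm_in: "\<alpha> \<in> hm X Y \<Longrightarrow> l \<in> R \<Longrightarrow> x \<in> Sec X l \<Longrightarrow> \<alpha> l x \<in> Sec Y l"
  using psh_hom_in[of \<alpha> "int_cat R"] by simp

lemma hm_natural:
  "\<alpha> \<in> hm X Y \<Longrightarrow> l' \<in> R \<Longrightarrow> p \<in> R \<Longrightarrow> l \<in> R \<Longrightarrow> p + l' \<le> l \<Longrightarrow> x \<in> Sec X l \<Longrightarrow>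
    \<alpha> l' (Res X (l', p, l) x) = Res Y (l', p, l) (\<alpha> l x)"
  using psh_hom_natural[of \<alpha> "int_cat R" X Y "(l', p, l)"] by simp

lemma hm_eqI:
  "\<alpha> \<in> hm X Y \<Longrightarrow> \<beta> \<in> hm X Y' \<Longrightarrow> (\<And>l x. l \<in> R \<Longrightarrow> x \<in> Sec X l \<Longrightarrow> \<alpha> l x = \<beta> l x) \<Longrightarrow> \<alpha> = \<beta>"
  using psh_hom_eqI[of \<alpha> "int_cat R"] by simp

lemma hmI:
  assumes "psh small X" and "\<And>l x. l \<in> R \<Longrightarrow> x \<in> Sec X l \<Longrightarrow> a l x \<in> Sec Y l"
    and "\<And>l' p l x. l' \<in> R \<Longrightarrow> p \<in> R \<Longrightarrow> l \<in> R \<Longrightarrow> p + l' \<le> l \<Longrightarrow> x \<in> Sec X l \<Longrightarrow>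
      a l' (Res X (l', p, l) x) = Res Y (l', p, l) (a l x)"
  shows "(\<lambda>l\<in>R. \<lambda>x\<in>Sec X l. a l x) \<in> hm X Y"
  using psh_homI[OF category_int assms(1), of a Y] assms(2,3) by auto

lemma res_in:
  "psh small X \<Longrightarrow> l' \<in> R \<Longrightarrow> p \<in> R \<Longrightarrow> l \<in> R \<Longrightarrow> p + l' \<le> l \<Longrightarrow> x \<in> Sec X l \<Longrightarrow>
    Res X (l', p, l) x \<in> Sec X l'"
  using presheaf_res_in[of small "int_cat R" X "(l', p, l)"] by simp

lemma res_ide: "psh small X \<Longrightarrow> l \<in> R \<Longrightarrow> x \<in> Sec X l \<Longrightarrow> Res X (l, 0, l) x = x"
  using presheaf_res_ide[of small "int_cat R" X l] by simp

lemma res_res: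
  "psh small X \<Longrightarrow> l'' \<in> R \<Longrightarrow> p' \<in> R \<Longrightarrow> l' \<in> R \<Longrightarrow> p \<in> R \<Longrightarrow> l \<in> R \<Longrightarrow> p' + l'' \<le> l' \<Longrightarrow> p + l' \<le> l \<Longrightarrow>
    x \<in> Sec X l \<Longrightarrow> Res X (l'', p', l') (Res X (l', p, l) x) = Res X (l'', p + p', l) x"
  using presheaf_res_comp[OF category_int, of small X "(l'', p', l')" l'' l' "(l', p, l)" l x]
  by (simp add: int_hom_iff)

lemma psh_intI:
  assumes "Sec X = (\<lambda>l\<in>R. S l)"
    and "\<And>l' p l. l' \<in> R \<Longrightarrow> p \<in> R \<Longrightarrow> l \<in> R \<Longrightarrow> p + l' \<le> l \<Longrightarrow> Res X (l', p, l) = (\<lambda>x\<in>S l. r l' p l x)"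
    and "Res X \<in> extensional (Arr (int_cat R))"
    and "\<And>l. l \<in> R \<Longrightarrow> small (S l)"
    and "\<And>l' p l x. l' \<in> R \<Longrightarrow> p \<in> R \<Longrightarrow> l \<in> R \<Longrightarrow> p + l' \<le> l \<Longrightarrow> x \<in> S l \<Longrightarrow> r l' p l x \<in> S l'"
    and "\<And>l x. l \<in> R \<Longrightarrow> x \<in> S l \<Longrightarrow> r l 0 l x = x"
    and "\<And>l'' p' l' p l x. l'' \<in> R \<Longrightarrow> p' \<in> R \<Longrightarrow> l' \<in> R \<Longrightarrow> p \<in> R \<Longrightarrow> l \<in> R \<Longrightarrow>
      p' + l'' \<le> l' \<Longrightarrow> p + l' \<le> l \<Longrightarrow> x \<in> S l \<Longrightarrow> r l'' (p + p') l x = r l'' p' l' (r l' p l x)"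
  shows "psh small X"
proof (rule presheafI[where S = S and r = "\<lambda>(l', p, l). r l' p l", OF category_int])
  show "Res X = (\<lambda>m\<in>Arr (int_cat R). \<lambda>x\<in>S (Cod (int_cat R) m). (case m of (l', p, l) \<Rightarrow> r l' p l) x)"
    (is "_ = ?r")
  proof
    fix m show "Res X m = ?r m"
      using assms(2,3) by (cases m) (auto simp: extensional_def)
  qed
qed (use assms in \<open>auto simp: int_hom_iff\<close>)

lemma is_sheaf_glue:
  assumes "is_sheaf R X" "l\<^sub>1 \<in> R" "l\<^sub>2 \<in> R" "x\<^sub>1 \<in> Sec X l\<^sub>1" "x\<^sub>2 \<in> Sec X l\<^sub>2"
    and "Res X (0, l\<^sub>1, l\<^sub>1) x\<^sub>1 = Res X (0, 0, l\<^sub>2) x\<^sub>2"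
  obtains x where "x \<in> Sec X (l\<^sub>1 + l\<^sub>2)" "Res X (l\<^sub>1, 0, l\<^sub>1 + l\<^sub>2) x = x\<^sub>1" "Res X (l\<^sub>2, l\<^sub>1, l\<^sub>1 + l\<^sub>2) x = x\<^sub>2"
  using assms unfolding is_sheaf_def by metis

text \<open>
  The two restrictions of a section of length \<open>l\<^sub>1 + l\<^sub>2\<close> always match at the common endpoint, so the
  uniqueness clause of the sheaf condition applies to them.
\<close>

lemma is_sheaf_unique:
  assumes "is_sheaf R X" "psh small X" and l: "l\<^sub>1 \<in> R" "l\<^sub>2 \<in> R"
    and x: "x \<in> Sec X (l\<^sub>1 + l\<^sub>2)" "y \<in> Sec X (l\<^sub>1 + l\<^sub>2)"
    and "Res X (l\<^sub>1, 0, l\<^sub>1 + l\<^sub>2) x = Res X (l\<^sub>1, 0, l\<^sub>1 + l\<^sub>2) y"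
    and "Res X (l\<^sub>2, l\<^sub>1, l\<^sub>1 + l\<^sub>2) x = Res X (l\<^sub>2, l\<^sub>1, l\<^sub>1 + l\<^sub>2) y"
  shows "x = y"
proof -
  have in_R: "l\<^sub>1 + l\<^sub>2 \<in> R" "0 \<in> R" "0 \<le> l\<^sub>1" "0 \<le> l\<^sub>2" using l add zero nonneg by auto
  have "Res X (0, l\<^sub>1, l\<^sub>1) (Res X (l\<^sub>1, 0, l\<^sub>1 + l\<^sub>2) x) = Res X (0, 0, l\<^sub>2) (Res X (l\<^sub>2, l\<^sub>1, l\<^sub>1 + l\<^sub>2) x)"
    using assms(2) l in_R x by (simp add: res_res)
  moreover have "Res X (l\<^sub>1, 0, l\<^sub>1 + l\<^sub>2) x \<in> Sec X l\<^sub>1" "Res X (l\<^sub>2, l\<^sub>1, l\<^sub>1 + l\<^sub>2) x \<in> Sec X l\<^sub>2"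
    using assms(2) l in_R x by (auto intro!: res_in)
  ultimately have "\<exists>!z. z \<in> Sec X (l\<^sub>1 + l\<^sub>2) \<and> Res X (l\<^sub>1, 0, l\<^sub>1 + l\<^sub>2) z = Res X (l\<^sub>1, 0, l\<^sub>1 + l\<^sub>2) x \<and>
      Res X (l\<^sub>2, l\<^sub>1, l\<^sub>1 + l\<^sub>2) z = Res X (l\<^sub>2, l\<^sub>1, l\<^sub>1 + l\<^sub>2) x"
    using assms(1) l unfolding is_sheaf_def by blast
  then show ?thesis using x assms(7,8) by metis
qed

lemma is_sheafI:
  assumes "\<And>l\<^sub>1 l\<^sub>2 x\<^sub>1 x\<^sub>2. l\<^sub>1 \<in> R \<Longrightarrow> l\<^sub>2 \<in> R \<Longrightarrow> x\<^sub>1 \<in> Sec X l\<^sub>1 \<Longrightarrow> x\<^sub>2 \<in> Sec X l\<^sub>2 \<Longrightarrow>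
      Res X (0, l\<^sub>1, l\<^sub>1) x\<^sub>1 = Res X (0, 0, l\<^sub>2) x\<^sub>2 \<Longrightarrow>
      \<exists>x \<in> Sec X (l\<^sub>1 + l\<^sub>2). Res X (l\<^sub>1, 0, l\<^sub>1 + l\<^sub>2) x = x\<^sub>1 \<and> Res X (l\<^sub>2, l\<^sub>1, l\<^sub>1 + l\<^sub>2) x = x\<^sub>2"
    and "\<And>l\<^sub>1 l\<^sub>2 x y. l\<^sub>1 \<in> R \<Longrightarrow> l\<^sub>2 \<in> R \<Longrightarrow> x \<in> Sec X (l\<^sub>1 + l\<^sub>2) \<Longrightarrow> y \<in> Sec X (l\<^sub>1 + l\<^sub>2) \<Longrightarrow>
      Res X (l\<^sub>1, 0, l\<^sub>1 + l\<^sub>2) x = Res X (l\<^sub>1, 0, l\<^sub>1 + l\<^sub>2) y \<Longrightarrow>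
      Res X (l\<^sub>2, l\<^sub>1, l\<^sub>1 + l\<^sub>2) x = Res X (l\<^sub>2, l\<^sub>1, l\<^sub>1 + l\<^sub>2) y \<Longrightarrow> x = y"
  shows "is_sheaf R X"
  unfolding is_sheaf_def using assms by (metis (no_types, lifting))

lemma sheaf_cat_simps [simp]:
  "X \<in> Obj (sheaf_cat small R) \<longleftrightarrow> psh small X \<and> is_sheaf R X"
  "Ide (sheaf_cat small R) X = (X, \<lambda>l\<in>R. \<lambda>x\<in>Sec X l. x, X)"
  "Comp (sheaf_cat small R) (Y', \<beta>, Z) (X, \<alpha>, Y) = (X, \<lambda>l\<in>R. \<lambda>x\<in>Sec X l. \<beta> l (\<alpha> l x), Z)"
  "Dom (sheaf_cat small R) (X, \<alpha>, Y) = X" "Cod (sheaf_cat small R) (X, \<alpha>, Y) = Y"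
  "(X, \<alpha>, Y) \<in> Arr (sheaf_cat small R) \<longleftrightarrow>
    psh small X \<and> is_sheaf R X \<and> psh small Y \<and> is_sheaf R Y \<and> \<alpha> \<in> hm X Y"
  by (auto simp: sheaf_cat_def full_subcategory_def psh_cat_def)

lemma sheaf_hom_iff:
  "f \<in> hom (sheaf_cat small R) X Y \<longleftrightarrow> (\<exists>\<alpha>. f = (X, \<alpha>, Y) \<and>
    psh small X \<and> is_sheaf R X \<and> psh small Y \<and> is_sheaf R Y \<and> \<alpha> \<in> hm X Y)"
  by (cases f) (auto simp: hom_def)

lemma category_sheaf: "category (sheaf_cat small R)"
  unfolding sheaf_cat_def by (intro category_full_subcategory category_psh_cat category_int)

text \<open>
  Morphisms over \<open>S\<close> in sectionwise form: the triangle of an arrow of the slice commutes iff it does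
  so on every section.
\<close>

lemma slice_sheaf_hom_iff:
  "F \<in> hom (slice (sheaf_cat small R) S) f g \<longleftrightarrow> (\<exists>X \<phi> Y \<chi> \<alpha>. F = (f, (X, \<alpha>, Y), g) \<and>
    f = (X, \<phi>, S) \<and> g = (Y, \<chi>, S) \<and> psh small S \<and> is_sheaf R S \<and>
    psh small X \<and> is_sheaf R X \<and> \<phi> \<in> hm X S \<and> psh small Y \<and> is_sheaf R Y \<and> \<chi> \<in> hm Y S \<and>
    \<alpha> \<in> hm X Y \<and> (\<forall>l\<in>R. \<forall>x\<in>Sec X l. \<chi> l (\<alpha> l x) = \<phi> l x))"
proof -
  have "(\<lambda>l\<in>R. \<lambda>x\<in>Sec X l. \<chi> l (\<alpha> l x)) = \<phi> \<longleftrightarrow> (\<forall>l\<in>R. \<forall>x\<in>Sec X l. \<chi> l (\<alpha> l x) = \<phi> l x)"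
    if "psh small X" "\<phi> \<in> hm X S" "\<chi> \<in> hm Y S" "\<alpha> \<in> hm X Y" for X \<phi> Y \<chi> \<alpha>
    using that psh_hom_comp[OF category_int that(1) that(4,3)]
    by (auto intro!: hm_eqI)
  then show ?thesis
    by (cases f; cases g) (auto simp: slice_hom_iff sheaf_hom_iff)
qed

lemma slice_sheaf_obj_iff:
  "f \<in> Obj (slice (sheaf_cat small R) S) \<longleftrightarrow> (\<exists>X \<phi>. f = (X, \<phi>, S) \<and> psh small S \<and> is_sheaf R S \<and>
    psh small X \<and> is_sheaf R X \<and> \<phi> \<in> hm X S)"
  by (cases f) (auto simp: slice_obj)

lemma hm_restrict: "\<alpha> \<in> hm X Y \<Longrightarrow> (\<lambda>l\<in>R. \<lambda>x\<in>Sec X l. \<alpha> l x) = \<alpha>"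
  using psh_hom_restrict[of \<alpha> "int_cat R"] by simp

end

section \<open>The slice adjunction\<close>

locale small_psh = set_universe small pr crc + lengths R
  for small :: "'u set \<Rightarrow> bool" and pr :: "'u \<times> 'u \<Rightarrow> 'u" and crc :: "real set \<Rightarrow> 'u" and R :: "real set"
begin

lemma inv_pr [simp]: "inv pr (pr z) = z"
  by (simp add: inv_f_f[OF inj_pr])

lemma pr_eq [simp]: "pr z = pr w \<longleftrightarrow> z = w"
  by (rule inj_eq[OF inj_pr])

abbreviation Sh where "Sh \<equiv> sheaf_cat small R"
abbreviation Prod (infixr \<open>\<otimes>\<close> 70) where "X \<otimes> Y \<equiv> psh_prod pr (int_cat R) X Y"

lemma prod_Sec: "l \<in> R \<Longrightarrow> Sec (X \<otimes> Y) l = pr ` (Sec X l \<times> Sec Y l)"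
  by (simp add: psh_prod_def)

lemma prod_SecE:
  assumes "z \<in> Sec (X \<otimes> Y) l" "l \<in> R"
  obtains x y where "z = pr (x, y)" "x \<in> Sec X l" "y \<in> Sec Y l"
  using assms by (auto simp: prod_Sec)

lemma prod_Res:
  "l' \<in> R \<Longrightarrow> p \<in> R \<Longrightarrow> l \<in> R \<Longrightarrow> p + l' \<le> l \<Longrightarrow> x \<in> Sec X l \<Longrightarrow> y \<in> Sec Y l \<Longrightarrow>
    Res (X \<otimes> Y) (l', p, l) (pr (x, y)) = pr (Res X (l', p, l) x, Res Y (l', p, l) y)"
  by (simp add: psh_prod_def)

lemma psh_prod:
  assumes X: "psh small X" and Y: "psh small Y"
  shows "psh small (X \<otimes> Y)"
proof (rule psh_intI[where S = "\<lambda>l. pr ` (Sec X l \<times> Sec Y l)"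
      and r = "\<lambda>l' p l z. pr (map_prod (Res X (l', p, l)) (Res Y (l', p, l)) (inv pr z))"])
  show "small (pr ` (Sec X l \<times> Sec Y l))" if "l \<in> R" for l
    using that presheaf_small[OF X] presheaf_small[OF Y] by (simp add: small_product)
qed (auto simp: psh_prod_def res_in[OF X] res_in[OF Y] res_ide[OF X] res_ide[OF Y]
      res_res[OF X] res_res[OF Y])

lemma is_sheaf_prod:
  assumes X: "psh small X" "is_sheaf R X" and Y: "psh small Y" "is_sheaf R Y"
  shows "is_sheaf R (X \<otimes> Y)"
proof (rule is_sheafI)
  fix l\<^sub>1 l\<^sub>2 z\<^sub>1 z\<^sub>2
  assume l: "l\<^sub>1 \<in> R" "l\<^sub>2 \<in> R" and z: "z\<^sub>1 \<in> Sec (X \<otimes> Y) l\<^sub>1" "z\<^sub>2 \<in> Sec (X \<otimes> Y) l\<^sub>2"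
    and eq: "Res (X \<otimes> Y) (0, l\<^sub>1, l\<^sub>1) z\<^sub>1 = Res (X \<otimes> Y) (0, 0, l\<^sub>2) z\<^sub>2"
  have l': "l\<^sub>1 + l\<^sub>2 \<in> R" "0 \<in> R" "0 \<le> l\<^sub>1" "0 \<le> l\<^sub>2" using l add zero nonneg by auto
  obtain x\<^sub>1 y\<^sub>1 where 1: "z\<^sub>1 = pr (x\<^sub>1, y\<^sub>1)" "x\<^sub>1 \<in> Sec X l\<^sub>1" "y\<^sub>1 \<in> Sec Y l\<^sub>1"
    using z(1) l(1) by (rule prod_SecE)
  obtain x\<^sub>2 y\<^sub>2 where 2: "z\<^sub>2 = pr (x\<^sub>2, y\<^sub>2)" "x\<^sub>2 \<in> Sec X l\<^sub>2" "y\<^sub>2 \<in> Sec Y l\<^sub>2"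
    using z(2) l(2) by (rule prod_SecE)
  have eqs: "Res X (0, l\<^sub>1, l\<^sub>1) x\<^sub>1 = Res X (0, 0, l\<^sub>2) x\<^sub>2" "Res Y (0, l\<^sub>1, l\<^sub>1) y\<^sub>1 = Res Y (0, 0, l\<^sub>2) y\<^sub>2"
    using eq l l' 1 2 by (simp_all add: prod_Res)
  obtain x where x: "x \<in> Sec X (l\<^sub>1 + l\<^sub>2)" "Res X (l\<^sub>1, 0, l\<^sub>1 + l\<^sub>2) x = x\<^sub>1" "Res X (l\<^sub>2, l\<^sub>1, l\<^sub>1 + l\<^sub>2) x = x\<^sub>2"
    by (rule is_sheaf_glue[OF X(2) l 1(2) 2(2) eqs(1)])
  obtain y where y: "y \<in> Sec Y (l\<^sub>1 + l\<^sub>2)" "Res Y (l\<^sub>1, 0, l\<^sub>1 + l\<^sub>2) y = y\<^sub>1" "Res Y (l\<^sub>2, l\<^sub>1, l\<^sub>1 + l\<^sub>2) y = y\<^sub>2"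
    by (rule is_sheaf_glue[OF Y(2) l 1(3) 2(3) eqs(2)])
  show "\<exists>z\<in>Sec (X \<otimes> Y) (l\<^sub>1 + l\<^sub>2).
      Res (X \<otimes> Y) (l\<^sub>1, 0, l\<^sub>1 + l\<^sub>2) z = z\<^sub>1 \<and> Res (X \<otimes> Y) (l\<^sub>2, l\<^sub>1, l\<^sub>1 + l\<^sub>2) z = z\<^sub>2"
    by (rule bexI[of _ "pr (x, y)"]) (use l l' x y 1 2 in \<open>auto simp: prod_Res prod_Sec\<close>)
next
  fix l\<^sub>1 l\<^sub>2 z w
  assume l: "l\<^sub>1 \<in> R" "l\<^sub>2 \<in> R" and z: "z \<in> Sec (X \<otimes> Y) (l\<^sub>1 + l\<^sub>2)" and w: "w \<in> Sec (X \<otimes> Y) (l\<^sub>1 + l\<^sub>2)"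
    and eq: "Res (X \<otimes> Y) (l\<^sub>1, 0, l\<^sub>1 + l\<^sub>2) z = Res (X \<otimes> Y) (l\<^sub>1, 0, l\<^sub>1 + l\<^sub>2) w"
      "Res (X \<otimes> Y) (l\<^sub>2, l\<^sub>1, l\<^sub>1 + l\<^sub>2) z = Res (X \<otimes> Y) (l\<^sub>2, l\<^sub>1, l\<^sub>1 + l\<^sub>2) w"
  have l': "l\<^sub>1 + l\<^sub>2 \<in> R" "0 \<in> R" "0 \<le> l\<^sub>1" "0 \<le> l\<^sub>2" using l add zero nonneg by auto
  obtain x y where 1: "z = pr (x, y)" "x \<in> Sec X (l\<^sub>1 + l\<^sub>2)" "y \<in> Sec Y (l\<^sub>1 + l\<^sub>2)"
    using z l'(1) by (rule prod_SecE)
  obtain x' y' where 2: "w = pr (x', y')" "x' \<in> Sec X (l\<^sub>1 + l\<^sub>2)" "y' \<in> Sec Y (l\<^sub>1 + l\<^sub>2)"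
    using w l'(1) by (rule prod_SecE)
  show "z = w"
    using eq 1 2 l l' is_sheaf_unique[OF X(2,1) l 1(2) 2(2)] is_sheaf_unique[OF Y(2,1) l 1(3) 2(3)]
    by (simp add: prod_Res)
qed

lemma fst_eq: "psh_fst pr (int_cat R) X Y = (X \<otimes> Y, \<lambda>l\<in>R. \<lambda>z\<in>Sec (X \<otimes> Y) l. fst (inv pr z), X)"
  and snd_eq: "psh_snd pr (int_cat R) X Y = (X \<otimes> Y, \<lambda>l\<in>R. \<lambda>z\<in>Sec (X \<otimes> Y) l. snd (inv pr z), Y)"
  by (auto simp: psh_fst_def psh_snd_def prod_Sec cong: restrict_cong)

lemma
  assumes "psh small X" "psh small Y"
  shows fst_hm: "(\<lambda>l\<in>R. \<lambda>z\<in>Sec (X \<otimes> Y) l. fst (inv pr z)) \<in> hm (X \<otimes> Y) X"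
    and snd_hm: "(\<lambda>l\<in>R. \<lambda>z\<in>Sec (X \<otimes> Y) l. snd (inv pr z)) \<in> hm (X \<otimes> Y) Y"
  by (rule hmI[OF psh_prod[OF assms]]; auto simp: prod_Res elim!: prod_SecE)+

lemma apfst_hm:
  assumes "psh small X" "psh small Y" "psh small S" "\<alpha> \<in> hm X Y"
  shows "(\<lambda>l\<in>R. \<lambda>z\<in>Sec (X \<otimes> S) l. pr (apfst (\<alpha> l) (inv pr z))) \<in> hm (X \<otimes> S) (Y \<otimes> S)"
  by (rule hmI[OF psh_prod[OF assms(1,3)]]) (use assms in \<open>auto simp: prod_Res prod_Sec hm_in hm_natural\<close>)

lemma graph_hm:
  assumes "psh small X" "psh small S" "\<phi> \<in> hm X S"
  shows "(\<lambda>l\<in>R. \<lambda>x\<in>Sec X l. pr (x, \<phi> l x)) \<in> hm X (X \<otimes> S)"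
  by (rule hmI[OF assms(1)]) (use assms in \<open>auto simp: prod_Res prod_Sec hm_in hm_natural\<close>)

lemma slice_product_simps:
  "omap (slice_product pr (int_cat R) S) Y = (Y \<otimes> S, \<lambda>l\<in>R. \<lambda>z\<in>Sec (Y \<otimes> S) l. snd (inv pr z), S)"
  "amap (slice_product pr (int_cat R) S) (Y, \<alpha>, Y') =
    ((Y \<otimes> S, \<lambda>l\<in>R. \<lambda>z\<in>Sec (Y \<otimes> S) l. snd (inv pr z), S),
     (Y \<otimes> S, \<lambda>l\<in>R. \<lambda>z\<in>Sec (Y \<otimes> S) l. pr (apfst (\<alpha> l) (inv pr z)), Y' \<otimes> S),
     (Y' \<otimes> S, \<lambda>l\<in>R. \<lambda>z\<in>Sec (Y' \<otimes> S) l. snd (inv pr z), S))"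
  by (auto simp: slice_product_def snd_eq prod_Sec cong: restrict_cong)

lemma slice_forget_simps:
  "omap (slice_forget (psh_cat small (int_cat R))) (X, \<phi>, S) = X"
  "amap (slice_forget (psh_cat small (int_cat R))) (f, h, g) = h"
  by (simp_all add: slice_forget_def)

lemma is_functor_slice_product:
  assumes S: "psh small S" "is_sheaf R S"
  shows "is_functor Sh (slice Sh S) (slice_product pr (int_cat R) S)"
proof -
  have "amap (slice_product pr (int_cat R) S) (g \<cdot>\<^bsub>Sh\<^esub> f) =
      amap (slice_product pr (int_cat R) S) g \<cdot>\<^bsub>slice Sh S\<^esub> amap (slice_product pr (int_cat R) S) f"
    if "f \<in> hom Sh X Y" "g \<in> hom Sh Y Z" for X Y Z f g
    using that by (auto simp: sheaf_hom_iff slice_product_simps prod_Sec hm_in fun_eq_iff restrict_def)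
  moreover have "amap (slice_product pr (int_cat R) S) (Ide Sh X)
      = Ide (slice Sh S) (omap (slice_product pr (int_cat R) S) X)" for X
    by (auto simp: slice_product_simps prod_Sec fun_eq_iff restrict_def)
  ultimately show ?thesis
    unfolding is_functor_def
    using S by (auto simp: category_sheaf category_slice slice_sheaf_hom_iff sheaf_hom_iff
        slice_sheaf_obj_iff slice_product_simps psh_prod is_sheaf_prod apfst_hm snd_hm prod_Sec hm_in)
qed

lemma is_functor_slice_forget:
  "is_functor (slice Sh S) Sh (slice_forget (psh_cat small (int_cat R)))"
  unfolding is_functor_def
  by (auto simp: category_sheaf category_slice slice_sheaf_obj_iff slice_sheaf_hom_iff
      sheaf_hom_iff slice_forget_simps)

lemma slice_adj_simps:
  "ladj (slice_adj small pr (int_cat R) S) = slice_forget (psh_cat small (int_cat R))"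
  "radj (slice_adj small pr (int_cat R) S) = slice_product pr (int_cat R) S"
  "adj_unit (slice_adj small pr (int_cat R) S) (X, \<phi>, T) = ((X, \<phi>, T),
     (X, \<lambda>l\<in>R. \<lambda>x\<in>Sec X l. pr (x, \<phi> l x), X \<otimes> S),
     (X \<otimes> S, \<lambda>l\<in>R. \<lambda>z\<in>Sec (X \<otimes> S) l. snd (inv pr z), S))"
  "adj_counit (slice_adj small pr (int_cat R) S) Y =
     (Y \<otimes> S, \<lambda>l\<in>R. \<lambda>z\<in>Sec (Y \<otimes> S) l. fst (inv pr z), Y)"
  by (simp_all add: slice_adj_def snd_eq fst_eq)

lemma adjunction_slice_adj:
  assumes S: "psh small S" "is_sheaf R S"
  shows "adjunction (slice Sh S) Sh (slice_adj small pr (int_cat R) S)" (is "adjunction ?C ?D ?T")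
proof -
  have 1: "nat_trans ?C ?C id_functor (radj ?T \<circ>\<^sub>F ladj ?T) (adj_unit ?T)"
  proof -
    have "adj_unit ?T A \<in> hom ?C A (omap (radj ?T) (omap (ladj ?T) A))" if "A \<in> Obj ?C" for A
      using that S by (auto simp: slice_sheaf_obj_iff slice_adj_simps slice_forget_simps slice_product_simps
        slice_sheaf_hom_iff psh_prod is_sheaf_prod graph_hm snd_hm prod_Sec hm_in)
    moreover have "adj_unit ?T B \<cdot>\<^bsub>?C\<^esub> f = amap (radj ?T) (amap (ladj ?T) f) \<cdot>\<^bsub>?C\<^esub> adj_unit ?T A"
      if "f \<in> hom ?C A B" for A B f
      using that S by (auto simp: slice_sheaf_hom_iff slice_adj_simps slice_forget_simps slice_product_simps
        prod_Sec hm_in fun_eq_iff restrict_def)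
    ultimately show ?thesis by (simp add: nat_trans_def)
  qed
  have 2: "nat_trans ?D ?D (ladj ?T \<circ>\<^sub>F radj ?T) id_functor (adj_counit ?T)"
  proof -
    have "adj_counit ?T A \<in> hom ?D (omap (ladj ?T) (omap (radj ?T) A)) A" if "A \<in> Obj ?D" for A
      using that S by (auto simp: slice_adj_simps slice_forget_simps slice_product_simps
        sheaf_hom_iff psh_prod is_sheaf_prod fst_hm)
    moreover have "adj_counit ?T B \<cdot>\<^bsub>?D\<^esub> amap (ladj ?T) (amap (radj ?T) f) = f \<cdot>\<^bsub>?D\<^esub> adj_counit ?T A"
      if "f \<in> hom ?D A B" for A B f
      using that S by (auto simp: sheaf_hom_iff slice_adj_simps slice_forget_simps slice_product_simps
        prod_Sec hm_in fun_eq_iff restrict_def)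
    ultimately show ?thesis by (simp add: nat_trans_def)
  qed
  have 3: "adj_counit ?T (omap (ladj ?T) A) \<cdot>\<^bsub>?D\<^esub> amap (ladj ?T) (adj_unit ?T A)
      = Ide ?D (omap (ladj ?T) A)" if "A \<in> Obj ?C" for A
    using that S by (auto simp: slice_sheaf_obj_iff slice_adj_simps slice_forget_simps
      prod_Sec hm_in fun_eq_iff restrict_def)
  have 4: "amap (radj ?T) (adj_counit ?T B) \<cdot>\<^bsub>?C\<^esub> adj_unit ?T (omap (radj ?T) B)
      = Ide ?C (omap (radj ?T) B)" if "B \<in> Obj ?D" for B
    using that S by (auto simp: slice_adj_simps slice_product_simps prod_Sec fun_eq_iff restrict_def)
  show ?thesis
    unfolding adjunction_def
    using 1 2 3 4 is_functor_slice_product[OF S] is_functor_slice_forget by (simp add: slice_adj_simps(1,2))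
qed

end

section \<open>Gluing along an overlap\<close>

context lengths
begin

text \<open>
  Cut the overlap of length \<open>c\<close> off the second section, glue what remains to the first one, and use
  uniqueness for the decomposition \<open>c + b\<close> to recognise the second section in the result.
\<close>

lemma overlap_glue:
  assumes X: "psh small X" "is_sheaf R X" and abc: "a \<in> R" "c \<in> R" "b \<in> R"
    and y: "y\<^sub>1 \<in> Sec X (a + c)" "y\<^sub>2 \<in> Sec X (c + b)"
    and eq: "Res X (c, a, a + c) y\<^sub>1 = Res X (c, 0, c + b) y\<^sub>2"
  obtains y where "y \<in> Sec X (a + c + b)" "Res X (a + c, 0, a + c + b) y = y\<^sub>1"
    "Res X (c + b, a, a + c + b) y = y\<^sub>2"
proof -
  note R = abc zero add[OF abc(1,2)] add[OF abc(2,3)] add[OF add[OF abc(1,2)] abc(3)]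
    nonneg[OF abc(1)] nonneg[OF abc(2)] nonneg[OF abc(3)]
  have e: "a + (c + b) = a + c + b" by simp
  have m: "Res X (b, c, c + b) y\<^sub>2 \<in> Sec X b" using X R y by (auto intro: res_in)
  have "Res X (0, a + c, a + c) y\<^sub>1 = Res X (0, c, c) (Res X (c, a, a + c) y\<^sub>1)"
    using X R y by (simp add: res_res)
  also have "\<dots> = Res X (0, 0, b) (Res X (b, c, c + b) y\<^sub>2)"
    unfolding eq using X R y by (simp add: res_res)
  finally obtain y where y': "y \<in> Sec X (a + c + b)" "Res X (a + c, 0, a + c + b) y = y\<^sub>1"
      "Res X (b, a + c, a + c + b) y = Res X (b, c, c + b) y\<^sub>2"
    by (rule is_sheaf_glue[OF X(2) R(5) R(3) y(1) m])
  have "Res X (c + b, a, a + c + b) y = y\<^sub>2"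
  proof (rule is_sheaf_unique[OF X(2,1) abc(2,3) _ y(2)])
    show "Res X (c + b, a, a + c + b) y \<in> Sec X (c + b)"
      using X R y' by (auto intro: res_in)
    have "Res X (c, 0, c + b) (Res X (c + b, a, a + c + b) y) = Res X (c, a, a + c) (Res X (a + c, 0, a + c + b) y)"
      using X R y'(1) by (simp add: res_res)
    then show "Res X (c, 0, c + b) (Res X (c + b, a, a + c + b) y) = Res X (c, 0, c + b) y\<^sub>2"
      using y' eq by simp
    show "Res X (b, c, c + b) (Res X (c + b, a, a + c + b) y) = Res X (b, c, c + b) y\<^sub>2"
      using X R y'(1) y'(3) by (simp add: res_res)
  qed
  with y' show ?thesis using that by blast
qed

lemma overlap_unique:
  assumes X: "psh small X" "is_sheaf R X" and abc: "a \<in> R" "c \<in> R" "b \<in> R"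
    and y: "y \<in> Sec X (a + c + b)" "z \<in> Sec X (a + c + b)"
    and eq: "Res X (a + c, 0, a + c + b) y = Res X (a + c, 0, a + c + b) z"
      "Res X (c + b, a, a + c + b) y = Res X (c + b, a, a + c + b) z"
  shows "y = z"
proof (rule is_sheaf_unique[OF X(2,1) add[OF abc(1,2)] abc(3) y eq(1)])
  note R = abc zero add[OF abc(1,2)] add[OF abc(2,3)] add[OF add[OF abc(1,2)] abc(3)]
    nonneg[OF abc(1)] nonneg[OF abc(2)] nonneg[OF abc(3)]
  have "Res X (b, a + c, a + c + b) w = Res X (b, c, c + b) (Res X (c + b, a, a + c + b) w)"
    if "w \<in> Sec X (a + c + b)" for w
    using X R that by (simp add: res_res)
  then show "Res X (b, a + c, a + c + b) y = Res X (b, a + c, a + c + b) z"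
    using y eq(2) by simp
qed

end

section \<open>The sheaf of phases\<close>

context set_universe
begin

sublocale Re: small_psh small pr crc "{0..}"
  by unfold_locales auto

sublocale Na: small_psh small pr crc "\<nat>"
  by unfold_locales (auto elim: Nats_cases)

text \<open>
  The phase \<open>[t]\<close>, as an element of the universe, and the representative of a phase in the interval
  from \<open>0\<close> (included) to \<open>1\<close> (excluded).
\<close>

definition ph :: "real \<Rightarrow> 'u" where "ph t = crc {u. t - u \<in> \<int>}"

definition phase :: "'u \<Rightarrow> real" where "phase u = frac (inv ph u)"

lemma RmodZ_eq: "RmodZ = range (\<lambda>t. {u. t - u \<in> \<int>})"
  by (auto simp: RmodZ_def quotient_def)

lemma circle_eq: "crc ` RmodZ = range ph"
  by (auto simp: RmodZ_eq ph_def)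

lemma coset_eq_iff: "{u. s - u \<in> \<int>} = {u. t - u \<in> \<int>} \<longleftrightarrow> s - t \<in> (\<int> :: real set)"
proof
  assume "{u. s - u \<in> \<int>} = {u. t - u \<in> \<int>}"
  then have "t \<in> {u. s - u \<in> \<int>}" by simp
  then show "s - t \<in> \<int>" by simp
next
  assume st: "s - t \<in> \<int>"
  have "s - u \<in> \<int> \<longleftrightarrow> t - u \<in> \<int>" for u
  proof
    assume "s - u \<in> \<int>"
    from Ints_diff[OF this st] show "t - u \<in> \<int>" by simp
  next
    assume "t - u \<in> \<int>"
    from Ints_add[OF st this] show "s - u \<in> \<int>" by simp
  qed
  then show "{u. s - u \<in> \<int>} = {u. t - u \<in> \<int>}" by auto
qed

lemma coset_in_RmodZ: "{u. t - u \<in> \<int>} \<in> RmodZ"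
  unfolding RmodZ_eq by (rule rangeI[of "\<lambda>t. {u. t - u \<in> \<int>}"])

lemma ph_eq_iff: "ph s = ph t \<longleftrightarrow> s - t \<in> \<int>"
  using inj_on_eq_iff[OF inj_crc coset_in_RmodZ[of s] coset_in_RmodZ[of t]]
  by (simp only: ph_def coset_eq_iff)

lemma frac_eq_if_diff_Ints: "s - t \<in> \<int> \<Longrightarrow> frac s = frac (t :: real)"
proof -
  assume "s - t \<in> \<int>"
  then obtain k where "s = t + of_int k" by (auto elim!: Ints_cases simp: algebra_simps)
  then show ?thesis by (simp add: frac_def)
qed

lemma phase_ph [simp]: "phase (ph t) = frac t"
proof -
  have "ph (inv ph (ph t)) = ph t" by (simp add: f_inv_into_f)
  then show ?thesis unfolding phase_def ph_eq_iff by (rule frac_eq_if_diff_Ints)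
qed

lemma ph_frac [simp]: "ph (frac t) = ph t"
  by (simp add: ph_eq_iff frac_def)

lemma ph_eq_frac_iff: "ph s = ph t \<longleftrightarrow> frac s = frac t"
  by (metis phase_ph ph_frac)

lemma ph_phase: "u \<in> range ph \<Longrightarrow> ph (phase u) = u"
  by auto

lemma ph_add_cong: "ph s = ph t \<Longrightarrow> ph (s + p) = ph (t + p)"
  by (simp add: ph_eq_iff)

lemma ph_Nats: "n \<in> \<nat> \<Longrightarrow> ph n = ph 0"
  by (auto simp: ph_eq_iff elim!: Nats_cases)

lemma small_range_ph: "A \<subseteq> range ph \<Longrightarrow> small A"
  using small_subset[OF small_circle] by (simp add: circle_eq)

lemma Sync_Sec: "0 \<le> l \<Longrightarrow> Sec (Sync crc) l = range ph"
  by (simp add: Sync_def circle_eq)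

lemma translate_coset: "(\<lambda>u. u + p) ` {u. t - u \<in> \<int>} = {u. t + p - u \<in> (\<int> :: real set)}"
  by (force simp: image_iff algebra_simps intro: exI[of _ "_ - p"])

lemma Sync_Res:
  assumes "0 \<le> l'" "0 \<le> p" "p + l' \<le> l"
  shows "Res (Sync crc) (l', p, l) (ph t) = ph (t + p)"
proof -
  have "inv_into RmodZ crc (ph t) = {u. t - u \<in> \<int>}"
    unfolding ph_def by (rule inv_into_f_f[OF inj_crc coset_in_RmodZ])
  then show ?thesis
    using assms by (simp add: Sync_def circle_eq ph_def[of "t + p"] translate_coset)
qed

lemma psh_Sync: "Re.psh small (Sync crc)"
proof (rule Re.psh_intI[where S = "\<lambda>_. range ph" and r = "\<lambda>l' p l u. ph (phase u + p)"])
  show "Res (Sync crc) (l', p, l) = (\<lambda>u\<in>range ph. ph (phase u + p))"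
    if "l' \<in> {0..}" "p \<in> {0..}" "l \<in> {0..}" "p + l' \<le> l" for l' p l
  proof
    fix u show "Res (Sync crc) (l', p, l) u = (\<lambda>u\<in>range ph. ph (phase u + p)) u"
    proof (cases "u \<in> range ph")
      case True
      then obtain t where "u = ph t" by auto
      then show ?thesis using that Sync_Res[of l' p l t] ph_add_cong[of "frac t" t p] by simp
    next
      case False
      then show ?thesis using that by (simp add: Sync_def circle_eq)
    qed
  qed
qed (auto simp: Sync_def circle_eq small_range_ph ph_eq_iff frac_def)

lemma is_sheaf_Sync: "is_sheaf {0..} (Sync crc)"
proof (rule Re.is_sheafI)
  fix l\<^sub>1 l\<^sub>2 x\<^sub>1 x\<^sub>2
  assume *: "l\<^sub>1 \<in> {0..}" "l\<^sub>2 \<in> {0..}" "x\<^sub>1 \<in> Sec (Sync crc) l\<^sub>1" "x\<^sub>2 \<in> Sec (Sync crc) l\<^sub>2"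
    "Res (Sync crc) (0, l\<^sub>1, l\<^sub>1) x\<^sub>1 = Res (Sync crc) (0, 0, l\<^sub>2) x\<^sub>2"
  then obtain s t where "x\<^sub>1 = ph s" "x\<^sub>2 = ph t" by (auto simp: Sync_Sec)
  with * show "\<exists>x\<in>Sec (Sync crc) (l\<^sub>1 + l\<^sub>2). Res (Sync crc) (l\<^sub>1, 0, l\<^sub>1 + l\<^sub>2) x = x\<^sub>1 \<and>
      Res (Sync crc) (l\<^sub>2, l\<^sub>1, l\<^sub>1 + l\<^sub>2) x = x\<^sub>2"
    by (intro bexI[of _ x\<^sub>1]) (auto simp: Sync_Res Sync_Sec)
qed (auto simp: Sync_Sec Sync_Res)

text \<open>
  The union of nonempty \<open>A\<close> and \<open>B\<close> is an image of the small set of triples of a phase, an element of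
  \<open>A\<close> and an element of \<open>B\<close>: whether the phase is \<open>0\<close> decides which of the two elements to take.
\<close>

lemma small_union:
  assumes "small A" "small B"
  shows "small (A \<union> B)"
proof (cases "A = {} \<or> B = {}")
  case False
  then obtain a b where ab: "a \<in> A" "b \<in> B" by auto
  let ?f = "\<lambda>z. let (c, w) = inv pr z in let (x, y) = inv pr w in if c = ph 0 then x else y"
  have "small (?f ` pr ` (crc ` RmodZ \<times> pr ` (A \<times> B)))"
    by (intro small_image small_product small_circle assms)
  moreover have "A \<union> B \<subseteq> ?f ` pr ` (crc ` RmodZ \<times> pr ` (A \<times> B))"
  proof
    fix x assume "x \<in> A \<union> B"
    then show "x \<in> ?f ` pr ` (crc ` RmodZ \<times> pr ` (A \<times> B))"
    proof
      assume "x \<in> A"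
      then have "pr (ph 0, pr (x, b)) \<in> pr ` (crc ` RmodZ \<times> pr ` (A \<times> B))"
        using ab by (auto simp: circle_eq)
      moreover have "x = ?f (pr (ph 0, pr (x, b)))" by simp
      ultimately show ?thesis by (rule rev_image_eqI)
    next
      assume "x \<in> B"
      then have "pr (ph (1/2), pr (a, x)) \<in> pr ` (crc ` RmodZ \<times> pr ` (A \<times> B))"
        using ab by (auto simp: circle_eq)
      moreover have "ph (1/2) \<noteq> ph 0"
        by (simp add: ph_eq_frac_iff frac_def floor_eq_iff)
      then have "x = ?f (pr (ph (1/2), pr (a, x)))" by simp
      ultimately show ?thesis by (rule rev_image_eqI)
    qed
  qed
  ultimately show ?thesis by (rule small_subset)
qed (use assms in auto)

section \<open>The extension of an integer sheaf, over the phases\<close>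

abbreviation cl :: "real \<Rightarrow> real" where "cl x \<equiv> of_int \<lceil>x\<rceil>"
abbreviation fl :: "real \<Rightarrow> real" where "fl x \<equiv> of_int \<lfloor>x\<rfloor>"

lemma cl_Nats: "0 \<le> x \<Longrightarrow> cl x \<in> \<nat>"
  and fl_Nats: "0 \<le> x \<Longrightarrow> fl x \<in> \<nat>"
proof -
  show "cl x \<in> \<nat>" if "0 \<le> x"
  proof -
    have "0 \<le> \<lceil>x\<rceil>" using that by linarith
    then have "cl x = of_nat (nat \<lceil>x\<rceil>)" by simp
    then show ?thesis by (simp only: of_nat_in_Nats)
  qed
  show "fl x \<in> \<nat>" if "0 \<le> x"
  proof -
    have "fl x = of_nat (nat \<lfloor>x\<rfloor>)" using that by simp
    then show ?thesis by (simp only: of_nat_in_Nats)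
  qed
qed

text \<open>
  These identities make restriction of the extended sheaf below functorial: moving by \<open>p\<close> from phase
  \<open>\<theta>\<close> crosses \<open>\<lfloor>\<theta> + p\<rfloor>\<close> unit steps and arrives at phase \<open>frac (\<theta> + p)\<close>.
\<close>

lemma fl_add_cl_frac: "fl a + cl (frac a + l) = cl (a + l)"
proof -
  have "frac a + l = (a + l) - of_int \<lfloor>a\<rfloor>" by (simp add: frac_def)
  then have "\<lceil>frac a + l\<rceil> = \<lceil>a + l\<rceil> - \<lfloor>a\<rfloor>" by (simp only: ceiling_diff_of_int)
  then show ?thesis by simp
qed

lemma fl_add_fl_frac: "fl a + fl (frac a + p) = fl (a + p)"
proof -
  have "frac a + p = (a + p) - of_int \<lfloor>a\<rfloor>" by (simp add: frac_def)
  then have "\<lfloor>frac a + p\<rfloor> = \<lfloor>a + p\<rfloor> - \<lfloor>a\<rfloor>" by (simp only: floor_diff_of_int)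
  then show ?thesis by simp
qed

lemma frac_frac_add: "frac (frac a + p) = frac (a + p :: real)"
  by (rule frac_eq_if_diff_Ints) (simp add: frac_def)

lemma frac_unit: "0 \<le> \<theta> \<Longrightarrow> \<theta> < 1 \<Longrightarrow> frac \<theta> = \<theta>"
  by (simp add: frac_eq)

lemma ph_unit_eq_iff: "0 \<le> s \<Longrightarrow> s < 1 \<Longrightarrow> 0 \<le> t \<Longrightarrow> t < 1 \<Longrightarrow> ph s = ph t \<longleftrightarrow> s = t"
  by (simp add: ph_eq_frac_iff frac_unit)

lemma phase_unit: "0 \<le> phase u" "phase u < 1"
  by (simp_all add: phase_def frac_lt_1)

lemma fl_cl_le:
  assumes "p + l' \<le> l"
  shows "fl (\<theta> + p) + cl (frac (\<theta> + p) + l') \<le> cl (\<theta> + l)"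
proof -
  have "\<lceil>\<theta> + p + l'\<rceil> \<le> \<lceil>\<theta> + l\<rceil>" using assms by (intro ceiling_mono) simp
  then show ?thesis unfolding fl_add_cl_frac by simp
qed

text \<open>
  The left Kan extension of \<open>Y\<close> along the inclusion of integer lengths has as its value at \<open>l\<close> the
  colimit of the \<open>Y n\<close> over all arrows from \<open>l\<close> to an integer \<open>n\<close>.  Each component of this diagram
  has a best representative: the start \<open>\<theta>\<close> of the interval lies in the first unit step, and \<open>n\<close> is
  the least integer with \<open>\<theta> + l \<le> n\<close>.  The sections are therefore pairs of a phase \<open>\<theta>\<close> and an
  element of \<open>Y \<lceil>\<theta> + l\<rceil>\<close>.
\<close>

definition lan :: "'u ipsh \<Rightarrow> 'u ipsh" where
  "lan Y = \<lparr>Sec = (\<lambda>l\<in>{0..}. {pr (ph \<theta>, y) |\<theta> y. 0 \<le> \<theta> \<and> \<theta> < 1 \<and> y \<in> Sec Y (cl (\<theta> + l))}),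
    Res = restrict (\<lambda>(l', p, l). \<lambda>u\<in>{pr (ph \<theta>, y) |\<theta> y. 0 \<le> \<theta> \<and> \<theta> < 1 \<and> y \<in> Sec Y (cl (\<theta> + l))}.
      let \<theta> = phase (fst (inv pr u)) in
      pr (ph (\<theta> + p), Res Y (cl (frac (\<theta> + p) + l'), fl (\<theta> + p), cl (\<theta> + l)) (snd (inv pr u))))
      (Arr IntC)\<rparr>"

lemma lan_Sec:
  "0 \<le> l \<Longrightarrow> Sec (lan Y) l = {pr (ph \<theta>, y) |\<theta> y. 0 \<le> \<theta> \<and> \<theta> < 1 \<and> y \<in> Sec Y (cl (\<theta> + l))}"
  by (simp add: lan_def)

lemma lan_SecI: "0 \<le> l \<Longrightarrow> 0 \<le> \<theta> \<Longrightarrow> \<theta> < 1 \<Longrightarrow> y \<in> Sec Y (cl (\<theta> + l)) \<Longrightarrow> pr (ph \<theta>, y) \<in> Sec (lan Y) l"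
  by (auto simp: lan_Sec)

lemma lan_SecE:
  assumes "u \<in> Sec (lan Y) l" "0 \<le> l"
  obtains \<theta> y where "u = pr (ph \<theta>, y)" "0 \<le> \<theta>" "\<theta> < 1" "y \<in> Sec Y (cl (\<theta> + l))"
  using assms by (auto simp: lan_Sec)

lemma lan_Res:
  assumes "0 \<le> l'" "0 \<le> p" "p + l' \<le> l" "0 \<le> \<theta>" "\<theta> < 1" "y \<in> Sec Y (cl (\<theta> + l))"
  shows "Res (lan Y) (l', p, l) (pr (ph \<theta>, y))
    = pr (ph (\<theta> + p), Res Y (cl (frac (\<theta> + p) + l'), fl (\<theta> + p), cl (\<theta> + l)) y)"
proof -
  have "pr (ph \<theta>, y) \<in> {pr (ph \<theta>, y) |\<theta> y. 0 \<le> \<theta> \<and> \<theta> < 1 \<and> y \<in> Sec Y (cl (\<theta> + l))}"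
    using assms by blast
  then show ?thesis
    using assms by (simp add: lan_def frac_unit Let_def)
qed

lemma lan_res_in:
  assumes Y: "Na.psh small Y" and "0 \<le> l'" "0 \<le> p" "p + l' \<le> l" "0 \<le> \<theta>" "\<theta> < 1"
    and "y \<in> Sec Y (cl (\<theta> + l))"
  shows "Res Y (cl (frac (\<theta> + p) + l'), fl (\<theta> + p), cl (\<theta> + l)) y \<in> Sec Y (cl (frac (\<theta> + p) + l'))"
  using assms fl_cl_le[of p l' l \<theta>] by (intro Na.res_in[OF Y] cl_Nats fl_Nats) (auto simp: frac_ge_0)

text \<open>
  As \<open>\<theta>\<close> varies, \<open>\<lceil>\<theta> + l\<rceil>\<close> takes at most two values, so the sections inject into the product of the
  circle with a union of two small sets.
\<close>

lemma small_lan_Sec: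
  assumes Y: "Na.psh small Y" and l: "0 \<le> l"
  shows "small (Sec (lan Y) l)"
proof -
  have n: "cl l \<in> \<nat>" "cl l + 1 \<in> \<nat>" using cl_Nats[OF l] by simp_all
  have "small (Sec Y (cl l))" "small (Sec Y (cl l + 1))"
    using presheaf_small[OF Y] n by simp_all
  then have "small (pr ` (crc ` RmodZ \<times> (Sec Y (cl l) \<union> Sec Y (cl l + 1))))"
    by (intro small_product small_circle small_union)
  moreover have "Sec (lan Y) l \<subseteq> pr ` (crc ` RmodZ \<times> (Sec Y (cl l) \<union> Sec Y (cl l + 1)))"
  proof
    fix u assume "u \<in> Sec (lan Y) l"
    then obtain \<theta> y where u: "u = pr (ph \<theta>, y)" "0 \<le> \<theta>" "\<theta> < 1" "y \<in> Sec Y (cl (\<theta> + l))"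
      using l by (rule lan_SecE)
    have "\<lceil>\<theta> + l\<rceil> = \<lceil>l\<rceil> \<or> \<lceil>\<theta> + l\<rceil> = \<lceil>l\<rceil> + 1" using u(2,3) by linarith
    then have "cl (\<theta> + l) = cl l \<or> cl (\<theta> + l) = cl l + 1" by auto
    then show "u \<in> pr ` (crc ` RmodZ \<times> (Sec Y (cl l) \<union> Sec Y (cl l + 1)))"
      using u by (auto simp: circle_eq)
  qed
  ultimately show ?thesis by (rule small_subset)
qed

lemma psh_lan:
  assumes Y: "Na.psh small Y"
  shows "Re.psh small (lan Y)"
proof -
  define r where "r l' p l u = (let \<theta> = phase (fst (inv pr u)) in
      pr (ph (\<theta> + p), Res Y (cl (frac (\<theta> + p) + l'), fl (\<theta> + p), cl (\<theta> + l)) (snd (inv pr u))))"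
    for l' p l u
  have r: "r l' p l (pr (ph \<theta>, y))
      = pr (ph (\<theta> + p), Res Y (cl (frac (\<theta> + p) + l'), fl (\<theta> + p), cl (\<theta> + l)) y)"
    if "0 \<le> \<theta>" "\<theta> < 1" for l' p l \<theta> y
    using that by (simp add: r_def frac_unit)
  show ?thesis
  proof (rule Re.psh_intI[where S = "\<lambda>l. {pr (ph \<theta>, y) |\<theta> y. 0 \<le> \<theta> \<and> \<theta> < 1 \<and> y \<in> Sec Y (cl (\<theta> + l))}"
      and r = r])
  show "Sec (lan Y) = (\<lambda>l\<in>{0..}. {pr (ph \<theta>, y) |\<theta> y. 0 \<le> \<theta> \<and> \<theta> < 1 \<and> y \<in> Sec Y (cl (\<theta> + l))})"
    by (simp add: lan_def)
  show "Res (lan Y) \<in> extensional (Arr IntC)" by (simp add: lan_def)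
  show "small {pr (ph \<theta>, y) |\<theta> y. 0 \<le> \<theta> \<and> \<theta> < 1 \<and> y \<in> Sec Y (cl (\<theta> + l))}" if "l \<in> {0..}" for l
    using small_lan_Sec[OF Y, of l] that by (simp add: lan_Sec)
next
  fix l' p l :: real and u
  assume l: "l' \<in> {0..}" "p \<in> {0..}" "l \<in> {0..}" "p + l' \<le> l"
    and "u \<in> {pr (ph \<theta>, y) |\<theta> y. 0 \<le> \<theta> \<and> \<theta> < 1 \<and> y \<in> Sec Y (cl (\<theta> + l))}"
  then obtain \<theta> y where u: "u = pr (ph \<theta>, y)" "0 \<le> \<theta>" "\<theta> < 1" "y \<in> Sec Y (cl (\<theta> + l))"
    by blast
  have "pr (ph (frac (\<theta> + p)), Res Y (cl (frac (\<theta> + p) + l'), fl (\<theta> + p), cl (\<theta> + l)) y) \<in> Sec (lan Y) l'"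
    using l u lan_res_in[OF Y, of l' p l \<theta> y] by (intro lan_SecI) (auto simp: frac_lt_1)
  then show "r l' p l u \<in> {pr (ph \<theta>, y) |\<theta> y. 0 \<le> \<theta> \<and> \<theta> < 1 \<and> y \<in> Sec Y (cl (\<theta> + l'))}"
    using l u by (simp add: r lan_Sec)
next
  fix l :: real and u
  assume l: "l \<in> {0..}" and "u \<in> {pr (ph \<theta>, y) |\<theta> y. 0 \<le> \<theta> \<and> \<theta> < 1 \<and> y \<in> Sec Y (cl (\<theta> + l))}"
  then obtain \<theta> y where u: "u = pr (ph \<theta>, y)" "0 \<le> \<theta>" "\<theta> < 1" "y \<in> Sec Y (cl (\<theta> + l))"
    by blast
  have "cl (\<theta> + l) \<in> \<nat>" "fl \<theta> = 0" using l u by (auto intro: cl_Nats simp: floor_eq_iff)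
  then show "r l 0 l u = u"
    using u Na.res_ide[OF Y] by (simp add: r frac_unit)
next
  fix l'' p' l' p l :: real and u
  assume l: "l'' \<in> {0..}" "p' \<in> {0..}" "l' \<in> {0..}" "p \<in> {0..}" "l \<in> {0..}" "p' + l'' \<le> l'" "p + l' \<le> l"
    and "u \<in> {pr (ph \<theta>, y) |\<theta> y. 0 \<le> \<theta> \<and> \<theta> < 1 \<and> y \<in> Sec Y (cl (\<theta> + l))}"
  then obtain \<theta> y where u: "u = pr (ph \<theta>, y)" "0 \<le> \<theta>" "\<theta> < 1" "y \<in> Sec Y (cl (\<theta> + l))"
    by blast
  define \<theta>' where "\<theta>' = frac (\<theta> + p)"
  have t': "0 \<le> \<theta>'" "\<theta>' < 1" "ph (\<theta> + p) = ph \<theta>'" by (simp_all add: \<theta>'_def frac_lt_1)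
  have e: "frac (\<theta> + (p + p')) = frac (\<theta>' + p')" "fl (\<theta> + (p + p')) = fl (\<theta> + p) + fl (\<theta>' + p')"
    using fl_add_fl_frac[of "\<theta> + p" p'] by (simp_all add: \<theta>'_def frac_frac_add add.assoc)
  then have e': "ph (\<theta> + (p + p')) = ph (\<theta>' + p')" by (simp add: ph_eq_frac_iff)
  have "Res Y (cl (frac (\<theta>' + p') + l''), fl (\<theta>' + p'), cl (\<theta>' + l')) (Res Y (cl (\<theta>' + l'), fl (\<theta> + p), cl (\<theta> + l)) y)
      = Res Y (cl (frac (\<theta>' + p') + l''), fl (\<theta> + p) + fl (\<theta>' + p'), cl (\<theta> + l)) y"
    using l u t' fl_cl_le[of p l' l \<theta>] fl_cl_le[of p' l'' l' \<theta>'] unfolding \<theta>'_def[symmetric]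
    by (intro Na.res_res[OF Y] cl_Nats fl_Nats) (auto simp: frac_ge_0)
  then show "r l'' (p + p') l u = r l'' p' l' (r l' p l u)"
    using u t' e e' by (simp add: r \<theta>'_def[symmetric])
qed (auto simp: lan_def r_def)
qed

text \<open>
  If the cut between the two pieces falls inside a unit step, the integer paths that cover them share
  that step.  Gluing along an overlap, rather than at a point, handles both this case and the case of
  a cut at a vertex.
\<close>

lemma is_sheaf_lan:
  assumes Y: "Na.psh small Y" "is_sheaf \<nat> Y"
  shows "is_sheaf {0..} (lan Y)"
proof (rule Re.is_sheafI)
  fix l\<^sub>1 l\<^sub>2 u v
  assume l: "l\<^sub>1 \<in> {0..}" "l\<^sub>2 \<in> {0..}" and u: "u \<in> Sec (lan Y) l\<^sub>1" and v: "v \<in> Sec (lan Y) l\<^sub>2"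
    and eq: "Res (lan Y) (0, l\<^sub>1, l\<^sub>1) u = Res (lan Y) (0, 0, l\<^sub>2) v"
  have l': "0 \<le> l\<^sub>1" "0 \<le> l\<^sub>2" using l by auto
  obtain \<theta> y\<^sub>1 where 1: "u = pr (ph \<theta>, y\<^sub>1)" "0 \<le> \<theta>" "\<theta> < 1" "y\<^sub>1 \<in> Sec Y (cl (\<theta> + l\<^sub>1))"
    using u l'(1) by (rule lan_SecE)
  obtain \<theta>' y\<^sub>2 where 2: "v = pr (ph \<theta>', y\<^sub>2)" "0 \<le> \<theta>'" "\<theta>' < 1" "y\<^sub>2 \<in> Sec Y (cl (\<theta>' + l\<^sub>2))"
    using v l'(2) by (rule lan_SecE)
  have fl0: "fl \<theta>' = 0" using 2 by (simp add: floor_eq_iff)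
  have eqs: "ph (\<theta> + l\<^sub>1) = ph \<theta>'"
    "Res Y (cl (frac (\<theta> + l\<^sub>1)), fl (\<theta> + l\<^sub>1), cl (\<theta> + l\<^sub>1)) y\<^sub>1 = Res Y (cl \<theta>', 0, cl (\<theta>' + l\<^sub>2)) y\<^sub>2"
    using eq 1 2 l' fl0 by (simp_all add: lan_Res frac_unit)
  have \<theta>': "\<theta>' = frac (\<theta> + l\<^sub>1)" using eqs(1) 2 by (simp add: ph_eq_frac_iff frac_unit)
  \<comment> \<open>the two paths overlap in \<open>c\<close> edges: one if the cut lies inside an edge, none at a vertex\<close>
  define a c b where "a = fl (\<theta> + l\<^sub>1)" and "c = cl \<theta>'" and "b = cl (\<theta>' + l\<^sub>2) - cl \<theta>'"
  have ac: "a + c = cl (\<theta> + l\<^sub>1)" using fl_add_cl_frac[of "\<theta> + l\<^sub>1" 0] by (simp add: a_def c_def \<theta>')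
  have cb: "c + b = cl (\<theta>' + l\<^sub>2)" by (simp add: c_def b_def)
  have acb: "a + c + b = cl (\<theta> + (l\<^sub>1 + l\<^sub>2))"
    using fl_add_cl_frac[of "\<theta> + l\<^sub>1" l\<^sub>2] by (simp add: a_def c_def b_def \<theta>' add.assoc)
  have bi: "\<lceil>\<theta>'\<rceil> \<le> \<lceil>\<theta>' + l\<^sub>2\<rceil>" using l' by (intro ceiling_mono) simp
  have "b = of_nat (nat (\<lceil>\<theta>' + l\<^sub>2\<rceil> - \<lceil>\<theta>'\<rceil>))" using bi by (simp add: b_def)
  then have b: "b \<in> \<nat>" by (simp only: of_nat_in_Nats)
  have a: "a \<in> \<nat>" and c: "c \<in> \<nat>" using 1 2 l' by (auto simp: a_def c_def intro: cl_Nats fl_Nats)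
  obtain y where y: "y \<in> Sec Y (a + c + b)" "Res Y (a + c, 0, a + c + b) y = y\<^sub>1"
      "Res Y (c + b, a, a + c + b) y = y\<^sub>2"
  proof (rule Na.overlap_glue[OF Y a c b])
    show "y\<^sub>1 \<in> Sec Y (a + c)" "y\<^sub>2 \<in> Sec Y (c + b)" using 1 2 ac cb by simp_all
    show "Res Y (c, a, a + c) y\<^sub>1 = Res Y (c, 0, c + b) y\<^sub>2"
      using eqs(2) ac cb by (simp add: a_def c_def \<theta>')
  qed
  have "pr (ph \<theta>, y) \<in> Sec (lan Y) (l\<^sub>1 + l\<^sub>2)"
    using 1 l' y(1) by (intro lan_SecI) (simp_all add: acb)
  moreover have "Res (lan Y) (l\<^sub>1, 0, l\<^sub>1 + l\<^sub>2) (pr (ph \<theta>, y)) = u"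
  proof -
    have "fl \<theta> = 0" using 1 by (simp add: floor_eq_iff)
    moreover have "Res Y (cl (\<theta> + l\<^sub>1), 0, cl (\<theta> + (l\<^sub>1 + l\<^sub>2))) y = y\<^sub>1" using y(2) by (simp only: acb[symmetric] ac[symmetric])
    moreover have "y \<in> Sec Y (cl (\<theta> + (l\<^sub>1 + l\<^sub>2)))" using y(1) unfolding acb .
    ultimately show ?thesis using 1(1-3) l' by (simp add: lan_Res frac_unit)
  qed
  moreover have "Res (lan Y) (l\<^sub>2, l\<^sub>1, l\<^sub>1 + l\<^sub>2) (pr (ph \<theta>, y)) = v"
  proof -
    have "Res Y (cl (\<theta>' + l\<^sub>2), fl (\<theta> + l\<^sub>1), cl (\<theta> + (l\<^sub>1 + l\<^sub>2))) y = y\<^sub>2"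
      using y(3) by (simp only: acb[symmetric] cb[symmetric] a_def)
    moreover have "y \<in> Sec Y (cl (\<theta> + (l\<^sub>1 + l\<^sub>2)))" using y(1) unfolding acb .
    ultimately show ?thesis using 1(2,3) 2(1) l' eqs(1) by (simp add: lan_Res \<theta>'[symmetric])
  qed
  ultimately show "\<exists>w\<in>Sec (lan Y) (l\<^sub>1 + l\<^sub>2). Res (lan Y) (l\<^sub>1, 0, l\<^sub>1 + l\<^sub>2) w = u \<and>
      Res (lan Y) (l\<^sub>2, l\<^sub>1, l\<^sub>1 + l\<^sub>2) w = v" by blast
next
  fix l\<^sub>1 l\<^sub>2 u v
  assume l: "l\<^sub>1 \<in> {0..}" "l\<^sub>2 \<in> {0..}" and u: "u \<in> Sec (lan Y) (l\<^sub>1 + l\<^sub>2)" and v: "v \<in> Sec (lan Y) (l\<^sub>1 + l\<^sub>2)"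
    and eq: "Res (lan Y) (l\<^sub>1, 0, l\<^sub>1 + l\<^sub>2) u = Res (lan Y) (l\<^sub>1, 0, l\<^sub>1 + l\<^sub>2) v"
      "Res (lan Y) (l\<^sub>2, l\<^sub>1, l\<^sub>1 + l\<^sub>2) u = Res (lan Y) (l\<^sub>2, l\<^sub>1, l\<^sub>1 + l\<^sub>2) v"
  have l': "0 \<le> l\<^sub>1" "0 \<le> l\<^sub>2" "0 \<le> l\<^sub>1 + l\<^sub>2" using l by auto
  obtain \<theta> y where 1: "u = pr (ph \<theta>, y)" "0 \<le> \<theta>" "\<theta> < 1" "y \<in> Sec Y (cl (\<theta> + (l\<^sub>1 + l\<^sub>2)))"
    using u l'(3) by (rule lan_SecE)
  obtain \<theta>' z where 2: "v = pr (ph \<theta>', z)" "0 \<le> \<theta>'" "\<theta>' < 1" "z \<in> Sec Y (cl (\<theta>' + (l\<^sub>1 + l\<^sub>2)))"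
    using v l'(3) by (rule lan_SecE)
  have "ph \<theta> = ph \<theta>'" using eq(1) 1 2 l' by (simp add: lan_Res)
  then have \<theta>': "\<theta>' = \<theta>" using 1 2 by (simp add: ph_unit_eq_iff)
  define a c b where "a = fl (\<theta> + l\<^sub>1)" and "c = cl (frac (\<theta> + l\<^sub>1))"
    and "b = cl (frac (\<theta> + l\<^sub>1) + l\<^sub>2) - cl (frac (\<theta> + l\<^sub>1))"
  have ac: "a + c = cl (\<theta> + l\<^sub>1)" using fl_add_cl_frac[of "\<theta> + l\<^sub>1" 0] by (simp add: a_def c_def)
  have cb: "c + b = cl (frac (\<theta> + l\<^sub>1) + l\<^sub>2)" by (simp add: c_def b_def)
  have acb: "a + c + b = cl (\<theta> + (l\<^sub>1 + l\<^sub>2))"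
    using fl_add_cl_frac[of "\<theta> + l\<^sub>1" l\<^sub>2] by (simp add: a_def c_def b_def add.assoc)
  have bi: "\<lceil>frac (\<theta> + l\<^sub>1)\<rceil> \<le> \<lceil>frac (\<theta> + l\<^sub>1) + l\<^sub>2\<rceil>" using l' by (intro ceiling_mono) simp
  have "b = of_nat (nat (\<lceil>frac (\<theta> + l\<^sub>1) + l\<^sub>2\<rceil> - \<lceil>frac (\<theta> + l\<^sub>1)\<rceil>))" using bi by (simp add: b_def)
  then have b: "b \<in> \<nat>" by (simp only: of_nat_in_Nats)
  have a: "a \<in> \<nat>" and c: "c \<in> \<nat>" using 1 l' by (auto simp: a_def c_def intro!: cl_Nats fl_Nats)
  have fl0: "fl \<theta> = 0" using 1 by (simp add: floor_eq_iff)
  have "y = z"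
  proof (rule Na.overlap_unique[OF Y a c b])
    show "y \<in> Sec Y (a + c + b)" "z \<in> Sec Y (a + c + b)" using 1 2 by (simp_all add: acb \<theta>')
    show "Res Y (a + c, 0, a + c + b) y = Res Y (a + c, 0, a + c + b) z"
    proof -
      have "Res Y (cl (\<theta> + l\<^sub>1), 0, cl (\<theta> + (l\<^sub>1 + l\<^sub>2))) y = Res Y (cl (\<theta> + l\<^sub>1), 0, cl (\<theta> + (l\<^sub>1 + l\<^sub>2))) z"
        using eq(1) 1 2 l' fl0 by (simp add: lan_Res \<theta>' frac_unit)
      then show ?thesis by (simp only: acb[symmetric] ac[symmetric])
    qed
    show "Res Y (c + b, a, a + c + b) y = Res Y (c + b, a, a + c + b) z"
    proof -
      have "Res Y (cl (frac (\<theta> + l\<^sub>1) + l\<^sub>2), a, cl (\<theta> + (l\<^sub>1 + l\<^sub>2))) y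
          = Res Y (cl (frac (\<theta> + l\<^sub>1) + l\<^sub>2), a, cl (\<theta> + (l\<^sub>1 + l\<^sub>2))) z"
        using eq(2) 1 2 l' by (simp add: lan_Res \<theta>' a_def)
      then show ?thesis by (simp only: acb[symmetric] cb[symmetric])
    qed
  qed
  then show "u = v" using 1 2 \<theta>' by simp
qed

abbreviation "S \<equiv> Sync crc"
abbreviation "Slice \<equiv> slice (IntSh small) (Sync crc)"

definition lan_proj :: "'u ipsh \<Rightarrow> real \<Rightarrow> 'u \<Rightarrow> 'u" where
  "lan_proj Y = (\<lambda>l\<in>{0..}. \<lambda>u\<in>Sec (lan Y) l. fst (inv pr u))"

definition lan_map :: "'u ipsh \<Rightarrow> (real \<Rightarrow> 'u \<Rightarrow> 'u) \<Rightarrow> real \<Rightarrow> 'u \<Rightarrow> 'u" where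
  "lan_map Y \<alpha> = (\<lambda>l\<in>{0..}. \<lambda>u\<in>Sec (lan Y) l.
     pr (fst (inv pr u), \<alpha> (cl (phase (fst (inv pr u)) + l)) (snd (inv pr u))))"

definition lan_functor :: "('u ipsh, 'u ipsh_arr, 'u ipsh_arr, 'u ipsh_arr \<times> 'u ipsh_arr \<times> 'u ipsh_arr) ftr" where
  "lan_functor = \<lparr>omap = (\<lambda>Y. (lan Y, lan_proj Y, S)),
     amap = (\<lambda>(Y, \<alpha>, Y'). ((lan Y, lan_proj Y, S), (lan Y, lan_map Y \<alpha>, lan Y'), (lan Y', lan_proj Y', S)))\<rparr>"

lemma lan_functor_simps [simp]:
  "omap lan_functor Y = (lan Y, lan_proj Y, S)"
  "amap lan_functor (Y, \<alpha>, Y') = ((lan Y, lan_proj Y, S), (lan Y, lan_map Y \<alpha>, lan Y'), (lan Y', lan_proj Y', S))"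
  by (simp_all add: lan_functor_def)

lemma lan_proj_apply:
  "0 \<le> l \<Longrightarrow> 0 \<le> \<theta> \<Longrightarrow> \<theta> < 1 \<Longrightarrow> y \<in> Sec Y (cl (\<theta> + l)) \<Longrightarrow> lan_proj Y l (pr (ph \<theta>, y)) = ph \<theta>"
  by (simp add: lan_proj_def lan_SecI)

lemma lan_map_apply:
  "0 \<le> l \<Longrightarrow> 0 \<le> \<theta> \<Longrightarrow> \<theta> < 1 \<Longrightarrow> y \<in> Sec Y (cl (\<theta> + l)) \<Longrightarrow>
    lan_map Y \<alpha> l (pr (ph \<theta>, y)) = pr (ph \<theta>, \<alpha> (cl (\<theta> + l)) y)"
  by (simp add: lan_map_def lan_SecI frac_unit)

lemma lan_proj_hm:
  assumes Y: "Na.psh small Y"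
  shows "lan_proj Y \<in> Re.hm (lan Y) S"
  unfolding lan_proj_def
proof (rule Re.hmI[OF psh_lan[OF Y]])
  fix l u assume "l \<in> {0..}" "u \<in> Sec (lan Y) l"
  then show "fst (inv pr u) \<in> Sec S l" by (auto elim!: lan_SecE simp: Sync_Sec)
next
  fix l' p l u assume l: "l' \<in> {0..}" "p \<in> {0..}" "l \<in> {0..}" "p + l' \<le> l" and u: "u \<in> Sec (lan Y) l"
  then show "fst (inv pr (Res (lan Y) (l', p, l) u)) = Res S (l', p, l) (fst (inv pr u))"
    by (auto elim!: lan_SecE simp: lan_Res Sync_Res)
qed

text \<open>
  The phase is left alone by \<open>lan_map\<close>, so naturality reduces to that of \<open>\<alpha>\<close> at the single arrow of
  integer lengths that computes the restriction.
\<close>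

lemma lan_map_hm:
  assumes Y: "Na.psh small Y" and Y': "Na.psh small Y'" and \<alpha>: "\<alpha> \<in> Na.hm Y Y'"
  shows "lan_map Y \<alpha> \<in> Re.hm (lan Y) (lan Y')"
  unfolding lan_map_def
proof (rule Re.hmI[OF psh_lan[OF Y]])
  fix l u assume l: "l \<in> {0..}" and "u \<in> Sec (lan Y) l"
  then obtain \<theta> y where u: "u = pr (ph \<theta>, y)" "0 \<le> \<theta>" "\<theta> < 1" "y \<in> Sec Y (cl (\<theta> + l))"
    by (auto elim: lan_SecE)
  have "\<alpha> (cl (\<theta> + l)) y \<in> Sec Y' (cl (\<theta> + l))" using l u by (intro Na.hm_in[OF \<alpha>] cl_Nats) auto
  then show "pr (fst (inv pr u), \<alpha> (cl (phase (fst (inv pr u)) + l)) (snd (inv pr u))) \<in> Sec (lan Y') l"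
    using l u by (simp add: frac_unit lan_SecI)
next
  fix l' p l u assume l: "l' \<in> {0..}" "p \<in> {0..}" "l \<in> {0..}" "p + l' \<le> l" and "u \<in> Sec (lan Y) l"
  then obtain \<theta> y where u: "u = pr (ph \<theta>, y)" "0 \<le> \<theta>" "\<theta> < 1" "y \<in> Sec Y (cl (\<theta> + l))"
    by (auto elim: lan_SecE)
  have "\<alpha> (cl (\<theta> + l)) y \<in> Sec Y' (cl (\<theta> + l))" using l u by (intro Na.hm_in[OF \<alpha>] cl_Nats) auto
  moreover have "\<alpha> (cl (frac (\<theta> + p) + l')) (Res Y (cl (frac (\<theta> + p) + l'), fl (\<theta> + p), cl (\<theta> + l)) y)
      = Res Y' (cl (frac (\<theta> + p) + l'), fl (\<theta> + p), cl (\<theta> + l)) (\<alpha> (cl (\<theta> + l)) y)"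
    using l u fl_cl_le[of p l' l \<theta>]
    by (intro Na.hm_natural[OF \<alpha>] cl_Nats fl_Nats) (auto simp: frac_ge_0)
  ultimately show "pr (fst (inv pr (Res (lan Y) (l', p, l) u)), \<alpha> (cl (phase (fst (inv pr (Res (lan Y) (l', p, l) u))) + l'))
      (snd (inv pr (Res (lan Y) (l', p, l) u)))) =
    Res (lan Y') (l', p, l) (pr (fst (inv pr u), \<alpha> (cl (phase (fst (inv pr u)) + l)) (snd (inv pr u))))"
    using l u by (simp add: frac_unit lan_Res)
qed

lemma lan_proj_map:
  assumes \<alpha>: "\<alpha> \<in> Na.hm Y Y'" and l: "0 \<le> l" "u \<in> Sec (lan Y) l"
  shows "lan_proj Y' l (lan_map Y \<alpha> l u) = lan_proj Y l u"
proof -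
  obtain \<theta> y where u: "u = pr (ph \<theta>, y)" "0 \<le> \<theta>" "\<theta> < 1" "y \<in> Sec Y (cl (\<theta> + l))"
    using l by (auto elim: lan_SecE)
  have "\<alpha> (cl (\<theta> + l)) y \<in> Sec Y' (cl (\<theta> + l))" using l u by (intro Na.hm_in[OF \<alpha>] cl_Nats) auto
  then show ?thesis using l u by (simp add: lan_map_apply lan_proj_apply)
qed

lemma lan_functor_obj: "Y \<in> Obj (IntNSh small) \<Longrightarrow> (lan Y, lan_proj Y, S) \<in> Obj Slice"
  by (simp add: Re.slice_sheaf_obj_iff psh_Sync is_sheaf_Sync psh_lan is_sheaf_lan lan_proj_hm)

lemma lan_map_eqI:
  assumes "\<And>n x. n \<in> \<nat> \<Longrightarrow> x \<in> Sec Y n \<Longrightarrow> \<alpha> n x = \<beta> n x"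
  shows "lan_map Y \<alpha> = lan_map Y \<beta>"
proof -
  have "\<alpha> (cl (phase (fst (inv pr u)) + l)) (snd (inv pr u)) = \<beta> (cl (phase (fst (inv pr u)) + l)) (snd (inv pr u))"
    if l: "0 \<le> l" "u \<in> Sec (lan Y) l" for l u
  proof -
    obtain \<theta> y where u: "u = pr (ph \<theta>, y)" "0 \<le> \<theta>" "\<theta> < 1" "y \<in> Sec Y (cl (\<theta> + l))"
      using l by (auto elim: lan_SecE)
    have "cl (\<theta> + l) \<in> \<nat>" using l u by (auto intro: cl_Nats)
    then show ?thesis using u assms by (simp add: frac_unit)
  qed
  then show ?thesis by (auto simp: lan_map_def fun_eq_iff restrict_def)
qed

lemma lan_map_ide: "lan_map Y (\<lambda>n\<in>\<nat>. \<lambda>x\<in>Sec Y n. x) = (\<lambda>l\<in>{0..}. \<lambda>u\<in>Sec (lan Y) l. u)"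
proof -
  have "lan_map Y (\<lambda>n\<in>\<nat>. \<lambda>x\<in>Sec Y n. x) = lan_map Y (\<lambda>n x. x)"
    by (rule lan_map_eqI) simp
  moreover have "pr (fst (inv pr u), snd (inv pr u)) = u" if "0 \<le> l" "u \<in> Sec (lan Y) l" for l u
    using that by (auto elim: lan_SecE)
  ultimately show ?thesis by (auto simp: lan_map_def fun_eq_iff restrict_def)
qed

lemma lan_map_comp:
  assumes \<alpha>: "\<alpha> \<in> Na.hm X Y"
  shows "lan_map X (\<lambda>n\<in>\<nat>. \<lambda>x\<in>Sec X n. \<beta> n (\<alpha> n x))
    = (\<lambda>l\<in>{0..}. \<lambda>u\<in>Sec (lan X) l. lan_map Y \<beta> l (lan_map X \<alpha> l u))"
proof -
  have "lan_map X (\<lambda>n\<in>\<nat>. \<lambda>x\<in>Sec X n. \<beta> n (\<alpha> n x)) = lan_map X (\<lambda>n x. \<beta> n (\<alpha> n x))"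
    by (rule lan_map_eqI) simp
  moreover have "lan_map X (\<lambda>n x. \<beta> n (\<alpha> n x)) l u = lan_map Y \<beta> l (lan_map X \<alpha> l u)"
    if l: "0 \<le> l" "u \<in> Sec (lan X) l" for l u
  proof -
    obtain \<theta> x where u: "u = pr (ph \<theta>, x)" "0 \<le> \<theta>" "\<theta> < 1" "x \<in> Sec X (cl (\<theta> + l))"
      using l by (auto elim: lan_SecE)
    have "\<alpha> (cl (\<theta> + l)) x \<in> Sec Y (cl (\<theta> + l))" using l u by (intro Na.hm_in[OF \<alpha>] cl_Nats) auto
    then show ?thesis using l u by (simp add: lan_map_apply)
  qed
  ultimately show ?thesis
    by (auto simp: lan_map_def[of X] fun_eq_iff restrict_def)
qed

lemma is_functor_lan: "is_functor (IntNSh small) Slice lan_functor"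
proof -
  have "amap lan_functor f \<in> hom Slice (omap lan_functor A) (omap lan_functor B)" if "f \<in> hom (IntNSh small) A B" for A B f
    using that by (auto simp: Na.sheaf_hom_iff Re.slice_sheaf_hom_iff psh_Sync is_sheaf_Sync psh_lan
        is_sheaf_lan lan_proj_hm lan_map_hm lan_proj_map)
  moreover have "amap lan_functor (g \<cdot>\<^bsub>IntNSh small\<^esub> f) = amap lan_functor g \<cdot>\<^bsub>Slice\<^esub> amap lan_functor f"
    if "f \<in> hom (IntNSh small) A B" "g \<in> hom (IntNSh small) B E" for A B E f g
    using that by (auto simp: Na.sheaf_hom_iff lan_map_comp)
  moreover have "amap lan_functor (Ide (IntNSh small) A) = Ide Slice (omap lan_functor A)" for A
    by (simp add: lan_map_ide)
  ultimately show ?thesis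
    unfolding is_functor_def
    using lan_functor_obj by (simp add: Na.category_sheaf category_slice[OF Re.category_sheaf])
qed

section \<open>The fiber over phase zero\<close>

text \<open>
  Restriction along an arrow between integer lengths shifts the phase by an integer, so the sections
  of integer length and phase \<open>0\<close> are stable under it.
\<close>

definition fiber :: "'u ipsh \<Rightarrow> (real \<Rightarrow> 'u \<Rightarrow> 'u) \<Rightarrow> 'u ipsh" where
  "fiber X \<phi> = \<lparr>Sec = (\<lambda>n\<in>\<nat>. {x \<in> Sec X n. \<phi> n x = ph 0}),
     Res = restrict (\<lambda>(n', p, n). \<lambda>x\<in>{x \<in> Sec X n. \<phi> n x = ph 0}. Res X (n', p, n) x) (Arr IntNC)\<rparr>"

definition fiber_functor :: "('u ipsh_arr, 'u ipsh_arr \<times> 'u ipsh_arr \<times> 'u ipsh_arr, 'u ipsh, 'u ipsh_arr) ftr" where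
  "fiber_functor = \<lparr>omap = (\<lambda>(X, \<phi>, _). fiber X \<phi>),
     amap = (\<lambda>((X, \<phi>, _), (_, \<alpha>, _), (Y, \<chi>, _)).
       (fiber X \<phi>, \<lambda>n\<in>\<nat>. \<lambda>x\<in>Sec (fiber X \<phi>) n. \<alpha> n x, fiber Y \<chi>))\<rparr>"

lemma fiber_functor_simps [simp]:
  "omap fiber_functor (X, \<phi>, T) = fiber X \<phi>"
  "amap fiber_functor ((X, \<phi>, T), (X', \<alpha>, Y'), (Y, \<chi>, T')) = (fiber X \<phi>, \<lambda>n\<in>\<nat>. \<lambda>x\<in>Sec (fiber X \<phi>) n. \<alpha> n x, fiber Y \<chi>)"
  by (simp_all add: fiber_functor_def)

lemma Nats_nonneg: "n \<in> \<nat> \<Longrightarrow> 0 \<le> (n :: real)"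
  by (auto elim: Nats_cases)

lemma fiber_Sec: "n \<in> \<nat> \<Longrightarrow> x \<in> Sec (fiber X \<phi>) n \<longleftrightarrow> x \<in> Sec X n \<and> \<phi> n x = ph 0"
  by (simp add: fiber_def)

lemma fiber_Res:
  "n' \<in> \<nat> \<Longrightarrow> p \<in> \<nat> \<Longrightarrow> n \<in> \<nat> \<Longrightarrow> p + n' \<le> n \<Longrightarrow> x \<in> Sec X n \<Longrightarrow> \<phi> n x = ph 0 \<Longrightarrow>
    Res (fiber X \<phi>) (n', p, n) x = Res X (n', p, n) x"
  by (simp add: fiber_def)

lemma fiber_res_in:
  assumes X: "Re.psh small X" and \<phi>: "\<phi> \<in> Re.hm X S" and n: "n' \<in> \<nat>" "p \<in> \<nat>" "n \<in> \<nat>" "p + n' \<le> n"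
    and x: "x \<in> Sec X n" "\<phi> n x = ph 0"
  shows "Res X (n', p, n) x \<in> Sec X n' \<and> \<phi> n' (Res X (n', p, n) x) = ph 0"
proof
  note nn = n(1-3)[THEN Nats_nonneg]
  show "Res X (n', p, n) x \<in> Sec X n'" using nn n x by (intro Re.res_in[OF X]) auto
  have "\<phi> n' (Res X (n', p, n) x) = Res S (n', p, n) (\<phi> n x)"
    using nn n x by (intro Re.hm_natural[OF \<phi>]) auto
  then show "\<phi> n' (Res X (n', p, n) x) = ph 0" using nn n x ph_Nats[of p] by (simp add: Sync_Res)
qed

lemma psh_fiber:
  assumes X: "Re.psh small X" and \<phi>: "\<phi> \<in> Re.hm X S"
  shows "Na.psh small (fiber X \<phi>)"
proof (rule Na.psh_intI[where S = "\<lambda>n. {x \<in> Sec X n. \<phi> n x = ph 0}" and r = "\<lambda>n' p n. Res X (n', p, n)"])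
  show "small {x \<in> Sec X n. \<phi> n x = ph 0}" if "n \<in> \<nat>" for n
    by (rule small_subset[OF presheaf_small[OF X, of n]]) (use that Nats_nonneg in auto)
  show "Res X (n', p, n) x \<in> {x \<in> Sec X n'. \<phi> n' x = ph 0}"
    if "n' \<in> \<nat>" "p \<in> \<nat>" "n \<in> \<nat>" "p + n' \<le> n" "x \<in> {x \<in> Sec X n. \<phi> n x = ph 0}" for n' p n x
    using fiber_res_in[OF X \<phi>] that by simp
  show "Res X (n, 0, n) x = x" if "n \<in> \<nat>" "x \<in> {x \<in> Sec X n. \<phi> n x = ph 0}" for n x
    using that Re.res_ide[OF X] Nats_nonneg by simp
  show "Res X (n'', p + p', n) x = Res X (n'', p', n') (Res X (n', p, n) x)"
    if "n'' \<in> \<nat>" "p' \<in> \<nat>" "n' \<in> \<nat>" "p \<in> \<nat>" "n \<in> \<nat>" "p' + n'' \<le> n'" "p + n' \<le> n"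
      "x \<in> {x \<in> Sec X n. \<phi> n x = ph 0}" for n'' p' n' p n x
    using that(6-8) that(1-5)[THEN Nats_nonneg] Re.res_res[OF X] by simp
qed (auto simp: fiber_def)

text \<open>
  A section glued from sections of phase \<open>0\<close> has phase \<open>0\<close> itself, since its phase is that of its
  initial piece.
\<close>

lemma is_sheaf_fiber:
  assumes X: "Re.psh small X" "is_sheaf {0..} X" and \<phi>: "\<phi> \<in> Re.hm X S"
  shows "is_sheaf \<nat> (fiber X \<phi>)"
proof (rule Na.is_sheafI)
  fix l\<^sub>1 l\<^sub>2 x\<^sub>1 x\<^sub>2
  assume l: "l\<^sub>1 \<in> \<nat>" "l\<^sub>2 \<in> \<nat>" and x: "x\<^sub>1 \<in> Sec (fiber X \<phi>) l\<^sub>1" "x\<^sub>2 \<in> Sec (fiber X \<phi>) l\<^sub>2"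
    and eq: "Res (fiber X \<phi>) (0, l\<^sub>1, l\<^sub>1) x\<^sub>1 = Res (fiber X \<phi>) (0, 0, l\<^sub>2) x\<^sub>2"
  note ll = l[THEN Nats_nonneg] Nats_add[OF l]
  have x': "x\<^sub>1 \<in> Sec X l\<^sub>1" "x\<^sub>2 \<in> Sec X l\<^sub>2" "\<phi> l\<^sub>1 x\<^sub>1 = ph 0" "\<phi> l\<^sub>2 x\<^sub>2 = ph 0"
    using x l by (simp_all add: fiber_Sec)
  have "Res X (0, l\<^sub>1, l\<^sub>1) x\<^sub>1 = Res X (0, 0, l\<^sub>2) x\<^sub>2"
    using eq l ll x' by (simp add: fiber_Res)
  then obtain x where x: "x \<in> Sec X (l\<^sub>1 + l\<^sub>2)" "Res X (l\<^sub>1, 0, l\<^sub>1 + l\<^sub>2) x = x\<^sub>1" "Res X (l\<^sub>2, l\<^sub>1, l\<^sub>1 + l\<^sub>2) x = x\<^sub>2"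
    using Re.is_sheaf_glue[OF X(2) _ _ x'(1,2)] ll by auto
  have "\<phi> (l\<^sub>1 + l\<^sub>2) x \<in> range ph"
    using Re.hm_in[OF \<phi>, of "l\<^sub>1 + l\<^sub>2" x] x ll by (simp add: Sync_Sec)
  then obtain t where t: "\<phi> (l\<^sub>1 + l\<^sub>2) x = ph t" by auto
  have "\<phi> l\<^sub>1 (Res X (l\<^sub>1, 0, l\<^sub>1 + l\<^sub>2) x) = Res S (l\<^sub>1, 0, l\<^sub>1 + l\<^sub>2) (\<phi> (l\<^sub>1 + l\<^sub>2) x)"
    using ll x(1) by (intro Re.hm_natural[OF \<phi>]) auto
  then have "\<phi> (l\<^sub>1 + l\<^sub>2) x = ph 0" using x(2) x'(3) t ll by (simp add: Sync_Res)
  then show "\<exists>x\<in>Sec (fiber X \<phi>) (l\<^sub>1 + l\<^sub>2). Res (fiber X \<phi>) (l\<^sub>1, 0, l\<^sub>1 + l\<^sub>2) x = x\<^sub>1 \<and>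
      Res (fiber X \<phi>) (l\<^sub>2, l\<^sub>1, l\<^sub>1 + l\<^sub>2) x = x\<^sub>2"
    using x l ll by (intro bexI[of _ x]) (auto simp: fiber_Sec fiber_Res)
next
  fix l\<^sub>1 l\<^sub>2 x y
  assume l: "l\<^sub>1 \<in> \<nat>" "l\<^sub>2 \<in> \<nat>" and xy: "x \<in> Sec (fiber X \<phi>) (l\<^sub>1 + l\<^sub>2)" "y \<in> Sec (fiber X \<phi>) (l\<^sub>1 + l\<^sub>2)"
    and eq: "Res (fiber X \<phi>) (l\<^sub>1, 0, l\<^sub>1 + l\<^sub>2) x = Res (fiber X \<phi>) (l\<^sub>1, 0, l\<^sub>1 + l\<^sub>2) y"
      "Res (fiber X \<phi>) (l\<^sub>2, l\<^sub>1, l\<^sub>1 + l\<^sub>2) x = Res (fiber X \<phi>) (l\<^sub>2, l\<^sub>1, l\<^sub>1 + l\<^sub>2) y"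
  note ll = l[THEN Nats_nonneg] Nats_add[OF l]
  show "x = y"
    using xy eq l ll Re.is_sheaf_unique[OF X(2,1), of l\<^sub>1 l\<^sub>2 x y] by (simp add: fiber_Sec fiber_Res)
qed

lemma fiber_hm:
  assumes X: "Re.psh small X" "\<phi> \<in> Re.hm X S" and Y: "\<chi> \<in> Re.hm Y S"
    and \<alpha>: "\<alpha> \<in> Re.hm X Y" "\<And>l x. 0 \<le> l \<Longrightarrow> x \<in> Sec X l \<Longrightarrow> \<chi> l (\<alpha> l x) = \<phi> l x"
  shows "(\<lambda>n\<in>\<nat>. \<lambda>x\<in>Sec (fiber X \<phi>) n. \<alpha> n x) \<in> Na.hm (fiber X \<phi>) (fiber Y \<chi>)"
proof (rule Na.hmI[OF psh_fiber[OF X]])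
  fix n x assume "n \<in> \<nat>" "x \<in> Sec (fiber X \<phi>) n"
  then show "\<alpha> n x \<in> Sec (fiber Y \<chi>) n"
    using \<alpha>(2)[of n x] Re.hm_in[OF \<alpha>(1), of n x] Nats_nonneg[of n] by (simp add: fiber_Sec)
next
  fix n' p n x assume n: "n' \<in> \<nat>" "p \<in> \<nat>" "n \<in> \<nat>" "p + n' \<le> n" and x: "x \<in> Sec (fiber X \<phi>) n"
  note nn = n(1-3)[THEN Nats_nonneg]
  have x': "x \<in> Sec X n" "\<phi> n x = ph 0" using x n by (simp_all add: fiber_Sec)
  have "\<alpha> n' (Res X (n', p, n) x) = Res Y (n', p, n) (\<alpha> n x)"
    using nn n x' by (intro Re.hm_natural[OF \<alpha>(1)]) auto
  then show "\<alpha> n' (Res (fiber X \<phi>) (n', p, n) x) = Res (fiber Y \<chi>) (n', p, n) (\<alpha> n x)"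
    using n nn x' \<alpha>(2)[OF nn(3) x'(1)] Re.hm_in[OF \<alpha>(1), of n x] by (simp add: fiber_Res)
qed

lemma is_functor_fiber: "is_functor Slice (IntNSh small) fiber_functor"
proof -
  have "amap fiber_functor f \<in> hom (IntNSh small) (omap fiber_functor A) (omap fiber_functor B)" if "f \<in> hom Slice A B" for A B f
    using that by (auto simp: Na.sheaf_hom_iff Re.slice_sheaf_hom_iff psh_fiber is_sheaf_fiber intro!: fiber_hm)
  moreover have "amap fiber_functor (g \<cdot>\<^bsub>Slice\<^esub> f) = amap fiber_functor g \<cdot>\<^bsub>IntNSh small\<^esub> amap fiber_functor f"
    if f': "f \<in> hom Slice A B" and g': "g \<in> hom Slice B E" for A B E f g
  proof -
    obtain X \<phi> Y \<chi> \<alpha> where f: "f = ((X, \<phi>, S), (X, \<alpha>, Y), (Y, \<chi>, S))" "A = (X, \<phi>, S)" "B = (Y, \<chi>, S)"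
        "\<alpha> \<in> Re.hm X Y" "\<forall>l\<in>{0..}. \<forall>x\<in>Sec X l. \<chi> l (\<alpha> l x) = \<phi> l x"
      using f' unfolding Re.slice_sheaf_hom_iff by blast
    obtain Z \<xi> \<beta> where g: "g = ((Y, \<chi>, S), (Y, \<beta>, Z), (Z, \<xi>, S))"
      using g' f(3) unfolding Re.slice_sheaf_hom_iff by auto
    have "\<alpha> n x \<in> Sec Y n" if "n \<in> \<nat>" "x \<in> Sec X n" for n x
      using Re.hm_in[OF f(4), of n x] that Nats_nonneg[of n] by simp
    then show ?thesis
      using f(5) Nats_nonneg by (auto simp: f(1) g fiber_Sec fun_eq_iff restrict_def)
  qed
  moreover have "amap fiber_functor (Ide Slice A) = Ide (IntNSh small) (omap fiber_functor A)" if "A \<in> Obj Slice" for A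
    using that Nats_nonneg by (auto simp: Re.slice_sheaf_obj_iff fiber_Sec fun_eq_iff restrict_def)
  ultimately show ?thesis
    unfolding is_functor_def
    using psh_fiber is_sheaf_fiber
    by (auto simp: Na.category_sheaf category_slice[OF Re.category_sheaf] Re.slice_sheaf_obj_iff)
qed

section \<open>The adjunction between extension and fiber\<close>

text \<open>
  The unit at \<open>Y\<close> inserts phase \<open>0\<close>.  The counit at \<open>\<phi> : X \<rightarrow> Sync\<close> takes a phase \<open>\<theta>\<close> and a section
  of \<open>X\<close> over an integer interval to its restriction to the part of length \<open>l\<close> that starts at \<open>\<theta>\<close>.
\<close>

definition lan_fiber_adj :: "('u ipsh, 'u ipsh_arr, 'u ipsh_arr, 'u ipsh_arr \<times> 'u ipsh_arr \<times> 'u ipsh_arr) adj" where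
  "lan_fiber_adj = \<lparr>ladj = lan_functor, radj = fiber_functor,
     adj_unit = (\<lambda>Y. (Y, \<lambda>n\<in>\<nat>. \<lambda>y\<in>Sec Y n. pr (ph 0, y), fiber (lan Y) (lan_proj Y))),
     adj_counit = (\<lambda>(X, \<phi>, T). ((lan (fiber X \<phi>), lan_proj (fiber X \<phi>), S),
       (lan (fiber X \<phi>), \<lambda>l\<in>{0..}. \<lambda>u\<in>Sec (lan (fiber X \<phi>)) l.
          Res X (l, phase (fst (inv pr u)), cl (phase (fst (inv pr u)) + l)) (snd (inv pr u)), X),
       (X, \<phi>, S)))\<rparr>"

lemma lan_fiber_adj_simps [simp]:
  "ladj lan_fiber_adj = lan_functor" "radj lan_fiber_adj = fiber_functor"
  "adj_unit lan_fiber_adj Y = (Y, \<lambda>n\<in>\<nat>. \<lambda>y\<in>Sec Y n. pr (ph 0, y), fiber (lan Y) (lan_proj Y))"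
  "adj_counit lan_fiber_adj (X, \<phi>, T) = ((lan (fiber X \<phi>), lan_proj (fiber X \<phi>), S),
       (lan (fiber X \<phi>), \<lambda>l\<in>{0..}. \<lambda>u\<in>Sec (lan (fiber X \<phi>)) l.
          Res X (l, phase (fst (inv pr u)), cl (phase (fst (inv pr u)) + l)) (snd (inv pr u)), X),
       (X, \<phi>, S))"
  by (simp_all add: lan_fiber_adj_def)

lemma cl_Nats_eq: "n \<in> \<nat> \<Longrightarrow> cl n = n"
  by (erule Nats_cases) simp

text \<open>
  The unit is bijective: at phase \<open>0\<close> and integer length \<open>n\<close> the covering path has length exactly \<open>n\<close>.
\<close>

lemma fiber_lan_Sec:
  assumes "n \<in> \<nat>"
  shows "u \<in> Sec (fiber (lan Y) (lan_proj Y)) n \<longleftrightarrow> (\<exists>y\<in>Sec Y n. u = pr (ph 0, y))"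
proof
  note n = Nats_nonneg[OF assms] cl_Nats_eq[OF assms]
  assume "u \<in> Sec (fiber (lan Y) (lan_proj Y)) n"
  then have u: "u \<in> Sec (lan Y) n" "lan_proj Y n u = ph 0" using assms by (simp_all add: fiber_Sec)
  obtain \<theta> y where y: "u = pr (ph \<theta>, y)" "0 \<le> \<theta>" "\<theta> < 1" "y \<in> Sec Y (cl (\<theta> + n))"
    using u(1) n(1) by (rule lan_SecE)
  then have "\<theta> = 0" using u(2) n by (simp add: lan_proj_apply ph_unit_eq_iff)
  then show "\<exists>y\<in>Sec Y n. u = pr (ph 0, y)" using y n by auto
next
  note n = Nats_nonneg[OF assms] cl_Nats_eq[OF assms]
  assume "\<exists>y\<in>Sec Y n. u = pr (ph 0, y)"
  then show "u \<in> Sec (fiber (lan Y) (lan_proj Y)) n"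
    using n lan_SecI[of n 0 _ Y] lan_proj_apply[of n 0 _ Y] assms by (auto simp: fiber_Sec)
qed

lemma lan_Res_Nats:
  assumes "n' \<in> \<nat>" "p \<in> \<nat>" "n \<in> \<nat>" "p + n' \<le> n" "y \<in> Sec Y n"
  shows "Res (lan Y) (n', p, n) (pr (ph 0, y)) = pr (ph 0, Res Y (n', p, n) y)"
proof -
  have p: "frac p = 0" "fl p = p" using assms(2) by (auto elim!: Nats_cases simp del: of_int_floor_cancel)
  show ?thesis
    using lan_Res[of n' p n 0 y Y] assms ph_Nats[of p] assms(1-3)[THEN Nats_nonneg]
    by (simp add: p cl_Nats_eq)
qed

text \<open>
  Every section of the extension is thus a restriction of a section of phase \<open>0\<close> and integer length,
  so a morphism out of \<open>lan Y\<close> is determined by its values on those.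
\<close>

lemma lan_generated:
  assumes "0 \<le> l" "0 \<le> \<theta>" "\<theta> < 1" "y \<in> Sec Y (cl (\<theta> + l))" and Y: "Na.psh small Y"
  shows "Res (lan Y) (l, \<theta>, cl (\<theta> + l)) (pr (ph 0, y)) = pr (ph \<theta>, y)"
proof -
  have n: "cl (\<theta> + l) \<in> \<nat>" using assms by (intro cl_Nats) simp
  have "fl \<theta> = 0" using assms by (simp add: floor_eq_iff)
  then show ?thesis
    using lan_Res[of l \<theta> "cl (\<theta> + l)" 0 y Y] assms n Na.res_ide[OF Y n] by (simp add: frac_unit)
qed

lemma unit_hm:
  assumes Y: "Na.psh small Y"
  shows "(\<lambda>n\<in>\<nat>. \<lambda>y\<in>Sec Y n. pr (ph 0, y)) \<in> Na.hm Y (fiber (lan Y) (lan_proj Y))"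
proof (rule Na.hmI[OF Y])
  fix n y assume "n \<in> \<nat>" "y \<in> Sec Y n"
  then show "pr (ph 0, y) \<in> Sec (fiber (lan Y) (lan_proj Y)) n" by (auto simp: fiber_lan_Sec)
next
  fix n' p n y assume n: "n' \<in> \<nat>" "p \<in> \<nat>" "n \<in> \<nat>" "p + n' \<le> n" and y: "y \<in> Sec Y n"
  have "pr (ph 0, y) \<in> Sec (fiber (lan Y) (lan_proj Y)) n" using n y by (auto simp: fiber_lan_Sec)
  then have "pr (ph 0, y) \<in> Sec (lan Y) n" "lan_proj Y n (pr (ph 0, y)) = ph 0"
    using n by (simp_all add: fiber_Sec)
  then show "pr (ph 0, Res Y (n', p, n) y) = Res (fiber (lan Y) (lan_proj Y)) (n', p, n) (pr (ph 0, y))"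
    using n y by (simp add: fiber_Res lan_Res_Nats)
qed

lemma lan_fiberE:
  assumes "u \<in> Sec (lan (fiber X \<phi>)) l" "0 \<le> l"
  obtains \<theta> x where "u = pr (ph \<theta>, x)" "0 \<le> \<theta>" "\<theta> < 1" "x \<in> Sec (fiber X \<phi>) (cl (\<theta> + l))"
    "x \<in> Sec X (cl (\<theta> + l))" "\<phi> (cl (\<theta> + l)) x = ph 0" "cl (\<theta> + l) \<in> \<nat>" "\<theta> + l \<le> cl (\<theta> + l)"
proof -
  obtain \<theta> x where u: "u = pr (ph \<theta>, x)" "0 \<le> \<theta>" "\<theta> < 1" "x \<in> Sec (fiber X \<phi>) (cl (\<theta> + l))"
    using assms by (rule lan_SecE)
  have n: "cl (\<theta> + l) \<in> \<nat>" using assms u by (intro cl_Nats) simp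
  show ?thesis using that[OF u] n u(4) by (simp add: fiber_Sec)
qed

text \<open>
  Restricting to a shorter interval first replaces the covering path by a smaller one, from
  \<open>\<lfloor>\<theta> + p\<rfloor>\<close>, and then starts at \<open>frac (\<theta> + p)\<close>; the two offsets add up to \<open>\<theta> + p\<close>.
\<close>

lemma counit_hm:
  assumes X: "Re.psh small X" and \<phi>: "\<phi> \<in> Re.hm X S"
  shows "(\<lambda>l\<in>{0..}. \<lambda>u\<in>Sec (lan (fiber X \<phi>)) l.
      Res X (l, phase (fst (inv pr u)), cl (phase (fst (inv pr u)) + l)) (snd (inv pr u)))
      \<in> Re.hm (lan (fiber X \<phi>)) X"
proof (rule Re.hmI[OF psh_lan[OF psh_fiber[OF X \<phi>]]])
  fix l u assume l: "l \<in> {0..}" and "u \<in> Sec (lan (fiber X \<phi>)) l"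
  then obtain \<theta> x where u: "u = pr (ph \<theta>, x)" "0 \<le> \<theta>" "\<theta> < 1" "x \<in> Sec X (cl (\<theta> + l))"
      "cl (\<theta> + l) \<in> \<nat>" "\<theta> + l \<le> cl (\<theta> + l)"
    by (auto elim: lan_fiberE)
  have "Res X (l, \<theta>, cl (\<theta> + l)) x \<in> Sec X l"
    by (rule Re.res_in[OF X]) (use l u Nats_nonneg in auto)
  then show "Res X (l, phase (fst (inv pr u)), cl (phase (fst (inv pr u)) + l)) (snd (inv pr u)) \<in> Sec X l"
    using u by (simp add: frac_unit)
next
  fix l' p l u assume l: "l' \<in> {0..}" "p \<in> {0..}" "l \<in> {0..}" "p + l' \<le> l" and "u \<in> Sec (lan (fiber X \<phi>)) l"
  then obtain \<theta> x where u: "u = pr (ph \<theta>, x)" "0 \<le> \<theta>" "\<theta> < 1" "x \<in> Sec (fiber X \<phi>) (cl (\<theta> + l))"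
      "x \<in> Sec X (cl (\<theta> + l))" "\<phi> (cl (\<theta> + l)) x = ph 0" "cl (\<theta> + l) \<in> \<nat>" "\<theta> + l \<le> cl (\<theta> + l)"
    by (auto elim: lan_fiberE)
  define \<theta>' n' where "\<theta>' = frac (\<theta> + p)" and "n' = cl (\<theta>' + l')"
  have n': "n' \<in> \<nat>" "\<theta>' + l' \<le> n'" "0 \<le> \<theta>'"
    using l by (auto simp: n'_def \<theta>'_def intro!: cl_Nats)
  have f: "fl (\<theta> + p) \<in> \<nat>" using l u by (intro fl_Nats) auto
  have le: "fl (\<theta> + p) + n' \<le> cl (\<theta> + l)" using fl_cl_le[OF l(4), of \<theta>] by (simp add: n'_def \<theta>'_def)
  have sum: "fl (\<theta> + p) + \<theta>' = \<theta> + p" by (simp add: \<theta>'_def frac_def)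
  have "Res X (l', \<theta>', n') (Res X (n', fl (\<theta> + p), cl (\<theta> + l)) x) = Res X (l', \<theta> + p, cl (\<theta> + l)) x"
    using Re.res_res[OF X, of l' \<theta>' n' "fl (\<theta> + p)" "cl (\<theta> + l)" x] l u n' le
      Nats_nonneg[OF f] Nats_nonneg[OF n'(1)] Nats_nonneg[OF u(7)] sum by simp
  also have "\<dots> = Res X (l', p, l) (Res X (l, \<theta>, cl (\<theta> + l)) x)"
    using Re.res_res[OF X, of l' p l \<theta> "cl (\<theta> + l)" x] l u Nats_nonneg[OF u(7)] by simp
  finally have "Res X (l', \<theta>', n') (Res X (n', fl (\<theta> + p), cl (\<theta> + l)) x) = \<dots>" .
  then show "Res X (l', phase (fst (inv pr (Res (lan (fiber X \<phi>)) (l', p, l) u))),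
        cl (phase (fst (inv pr (Res (lan (fiber X \<phi>)) (l', p, l) u))) + l'))
        (snd (inv pr (Res (lan (fiber X \<phi>)) (l', p, l) u))) =
      Res X (l', p, l) (Res X (l, phase (fst (inv pr u)), cl (phase (fst (inv pr u)) + l)) (snd (inv pr u)))"
    using l u n' f le by (simp add: frac_unit lan_Res fiber_Res flip: \<theta>'_def n'_def)
qed

lemma adjunction_lan_fiber: "adjunction (IntNSh small) Slice lan_fiber_adj"
proof -
  have unit: "nat_trans (IntNSh small) (IntNSh small) id_functor (fiber_functor \<circ>\<^sub>F lan_functor) (adj_unit lan_fiber_adj)"
  proof -
    have "adj_unit lan_fiber_adj Y \<in> hom (IntNSh small) Y (omap fiber_functor (omap lan_functor Y))"
      if "Y \<in> Obj (IntNSh small)" for Y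
      using that by (auto simp: Na.sheaf_hom_iff unit_hm psh_lan is_sheaf_lan lan_proj_hm psh_fiber is_sheaf_fiber)
    moreover have "adj_unit lan_fiber_adj Z \<cdot>\<^bsub>IntNSh small\<^esub> f = amap fiber_functor (amap lan_functor f) \<cdot>\<^bsub>IntNSh small\<^esub> adj_unit lan_fiber_adj Y"
      if f: "f \<in> hom (IntNSh small) Y Z" for Y Z f
    proof -
      obtain \<alpha> where \<alpha>: "f = (Y, \<alpha>, Z)" "\<alpha> \<in> Na.hm Y Z"
        using f by (auto simp: Na.sheaf_hom_iff)
      have "lan_map Y \<alpha> n (pr (ph 0, y)) = pr (ph 0, \<alpha> n y)" if "n \<in> \<nat>" "y \<in> Sec Y n" for n y
        using lan_map_apply[of n 0 y Y \<alpha>] that Nats_nonneg[of n] cl_Nats_eq[of n] by simp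
      then show ?thesis
        using Na.hm_in[OF \<alpha>(2)] by (auto simp: \<alpha>(1) fiber_lan_Sec fun_eq_iff restrict_def)
    qed
    ultimately show ?thesis by (simp add: nat_trans_def)
  qed
  have counit: "nat_trans Slice Slice (lan_functor \<circ>\<^sub>F fiber_functor) id_functor (adj_counit lan_fiber_adj)"
  proof -
    have "adj_counit lan_fiber_adj A \<in> hom Slice (omap lan_functor (omap fiber_functor A)) A" if A: "A \<in> Obj Slice" for A
    proof -
      obtain X \<phi> where X: "A = (X, \<phi>, S)" "Re.psh small X" "is_sheaf {0..} X" "\<phi> \<in> Re.hm X S"
        using A by (auto simp: Re.slice_sheaf_obj_iff)
      have "\<phi> l (Res X (l, phase (fst (inv pr u)), cl (phase (fst (inv pr u)) + l)) (snd (inv pr u)))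
          = lan_proj (fiber X \<phi>) l u" if l: "0 \<le> l" and u: "u \<in> Sec (lan (fiber X \<phi>)) l" for l u
      proof -
        obtain \<theta> x where u: "u = pr (ph \<theta>, x)" "0 \<le> \<theta>" "\<theta> < 1" "x \<in> Sec (fiber X \<phi>) (cl (\<theta> + l))"
            "x \<in> Sec X (cl (\<theta> + l))" "\<phi> (cl (\<theta> + l)) x = ph 0" "cl (\<theta> + l) \<in> \<nat>" "\<theta> + l \<le> cl (\<theta> + l)"
          using u l by (rule lan_fiberE)
        have "\<phi> l (Res X (l, \<theta>, cl (\<theta> + l)) x) = Res S (l, \<theta>, cl (\<theta> + l)) (\<phi> (cl (\<theta> + l)) x)"
          by (rule Re.hm_natural[OF X(4)]) (use l u Nats_nonneg in auto)
        then show ?thesis using l u by (simp add: frac_unit lan_proj_apply Sync_Res)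
      qed
      then show ?thesis
        using X by (simp add: Re.slice_sheaf_hom_iff psh_Sync is_sheaf_Sync psh_lan is_sheaf_lan
            psh_fiber is_sheaf_fiber lan_proj_hm counit_hm)
    qed
    moreover have "adj_counit lan_fiber_adj B \<cdot>\<^bsub>Slice\<^esub> amap lan_functor (amap fiber_functor f) = f \<cdot>\<^bsub>Slice\<^esub> adj_counit lan_fiber_adj A"
      if f': "f \<in> hom Slice A B" for A B f
    proof -
      obtain X \<phi> Y \<chi> \<alpha> where f: "f = ((X, \<phi>, S), (X, \<alpha>, Y), (Y, \<chi>, S))" "A = (X, \<phi>, S)" "B = (Y, \<chi>, S)"
          "\<alpha> \<in> Re.hm X Y" "\<forall>l\<in>{0..}. \<forall>x\<in>Sec X l. \<chi> l (\<alpha> l x) = \<phi> l x" "Re.psh small X" "\<phi> \<in> Re.hm X S"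
        using f' unfolding Re.slice_sheaf_hom_iff by blast
      define \<alpha>' where "\<alpha>' = (\<lambda>n\<in>\<nat>. \<lambda>x\<in>Sec (fiber X \<phi>) n. \<alpha> n x)"
      have *: "lan_map (fiber X \<phi>) \<alpha>' l u \<in> Sec (lan (fiber Y \<chi>)) l \<and>
          Res Y (l, phase (fst (inv pr (lan_map (fiber X \<phi>) \<alpha>' l u))),
            cl (phase (fst (inv pr (lan_map (fiber X \<phi>) \<alpha>' l u))) + l)) (snd (inv pr (lan_map (fiber X \<phi>) \<alpha>' l u)))
          = \<alpha> l (Res X (l, phase (fst (inv pr u)), cl (phase (fst (inv pr u)) + l)) (snd (inv pr u)))"
        if l: "0 \<le> l" and u': "u \<in> Sec (lan (fiber X \<phi>)) l" for l u
      proof -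
        obtain \<theta> x where u: "u = pr (ph \<theta>, x)" "0 \<le> \<theta>" "\<theta> < 1" "x \<in> Sec (fiber X \<phi>) (cl (\<theta> + l))"
            "x \<in> Sec X (cl (\<theta> + l))" "\<phi> (cl (\<theta> + l)) x = ph 0" "cl (\<theta> + l) \<in> \<nat>" "\<theta> + l \<le> cl (\<theta> + l)"
          using u' l by (rule lan_fiberE)
        have n: "0 \<le> cl (\<theta> + l)" using u by (intro Nats_nonneg)
        have "\<alpha> (cl (\<theta> + l)) x \<in> Sec (fiber Y \<chi>) (cl (\<theta> + l))"
          using u n f(5) Re.hm_in[OF f(4)] by (simp add: fiber_Sec)
        moreover have "\<alpha> l (Res X (l, \<theta>, cl (\<theta> + l)) x) = Res Y (l, \<theta>, cl (\<theta> + l)) (\<alpha> (cl (\<theta> + l)) x)"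
          by (rule Re.hm_natural[OF f(4)]) (use l u n in auto)
        ultimately show ?thesis using l u by (simp add: frac_unit lan_map_apply lan_SecI \<alpha>'_def)
      qed
      have "Res X (l, phase (fst (inv pr u)), cl (phase (fst (inv pr u)) + l)) (snd (inv pr u)) \<in> Sec X l"
        if "0 \<le> l" "u \<in> Sec (lan (fiber X \<phi>)) l" for l u
        using Re.hm_in[OF counit_hm[OF f(6,7)], of l u] that by simp
      then show ?thesis using * by (auto simp: f(1-3) \<alpha>'_def[symmetric] intro!: restrict_ext)
    qed
    ultimately show ?thesis by (simp add: nat_trans_def)
  qed
  have left: "adj_counit lan_fiber_adj (omap lan_functor Y) \<cdot>\<^bsub>Slice\<^esub> amap lan_functor (adj_unit lan_fiber_adj Y) = Ide Slice (omap lan_functor Y)"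
    if Y: "Y \<in> Obj (IntNSh small)" for Y
  proof -
    define \<eta> where "\<eta> = (\<lambda>n\<in>\<nat>. \<lambda>y\<in>Sec Y n. pr (ph 0, y))"
    have Y': "Na.psh small Y" using Y by simp
    have "lan_map Y \<eta> l u \<in> Sec (lan (fiber (lan Y) (lan_proj Y))) l \<and>
      Res (lan Y) (l, phase (fst (inv pr (lan_map Y \<eta> l u))), cl (phase (fst (inv pr (lan_map Y \<eta> l u))) + l))
        (snd (inv pr (lan_map Y \<eta> l u))) = u" if l: "0 \<le> l" and u': "u \<in> Sec (lan Y) l" for l u
    proof -
      obtain \<theta> y where u: "u = pr (ph \<theta>, y)" "0 \<le> \<theta>" "\<theta> < 1" "y \<in> Sec Y (cl (\<theta> + l))"
        using u' l by (rule lan_SecE)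
      have n: "cl (\<theta> + l) \<in> \<nat>" using l u by (intro cl_Nats) simp
      then have "pr (ph 0, y) \<in> Sec (fiber (lan Y) (lan_proj Y)) (cl (\<theta> + l))"
        using u by (auto simp: fiber_lan_Sec)
      then show ?thesis using l u n Y' by (simp add: lan_map_apply lan_SecI lan_generated frac_unit \<eta>_def)
    qed
    then show ?thesis by (auto simp: \<eta>_def[symmetric] intro!: restrict_ext)
  qed
  have right: "amap fiber_functor (adj_counit lan_fiber_adj B) \<cdot>\<^bsub>IntNSh small\<^esub> adj_unit lan_fiber_adj (omap fiber_functor B)
      = Ide (IntNSh small) (omap fiber_functor B)" if B: "B \<in> Obj Slice" for B
  proof -
    obtain X \<phi> where X: "B = (X, \<phi>, S)" "Re.psh small X" "\<phi> \<in> Re.hm X S"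
      using B by (auto simp: Re.slice_sheaf_obj_iff)
    have "pr (ph 0, x) \<in> Sec (lan (fiber X \<phi>)) n \<and> Res X (n, 0, cl n) x = x"
      if n: "n \<in> \<nat>" and x: "x \<in> Sec (fiber X \<phi>) n" for n x
      using n x Nats_nonneg[OF n] Re.res_ide[OF X(2), of n x] lan_SecI[of n 0 x "fiber X \<phi>"]
      by (simp add: fiber_Sec cl_Nats_eq)
    then show ?thesis
      using Nats_nonneg by (auto simp: X(1) fiber_lan_Sec fun_eq_iff restrict_def)
  qed
  show ?thesis
    unfolding adjunction_def using is_functor_lan is_functor_fiber unit counit left right
    by (simp del: lan_fiber_adj_simps(3,4))
qed

section \<open>The comparison of right adjoints\<close>

lemma precomp_incl_simps:
  "Sec (precomp_psh IntNC incl X) = (\<lambda>n\<in>\<nat>. Sec X n)"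
  "n' \<in> \<nat> \<Longrightarrow> p \<in> \<nat> \<Longrightarrow> n \<in> \<nat> \<Longrightarrow> p + n' \<le> n \<Longrightarrow> Res (precomp_psh IntNC incl X) (n', p, n) = Res X (n', p, n)"
  by (simp_all add: precomp_psh_def incl_def)

lemma Delta_i_simps [simp]:
  "omap Delta_i X = precomp_psh IntNC incl X"
  "amap Delta_i (X, \<alpha>, Y) = (precomp_psh IntNC incl X, \<lambda>n\<in>\<nat>. \<alpha> n, precomp_psh IntNC incl Y)"
  by (simp_all add: Delta_i_def precomp_functor_def) (simp add: incl_def)

lemma psh_precomp:
  assumes X: "Re.psh small X"
  shows "Na.psh small (precomp_psh IntNC incl X)"
proof (rule Na.psh_intI[where S = "Sec X" and r = "\<lambda>n' p n. Res X (n', p, n)"])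
  show "Res (precomp_psh IntNC incl X) (n', p, n) = (\<lambda>x\<in>Sec X n. Res X (n', p, n) x)"
    if n: "n' \<in> \<nat>" "p \<in> \<nat>" "n \<in> \<nat>" "p + n' \<le> n" for n' p n
  proof -
    have "(n', p, n) \<in> Arr IntC" using n(4) n(1-3)[THEN Nats_nonneg] by simp
    then have "Res X (n', p, n) \<in> extensional (Sec X n)"
      using X unfolding presheaf_def by (auto simp: PiE_iff simp del: Re.int_cat_simps(5))
    then show ?thesis using n by (simp add: precomp_incl_simps extensional_restrict)
  qed
  show "small (Sec X n)" if "n \<in> \<nat>" for n
    by (rule presheaf_small[OF X]) (use that Nats_nonneg in auto)
  show "Res X (n', p, n) x \<in> Sec X n'"
    if "n' \<in> \<nat>" "p \<in> \<nat>" "n \<in> \<nat>" "p + n' \<le> n" "x \<in> Sec X n" for n' p n x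
    using that(4,5) that(1-3)[THEN Nats_nonneg] by (intro Re.res_in[OF X]) auto
  show "Res X (n, 0, n) x = x" if "n \<in> \<nat>" "x \<in> Sec X n" for n x
    using that Re.res_ide[OF X] Nats_nonneg by simp
  show "Res X (n'', p + p', n) x = Res X (n'', p', n') (Res X (n', p, n) x)"
    if "n'' \<in> \<nat>" "p' \<in> \<nat>" "n' \<in> \<nat>" "p \<in> \<nat>" "n \<in> \<nat>" "p' + n'' \<le> n'" "p + n' \<le> n" "x \<in> Sec X n"
    for n'' p' n' p n x
    using that(6-8) that(1-5)[THEN Nats_nonneg] Re.res_res[OF X] by simp
qed (auto simp: precomp_psh_def incl_def)

lemma is_sheaf_precomp:
  assumes X: "is_sheaf {0..} X"
  shows "is_sheaf \<nat> (precomp_psh IntNC incl X)"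
  using X Nats_nonneg unfolding is_sheaf_def by (auto simp: precomp_incl_simps)

lemma Delta_i_hm:
  assumes X: "Re.psh small X" and \<alpha>: "\<alpha> \<in> Re.hm X Y"
  shows "(\<lambda>n\<in>\<nat>. \<alpha> n) \<in> Na.hm (precomp_psh IntNC incl X) (precomp_psh IntNC incl Y)"
proof -
  have "(\<lambda>n\<in>\<nat>. \<lambda>x\<in>Sec (precomp_psh IntNC incl X) n. \<alpha> n x) \<in> Na.hm (precomp_psh IntNC incl X) (precomp_psh IntNC incl Y)"
  proof (rule Na.hmI[OF psh_precomp[OF X]])
    fix n x assume "n \<in> \<nat>" "x \<in> Sec (precomp_psh IntNC incl X) n"
    then show "\<alpha> n x \<in> Sec (precomp_psh IntNC incl Y) n"
      using Re.hm_in[OF \<alpha>, of n x] Nats_nonneg[of n] by (simp add: precomp_incl_simps)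
  next
    fix n' p n x assume n: "n' \<in> \<nat>" "p \<in> \<nat>" "n \<in> \<nat>" "p + n' \<le> n" and x: "x \<in> Sec (precomp_psh IntNC incl X) n"
    have "\<alpha> n' (Res X (n', p, n) x) = Res Y (n', p, n) (\<alpha> n x)"
      by (rule Re.hm_natural[OF \<alpha>]) (use n x n(1-3)[THEN Nats_nonneg] in \<open>auto simp: precomp_incl_simps\<close>)
    then show "\<alpha> n' (Res (precomp_psh IntNC incl X) (n', p, n) x) = Res (precomp_psh IntNC incl Y) (n', p, n) (\<alpha> n x)"
      using n by (simp add: precomp_incl_simps)
  qed
  moreover have "(\<lambda>n\<in>\<nat>. \<lambda>x\<in>Sec (precomp_psh IntNC incl X) n. \<alpha> n x) = (\<lambda>n\<in>\<nat>. \<alpha> n)"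
  proof (rule ext)
    fix n
    have "\<alpha> n \<in> extensional (Sec X n)" if "n \<in> \<nat>"
      using \<alpha> Nats_nonneg[OF that] by (auto simp: psh_hom_def PiE_iff)
    then show "(\<lambda>n\<in>\<nat>. \<lambda>x\<in>Sec (precomp_psh IntNC incl X) n. \<alpha> n x) n = (\<lambda>n\<in>\<nat>. \<alpha> n) n"
      by (simp add: precomp_incl_simps extensional_restrict)
  qed
  ultimately show ?thesis by simp
qed

lemma is_functor_Delta_i: "is_functor (IntSh small) (IntNSh small) Delta_i"
proof -
  have "amap Delta_i (g \<cdot>\<^bsub>IntSh small\<^esub> f) = amap Delta_i g \<cdot>\<^bsub>IntNSh small\<^esub> amap Delta_i f"
    if "f \<in> hom (IntSh small) A B" "g \<in> hom (IntSh small) B E" for A B E f g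
    using that Nats_nonneg by (auto simp: Re.sheaf_hom_iff precomp_incl_simps fun_eq_iff restrict_def)
  moreover have "amap Delta_i (Ide (IntSh small) A) = Ide (IntNSh small) (omap Delta_i A)" for A
    using Nats_nonneg by (auto simp: precomp_incl_simps fun_eq_iff restrict_def)
  ultimately show ?thesis
    unfolding is_functor_def
    by (auto simp: Na.category_sheaf Re.category_sheaf Re.sheaf_hom_iff Na.sheaf_hom_iff psh_precomp
        is_sheaf_precomp intro: Delta_i_hm)
qed

definition fiber_prod_fst :: "'u ipsh \<Rightarrow> 'u ipsh_arr" where
  "fiber_prod_fst X = (omap fiber_functor (omap (slice_product pr IntC S) X),
     \<lambda>n\<in>\<nat>. \<lambda>z\<in>Sec (omap fiber_functor (omap (slice_product pr IntC S) X)) n. fst (inv pr z), omap Delta_i X)"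

lemma fiber_prod_Sec:
  assumes "n \<in> \<nat>"
  shows "z \<in> Sec (fiber (psh_prod pr IntC X S) (\<lambda>l\<in>{0..}. \<lambda>z\<in>Sec (psh_prod pr IntC X S) l. snd (inv pr z))) n
    \<longleftrightarrow> (\<exists>x\<in>Sec X n. z = pr (x, ph 0))"
  using assms Nats_nonneg[OF assms] by (auto simp: fiber_Sec Re.prod_Sec Sync_Sec)

text \<open>
  The projection \<open>X \<times> Sync \<rightarrow> Sync\<close> has fiber \<open>X\<close> over phase \<open>0\<close>, which identifies the composite of the
  two right adjoints with restriction to integer lengths.
\<close>

lemma nat_iso_fiber_prod_fst:
  "nat_iso (IntSh small) (IntNSh small) (fiber_functor \<circ>\<^sub>F slice_product pr IntC S) Delta_i fiber_prod_fst"
proof -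
  define F where "F X = fiber (psh_prod pr IntC X S) (\<lambda>l\<in>{0..}. \<lambda>z\<in>Sec (psh_prod pr IntC X S) l. snd (inv pr z))" for X
  note F_Sec = fiber_prod_Sec[folded F_def]
  have F_eq: "omap fiber_functor (omap (slice_product pr IntC S) X) = F X" for X
    by (simp add: Re.slice_product_simps F_def)
  have F_amap: "amap fiber_functor (amap (slice_product pr IntC S) (X, \<alpha>, Y))
      = (F X, \<lambda>n\<in>\<nat>. \<lambda>z\<in>Sec (F X) n. pr (apfst (\<alpha> n) (inv pr z)), F Y)" for X \<alpha> Y
  proof -
    have "z \<in> Sec (psh_prod pr IntC X S) n" if "n \<in> \<nat>" "z \<in> Sec (F X) n" for n z
      using that by (simp add: F_def fiber_Sec)
    then show ?thesis
      using Nats_nonneg by (simp add: Re.slice_product_simps F_def[symmetric] cong: restrict_cong)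
  qed
  have F: "Na.psh small (F X) \<and> is_sheaf \<nat> (F X)" if "Re.psh small X" "is_sheaf {0..} X" for X
    using that psh_Sync is_sheaf_Sync
    by (simp add: F_def psh_fiber is_sheaf_fiber Re.psh_prod Re.is_sheaf_prod Re.snd_hm)
  have res: "Res (F X) (n', p, n) (pr (x, ph 0)) = pr (Res X (n', p, n) x, ph 0)"
    if n: "n' \<in> \<nat>" "p \<in> \<nat>" "n \<in> \<nat>" "p + n' \<le> n" and x: "x \<in> Sec X n" for X n' p n x
  proof -
    note nn = n(1-3)[THEN Nats_nonneg]
    have "pr (x, ph 0) \<in> Sec (F X) n" using x n by (auto simp: F_Sec)
    then have "Res (F X) (n', p, n) (pr (x, ph 0)) = Res (psh_prod pr IntC X S) (n', p, n) (pr (x, ph 0))"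
      using n unfolding F_def by (intro fiber_Res) (simp_all add: fiber_Sec)
    then show ?thesis using n nn x ph_Nats[of p] by (simp add: Re.prod_Res Sync_Sec Sync_Res)
  qed
  have hom: "fiber_prod_fst X \<in> hom (IntNSh small) (F X) (omap Delta_i X)"
    if X: "X \<in> Obj (IntSh small)" for X
  proof -
    have X': "Re.psh small X" "is_sheaf {0..} X" using X by simp_all
    have "(\<lambda>n\<in>\<nat>. \<lambda>z\<in>Sec (F X) n. fst (inv pr z)) \<in> Na.hm (F X) (precomp_psh IntNC incl X)"
      by (rule Na.hmI) (use X' F[OF X'] in \<open>auto simp: F_Sec res precomp_incl_simps\<close>)
    then show ?thesis
      using X' F[OF X'] by (simp add: fiber_prod_fst_def F_eq Na.sheaf_hom_iff psh_precomp is_sheaf_precomp)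
  qed
  have nat: "fiber_prod_fst Y \<cdot>\<^bsub>IntNSh small\<^esub> amap fiber_functor (amap (slice_product pr IntC S) f) = amap Delta_i f \<cdot>\<^bsub>IntNSh small\<^esub> fiber_prod_fst X"
    if f: "f \<in> hom (IntSh small) X Y" for X Y f
  proof -
    obtain \<alpha> where \<alpha>: "f = (X, \<alpha>, Y)" "\<alpha> \<in> Re.hm X Y" using f by (auto simp: Re.sheaf_hom_iff)
    have "\<alpha> n x \<in> Sec Y n" if "n \<in> \<nat>" "x \<in> Sec X n" for n x
      using Re.hm_in[OF \<alpha>(2), of n x] that Nats_nonneg[of n] by simp
    then show ?thesis
      by (auto simp: \<alpha>(1) fiber_prod_fst_def F_eq F_amap F_Sec precomp_incl_simps fun_eq_iff restrict_def)
  qed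
  have iso: "isomorphism (IntNSh small) (F X) (omap Delta_i X) (fiber_prod_fst X)"
    if X: "X \<in> Obj (IntSh small)" for X
  proof -
    have X': "Re.psh small X" "is_sheaf {0..} X" using X by simp_all
    let ?g = "(omap Delta_i X, \<lambda>n\<in>\<nat>. \<lambda>x\<in>Sec (omap Delta_i X) n. pr (x, ph 0), F X)"
    have "(\<lambda>n\<in>\<nat>. \<lambda>x\<in>Sec (omap Delta_i X) n. pr (x, ph 0)) \<in> Na.hm (omap Delta_i X) (F X)"
      unfolding Delta_i_simps
      by (rule Na.hmI) (use X' psh_precomp in \<open>auto simp: F_Sec res precomp_incl_simps\<close>)
    then have "?g \<in> hom (IntNSh small) (omap Delta_i X) (F X)"
      using X' F[OF X'] by (simp add: Na.sheaf_hom_iff psh_precomp is_sheaf_precomp)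
    moreover have "?g \<cdot>\<^bsub>IntNSh small\<^esub> fiber_prod_fst X = Ide (IntNSh small) (F X)"
      "fiber_prod_fst X \<cdot>\<^bsub>IntNSh small\<^esub> ?g = Ide (IntNSh small) (omap Delta_i X)"
      by (auto simp: fiber_prod_fst_def F_eq F_Sec precomp_incl_simps fun_eq_iff restrict_def)
    ultimately show ?thesis using hom[OF X] unfolding isomorphism_def by blast
  qed
  show ?thesis
    unfolding nat_iso_def nat_trans_def using hom nat iso
    by (simp add: F_eq del: Delta_i_simps Re.sheaf_cat_simps)
qed

section \<open>Full faithfulness\<close>

text \<open>
  A morphism \<open>lan A \<rightarrow> lan B\<close> over the phases preserves sections of phase \<open>0\<close> and integer length, that
  is, sections of \<open>A\<close> and \<open>B\<close>.  Its action on these is a morphism \<open>A \<rightarrow> B\<close>, and it determines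
  everything because all sections are restrictions of such.
\<close>

lemma fully_faithful_lan: "fully_faithful (IntNSh small) Slice lan_functor"
proof -
  have "bij_betw (amap lan_functor) (hom (IntNSh small) A B) (hom Slice (omap lan_functor A) (omap lan_functor B))"
    if "A \<in> Obj (IntNSh small)" and "B \<in> Obj (IntNSh small)" for A B
  proof -
    have A: "Na.psh small A" "is_sheaf \<nat> A" and B: "Na.psh small B" "is_sheaf \<nat> B"
      using that by simp_all
    have at0: "lan_map A \<alpha> n (pr (ph 0, y)) = pr (ph 0, \<alpha> n y)" if "n \<in> \<nat>" "y \<in> Sec A n" for \<alpha> n y
      using lan_map_apply[of n 0 y A \<alpha>] that Nats_nonneg[of n] by (simp add: cl_Nats_eq)
    have "inj_on (amap lan_functor) (hom (IntNSh small) A B)"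
    proof (rule inj_onI)
      fix f g assume "f \<in> hom (IntNSh small) A B" "g \<in> hom (IntNSh small) A B" and eq: "amap lan_functor f = amap lan_functor g"
      then obtain \<alpha> \<beta> where fg: "f = (A, \<alpha>, B)" "g = (A, \<beta>, B)" "\<alpha> \<in> Na.hm A B" "\<beta> \<in> Na.hm A B"
        by (auto simp: Na.sheaf_hom_iff)
      have "lan_map A \<alpha> = lan_map A \<beta>" using eq fg by simp
      then have "\<alpha> n y = \<beta> n y" if "n \<in> \<nat>" "y \<in> Sec A n" for n y
        using at0[OF that, of \<alpha>] at0[OF that, of \<beta>] by simp
      then show "f = g" using Na.hm_eqI[OF fg(3,4)] fg by simp
    qed
    moreover have "F \<in> amap lan_functor ` hom (IntNSh small) A B" if F': "F \<in> hom Slice (omap lan_functor A) (omap lan_functor B)" for F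
    proof -
      obtain h where F: "F = ((lan A, lan_proj A, S), (lan A, h, lan B), (lan B, lan_proj B, S))"
          "h \<in> Re.hm (lan A) (lan B)" "\<forall>l\<in>{0..}. \<forall>u\<in>Sec (lan A) l. lan_proj B l (h l u) = lan_proj A l u"
        using F' by (auto simp: Re.slice_sheaf_hom_iff)
      define \<alpha> where "\<alpha> n y = snd (inv pr (h n (pr (ph 0, y))))" for n y
      have h0: "\<alpha> n y \<in> Sec B n" "h n (pr (ph 0, y)) = pr (ph 0, \<alpha> n y)" "pr (ph 0, y) \<in> Sec (lan A) n"
        if n: "n \<in> \<nat>" and y: "y \<in> Sec A n" for n y
      proof -
        note n0 = Nats_nonneg[OF n]
        have "pr (ph 0, y) \<in> Sec (fiber (lan A) (lan_proj A)) n" using n y by (auto simp: fiber_lan_Sec)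
        then have 1: "pr (ph 0, y) \<in> Sec (lan A) n" "lan_proj A n (pr (ph 0, y)) = ph 0"
          using n by (simp_all add: fiber_Sec)
        have "h n (pr (ph 0, y)) \<in> Sec (lan B) n" using Re.hm_in[OF F(2), of n] 1 n0 by simp
        moreover have "lan_proj B n (h n (pr (ph 0, y))) = ph 0" using F(3) 1 n0 by simp
        ultimately have "h n (pr (ph 0, y)) \<in> Sec (fiber (lan B) (lan_proj B)) n" using n by (simp add: fiber_Sec)
        then show "\<alpha> n y \<in> Sec B n" "h n (pr (ph 0, y)) = pr (ph 0, \<alpha> n y)"
          using n by (auto simp: fiber_lan_Sec \<alpha>_def)
        show "pr (ph 0, y) \<in> Sec (lan A) n" by (rule 1)
      qed
      let ?\<alpha> = "\<lambda>n\<in>\<nat>. \<lambda>y\<in>Sec A n. \<alpha> n y"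
      have \<alpha>: "?\<alpha> \<in> Na.hm A B"
      proof (rule Na.hmI[OF A(1) h0(1)])
        fix n' p n y assume n: "n' \<in> \<nat>" "p \<in> \<nat>" "n \<in> \<nat>" "p + n' \<le> n" and y: "y \<in> Sec A n"
        note nn = n(1-3)[THEN Nats_nonneg]
        have r: "Res A (n', p, n) y \<in> Sec A n'" using n y by (intro Na.res_in[OF A(1)]) auto
        have "pr (ph 0, \<alpha> n' (Res A (n', p, n) y)) = h n' (pr (ph 0, Res A (n', p, n) y))"
          using h0(2)[OF n(1) r] by simp
        also have "\<dots> = h n' (Res (lan A) (n', p, n) (pr (ph 0, y)))"
          using n y by (simp add: lan_Res_Nats)
        also have "\<dots> = Res (lan B) (n', p, n) (h n (pr (ph 0, y)))"
          by (rule Re.hm_natural[OF F(2)]) (use n nn h0(3)[OF n(3) y] in auto)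
        also have "\<dots> = pr (ph 0, Res B (n', p, n) (\<alpha> n y))"
          using h0[OF n(3) y] n by (simp add: lan_Res_Nats)
        finally show "\<alpha> n' (Res A (n', p, n) y) = Res B (n', p, n) (\<alpha> n y)" by simp
      qed
      have "lan_map A ?\<alpha> = h"
      proof (rule Re.hm_eqI[OF lan_map_hm[OF A(1) B(1) \<alpha>] F(2)])
        fix l u assume l: "l \<in> {0..}" and "u \<in> Sec (lan A) l"
        then obtain \<theta> y where u: "u = pr (ph \<theta>, y)" "0 \<le> \<theta>" "\<theta> < 1" "y \<in> Sec A (cl (\<theta> + l))"
          by (auto elim: lan_SecE)
        have n: "cl (\<theta> + l) \<in> \<nat>" "\<theta> + l \<le> cl (\<theta> + l)" using l u by (auto intro: cl_Nats)
        have "h l u = h l (Res (lan A) (l, \<theta>, cl (\<theta> + l)) (pr (ph 0, y)))"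
          using l u A by (simp add: lan_generated)
        also have "\<dots> = Res (lan B) (l, \<theta>, cl (\<theta> + l)) (h (cl (\<theta> + l)) (pr (ph 0, y)))"
          by (rule Re.hm_natural[OF F(2)]) (use l u n Nats_nonneg[OF n(1)] h0(3)[OF n(1) u(4)] in auto)
        also have "\<dots> = pr (ph \<theta>, \<alpha> (cl (\<theta> + l)) y)"
          using l u B h0[OF n(1) u(4)] by (simp add: lan_generated)
        finally show "lan_map A ?\<alpha> l u = h l u"
          using l u n by (simp add: lan_map_apply)
      qed
      then have "F = amap lan_functor (A, ?\<alpha>, B)" using F by simp
      moreover have "(A, ?\<alpha>, B) \<in> hom (IntNSh small) A B" using A B \<alpha> by (simp add: Na.sheaf_hom_iff)
      ultimately show ?thesis by blast
    qed
    moreover have "amap lan_functor f \<in> hom Slice (omap lan_functor A) (omap lan_functor B)" if "f \<in> hom (IntNSh small) A B" for f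
      by (rule functor_hom[OF is_functor_lan that])
    ultimately show ?thesis unfolding bij_betw_def by blast
  qed
  then show ?thesis using is_functor_lan by (simp add: fully_faithful_def)
qed

section \<open>Preservation of limits\<close>

text \<open>
  To make the representable presheaves take values in the universe, the arrow \<open>Tr\<^sub>p\<close> is encoded as the
  phase \<open>1 / (p + 2)\<close>; any injection of the natural numbers into the open unit interval would do.
\<close>

definition enc :: "real \<Rightarrow> 'u" where "enc p = ph (1 / (p + 2))"
definition dec :: "'u \<Rightarrow> real" where "dec u = 1 / phase u - 2"

lemma dec_enc [simp]: "0 \<le> p \<Longrightarrow> dec (enc p) = p"
proof -
  assume p: "0 \<le> p"
  then have "frac (1 / (p + 2)) = 1 / (p + 2)" by (intro frac_unit) (simp_all add: divide_simps)
  then show ?thesis using p by (simp add: dec_def enc_def)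
qed

definition yoneda :: "real \<Rightarrow> 'u ipsh" where
  "yoneda n = \<lparr>Sec = (\<lambda>m\<in>\<nat>. enc ` {q \<in> \<nat>. q + m \<le> n}),
     Res = restrict (\<lambda>(m', p, m). \<lambda>u\<in>enc ` {q \<in> \<nat>. q + m \<le> n}. enc (dec u + p)) (Arr IntNC)\<rparr>"

lemma yoneda_Sec: "m \<in> \<nat> \<Longrightarrow> Sec (yoneda n) m = enc ` {q \<in> \<nat>. q + m \<le> n}"
  by (simp add: yoneda_def)

lemma yoneda_Res:
  "m' \<in> \<nat> \<Longrightarrow> p \<in> \<nat> \<Longrightarrow> m \<in> \<nat> \<Longrightarrow> p + m' \<le> m \<Longrightarrow> q \<in> \<nat> \<Longrightarrow> q + m \<le> n \<Longrightarrow>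
    Res (yoneda n) (m', p, m) (enc q) = enc (q + p)"
  using Nats_nonneg[of q] by (simp add: yoneda_def)

lemma enc_eq_iff: "0 \<le> p \<Longrightarrow> 0 \<le> q \<Longrightarrow> enc p = enc q \<longleftrightarrow> p = q"
  by (metis dec_enc)

lemma psh_yoneda: "Na.psh small (yoneda n)"
proof (rule Na.psh_intI[where S = "\<lambda>m. enc ` {q \<in> \<nat>. q + m \<le> n}" and r = "\<lambda>m' p m u. enc (dec u + p)"])
  show "small (enc ` {q \<in> \<nat>. q + m \<le> n})" for m
    by (rule small_range_ph) (auto simp: enc_def)
qed (use Nats_nonneg in \<open>auto simp: yoneda_def add.assoc\<close>)

lemma is_sheaf_yoneda: "is_sheaf \<nat> (yoneda n)"
proof (rule Na.is_sheafI)
  fix l\<^sub>1 l\<^sub>2 u v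
  assume l: "l\<^sub>1 \<in> \<nat>" "l\<^sub>2 \<in> \<nat>" and u: "u \<in> Sec (yoneda n) l\<^sub>1" and v: "v \<in> Sec (yoneda n) l\<^sub>2"
    and eq: "Res (yoneda n) (0, l\<^sub>1, l\<^sub>1) u = Res (yoneda n) (0, 0, l\<^sub>2) v"
  obtain p q where pq: "u = enc p" "p \<in> \<nat>" "p + l\<^sub>1 \<le> n" "v = enc q" "q \<in> \<nat>" "q + l\<^sub>2 \<le> n"
    using u v l by (auto simp: yoneda_Sec)
  note nn = l[THEN Nats_nonneg] pq(2,5)[THEN Nats_nonneg] Nats_add[OF l]
  have "q = p + l\<^sub>1" using eq l nn pq by (simp add: yoneda_Res enc_eq_iff)
  then show "\<exists>w\<in>Sec (yoneda n) (l\<^sub>1 + l\<^sub>2). Res (yoneda n) (l\<^sub>1, 0, l\<^sub>1 + l\<^sub>2) w = u \<and> Res (yoneda n) (l\<^sub>2, l\<^sub>1, l\<^sub>1 + l\<^sub>2) w = v"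
    using l nn pq by (intro bexI[of _ u]) (auto simp: yoneda_Sec yoneda_Res)
next
  fix l\<^sub>1 l\<^sub>2 u v
  assume l: "l\<^sub>1 \<in> \<nat>" "l\<^sub>2 \<in> \<nat>" and u: "u \<in> Sec (yoneda n) (l\<^sub>1 + l\<^sub>2)" and v: "v \<in> Sec (yoneda n) (l\<^sub>1 + l\<^sub>2)"
    and eq: "Res (yoneda n) (l\<^sub>1, 0, l\<^sub>1 + l\<^sub>2) u = Res (yoneda n) (l\<^sub>1, 0, l\<^sub>1 + l\<^sub>2) v"
  note nn = l[THEN Nats_nonneg] Nats_add[OF l]
  obtain p q where pq: "u = enc p" "p \<in> \<nat>" "p + (l\<^sub>1 + l\<^sub>2) \<le> n" "v = enc q" "q \<in> \<nat>" "q + (l\<^sub>1 + l\<^sub>2) \<le> n"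
    using u v nn by (auto simp: yoneda_Sec)
  then show "u = v" using eq l nn by (simp add: yoneda_Res)
qed

definition yoneda_map :: "'u ipsh \<Rightarrow> real \<Rightarrow> 'u \<Rightarrow> real \<Rightarrow> 'u \<Rightarrow> 'u" where
  "yoneda_map X n x = (\<lambda>m\<in>\<nat>. \<lambda>u\<in>Sec (yoneda n) m. Res X (m, dec u, n) x)"

lemma yoneda_map_hm:
  assumes X: "Na.psh small X" and n: "n \<in> \<nat>" and x: "x \<in> Sec X n"
  shows "yoneda_map X n x \<in> Na.hm (yoneda n) X"
  unfolding yoneda_map_def
proof (rule Na.hmI[OF psh_yoneda])
  fix m u assume "m \<in> \<nat>" "u \<in> Sec (yoneda n) m"
  then show "Res X (m, dec u, n) x \<in> Sec X m"
    using n x Nats_nonneg by (auto simp: yoneda_Sec intro: Na.res_in[OF X])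
next
  fix m' p m u assume m: "m' \<in> \<nat>" "p \<in> \<nat>" "m \<in> \<nat>" "p + m' \<le> m" and "u \<in> Sec (yoneda n) m"
  then obtain q where q: "u = enc q" "q \<in> \<nat>" "q + m \<le> n" by (auto simp: yoneda_Sec)
  then show "Res X (m', dec (Res (yoneda n) (m', p, m) u), n) x = Res X (m', p, m) (Res X (m, dec u, n) x)"
    using m n x Nats_nonneg[OF q(2)] Nats_nonneg[OF m(2)] by (simp add: yoneda_Res Na.res_res[OF X])
qed

lemma enc_0_in: "n \<in> \<nat> \<Longrightarrow> enc 0 \<in> Sec (yoneda n) n"
  by (auto simp: yoneda_Sec)

lemma yoneda_map_enc_0: "Na.psh small X \<Longrightarrow> n \<in> \<nat> \<Longrightarrow> x \<in> Sec X n \<Longrightarrow> yoneda_map X n x n (enc 0) = x"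
  by (simp add: yoneda_map_def enc_0_in Na.res_ide)

text \<open>
  With evaluation at the identity arrow, which \<open>enc 0\<close> encodes, this is the Yoneda lemma.
\<close>

lemma yoneda_map_natural:
  assumes \<alpha>: "\<alpha> \<in> Na.hm X Y" and n: "n \<in> \<nat>" and x: "x \<in> Sec X n"
  shows "(\<lambda>m\<in>\<nat>. \<lambda>u\<in>Sec (yoneda n) m. \<alpha> m (yoneda_map X n x m u)) = yoneda_map Y n (\<alpha> n x)"
proof -
  have "\<alpha> m (Res X (m, dec u, n) x) = Res Y (m, dec u, n) (\<alpha> n x)" if m: "m \<in> \<nat>" and u: "u \<in> Sec (yoneda n) m" for m u
  proof -
    obtain q where q: "u = enc q" "q \<in> \<nat>" "q + m \<le> n" using u m by (auto simp: yoneda_Sec)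
    show ?thesis
      by (rule Na.hm_natural[OF \<alpha>]) (use q m n x Nats_nonneg[OF q(2)] in auto)
  qed
  then show ?thesis by (auto simp: yoneda_map_def intro!: restrict_ext)
qed

abbreviation app :: "'u ipsh_arr \<Rightarrow> real \<Rightarrow> 'u \<Rightarrow> 'u" where "app f \<equiv> fst (snd f)"

text \<open>
  A compatible family of sections of length \<open>n\<close> is a cone from the representable presheaf at \<open>n\<close>,
  and a section of \<open>A\<close> of length \<open>n\<close> is a map from that presheaf to \<open>A\<close>.  So limits of integer
  sheaves are computed length by length.
\<close>

lemma limit_pointwise:
  assumes K: "is_functor J (IntNSh small) K" and lim: "is_limit J (IntNSh small) K A \<pi>"
    and n: "n \<in> \<nat>" and y: "\<And>j. j \<in> Obj J \<Longrightarrow> y j \<in> Sec (omap K j) n"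
    and compat: "\<And>i j u. u \<in> hom J i j \<Longrightarrow> app (amap K u) n (y i) = y j"
  shows "\<exists>!x. x \<in> Sec A n \<and> (\<forall>j\<in>Obj J. app (\<pi> j) n x = y j)"
proof -
  have J: "category J" using K by (rule functor_cats)
  have cone: "is_cone J (IntNSh small) K A \<pi>" using lim by (simp add: is_limit_def)
  have A: "Na.psh small A" "is_sheaf \<nat> A" using cone by (simp_all add: is_cone_def)
  have Kj: "Na.psh small (omap K j)" "is_sheaf \<nat> (omap K j)" if "j \<in> Obj J" for j
    using functor_obj[OF K that] by simp_all
  have \<pi>: "\<pi> j = (A, app (\<pi> j), omap K j)" "app (\<pi> j) \<in> Na.hm A (omap K j)" if "j \<in> Obj J" for j
    using cone that by (auto simp: is_cone_def Na.sheaf_hom_iff)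
  define c where "c j = (yoneda n, yoneda_map (omap K j) n (y j), omap K j)" for j
  have "is_cone J (IntNSh small) K (yoneda n) c"
    unfolding is_cone_def
  proof (intro conjI ballI allI)
    show "yoneda n \<in> Obj (IntNSh small)" by (simp add: psh_yoneda is_sheaf_yoneda)
    show "c j \<in> hom (IntNSh small) (yoneda n) (omap K j)" if "j \<in> Obj J" for j
      using Kj[OF that] yoneda_map_hm[OF _ n y[OF that]] by (simp add: c_def Na.sheaf_hom_iff psh_yoneda is_sheaf_yoneda)
    show "amap K u \<cdot>\<^bsub>IntNSh small\<^esub> c i = c j" if u: "u \<in> hom J i j" for i j u
    proof -
      obtain \<alpha> where \<alpha>: "amap K u = (omap K i, \<alpha>, omap K j)" "\<alpha> \<in> Na.hm (omap K i) (omap K j)"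
        using functor_hom[OF K u] by (auto simp: Na.sheaf_hom_iff)
      show ?thesis
        using yoneda_map_natural[OF \<alpha>(2) n y[OF homD(1)[OF J u]]] compat[OF u] by (simp add: \<alpha>(1) c_def)
    qed
  qed
  then obtain h where h: "h \<in> hom (IntNSh small) (yoneda n) A" "\<forall>j\<in>Obj J. \<pi> j \<cdot>\<^bsub>IntNSh small\<^esub> h = c j"
    and unique: "\<And>h'. h' \<in> hom (IntNSh small) (yoneda n) A \<Longrightarrow> \<forall>j\<in>Obj J. \<pi> j \<cdot>\<^bsub>IntNSh small\<^esub> h' = c j \<Longrightarrow> h' = h"
    using lim unfolding is_limit_def by blast
  obtain \<eta> where \<eta>: "h = (yoneda n, \<eta>, A)" "\<eta> \<in> Na.hm (yoneda n) A" using h(1) by (auto simp: Na.sheaf_hom_iff)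
  show ?thesis
  proof (rule ex_ex1I, rule exI[of _ "\<eta> n (enc 0)"], rule conjI)
    show "\<eta> n (enc 0) \<in> Sec A n" by (rule Na.hm_in[OF \<eta>(2) n enc_0_in[OF n]])
    show "\<forall>j\<in>Obj J. app (\<pi> j) n (\<eta> n (enc 0)) = y j"
    proof
      fix j assume j: "j \<in> Obj J"
      have "\<pi> j \<cdot>\<^bsub>IntNSh small\<^esub> h = (yoneda n, \<lambda>m\<in>\<nat>. \<lambda>u\<in>Sec (yoneda n) m. app (\<pi> j) m (\<eta> m u), omap K j)"
        by (subst \<pi>(1)[OF j]) (simp add: \<eta>(1))
      then have "(\<lambda>m\<in>\<nat>. \<lambda>u\<in>Sec (yoneda n) m. app (\<pi> j) m (\<eta> m u)) = yoneda_map (omap K j) n (y j)"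
        using h(2) j by (simp add: c_def)
      from fun_cong[OF fun_cong[OF this, of n], of "enc 0"]
      show "app (\<pi> j) n (\<eta> n (enc 0)) = y j"
        using n enc_0_in[OF n] yoneda_map_enc_0[OF Kj(1)[OF j] n y[OF j]] by simp
    qed
  next
    have det: "(yoneda n, yoneda_map A n x, A) = h" if x: "x \<in> Sec A n \<and> (\<forall>j\<in>Obj J. app (\<pi> j) n x = y j)" for x
    proof (rule unique)
      show "(yoneda n, yoneda_map A n x, A) \<in> hom (IntNSh small) (yoneda n) A"
        using A x yoneda_map_hm[OF A(1) n] by (simp add: Na.sheaf_hom_iff psh_yoneda is_sheaf_yoneda)
      show "\<forall>j\<in>Obj J. \<pi> j \<cdot>\<^bsub>IntNSh small\<^esub> (yoneda n, yoneda_map A n x, A) = c j"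
      proof
        fix j assume j: "j \<in> Obj J"
        show "\<pi> j \<cdot>\<^bsub>IntNSh small\<^esub> (yoneda n, yoneda_map A n x, A) = c j"
          using yoneda_map_natural[OF \<pi>(2)[OF j] n, of x] x j by (subst \<pi>(1)[OF j]) (simp add: c_def)
      qed
    qed
    fix x x' assume x: "x \<in> Sec A n \<and> (\<forall>j\<in>Obj J. app (\<pi> j) n x = y j)"
      and x': "x' \<in> Sec A n \<and> (\<forall>j\<in>Obj J. app (\<pi> j) n x' = y j)"
    have "(yoneda n, yoneda_map A n x, A) = (yoneda n, yoneda_map A n x', A)"
      by (rule trans[OF det[OF x] det[OF x', symmetric]])
    then have "yoneda_map A n x = yoneda_map A n x'" by simp
    then show "x = x'" using yoneda_map_enc_0[OF A(1) n] x x' by metis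
  qed
qed

lemma is_cone_functor:
  assumes F: "is_functor C D F" and K: "is_functor J C K" and cone: "is_cone J C K A \<pi>"
  shows "is_cone J D (F \<circ>\<^sub>F K) (omap F A) (\<lambda>j. amap F (\<pi> j))"
  unfolding is_cone_def
proof (intro conjI ballI allI)
  have J: "category J" using K by (rule functor_cats)
  have c: "A \<in> Obj C" "\<And>j. j \<in> Obj J \<Longrightarrow> \<pi> j \<in> hom C A (omap K j)"
    "\<And>i j u. u \<in> hom J i j \<Longrightarrow> amap K u \<cdot>\<^bsub>C\<^esub> \<pi> i = \<pi> j"
    using cone by (simp_all add: is_cone_def)
  show "omap F A \<in> Obj D" by (rule functor_obj[OF F c(1)])
  show "amap F (\<pi> j) \<in> hom D (omap F A) (omap (F \<circ>\<^sub>F K) j)" if "j \<in> Obj J" for j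
    using functor_hom[OF F c(2)[OF that]] by simp
  show "amap (F \<circ>\<^sub>F K) u \<cdot>\<^bsub>D\<^esub> amap F (\<pi> i) = amap F (\<pi> j)" if u: "u \<in> hom J i j" for i j u
    using functor_compose[OF F c(2)[OF homD(1)[OF J u]] functor_hom[OF K u]] c(3)[OF u] by simp
qed

text \<open>
  For a cone from \<open>\<phi> : X \<rightarrow> Sync\<close> and a section \<open>x\<close> of \<open>X\<close> with phase \<open>\<theta>\<close>, all legs send \<open>x\<close> to
  sections with the same phase \<open>\<theta>\<close>, hence to a compatible family in the values at \<open>\<lceil>\<theta> + l\<rceil>\<close> of the
  integer sheaves.  That family has exactly one preimage in the limit, and its uniqueness makes the
  assignment natural.  The common base is what matters here: the extension without its phase sends
  the terminal sheaf to a circle of phases.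
\<close>

lemma lan_functor_preserves_limit:
  assumes K: "is_functor J (IntNSh small) K" and lim: "is_limit J (IntNSh small) K A \<pi>"
  shows "is_limit J Slice (lan_functor \<circ>\<^sub>F K) (omap lan_functor A) (\<lambda>j. amap lan_functor (\<pi> j))"
proof -
  have J: "category J" using K by (rule functor_cats)
  have cone: "is_cone J (IntNSh small) K A \<pi>" using lim by (simp add: is_limit_def)
  have A: "Na.psh small A" "is_sheaf \<nat> A" using cone by (simp_all add: is_cone_def)
  have Kj: "Na.psh small (omap K j)" "is_sheaf \<nat> (omap K j)" if "j \<in> Obj J" for j
    using functor_obj[OF K that] by simp_all
  have \<pi>: "\<pi> j = (A, app (\<pi> j), omap K j)" "app (\<pi> j) \<in> Na.hm A (omap K j)" if "j \<in> Obj J" for j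
    using cone that by (auto simp: is_cone_def Na.sheaf_hom_iff)
  have lan_\<pi>: "amap lan_functor (\<pi> j) = ((lan A, lan_proj A, S), (lan A, lan_map A (app (\<pi> j)), lan (omap K j)),
      (lan (omap K j), lan_proj (omap K j), S))" if "j \<in> Obj J" for j
    by (subst \<pi>(1)[OF that]) simp
  have "\<exists>!H. H \<in> hom Slice B (omap lan_functor A) \<and> (\<forall>j\<in>Obj J. amap lan_functor (\<pi> j) \<cdot>\<^bsub>Slice\<^esub> H = \<mu> j)"
    if c: "is_cone J Slice (lan_functor \<circ>\<^sub>F K) B \<mu>" for B \<mu>
  proof -
    have "B \<in> Obj Slice" using c by (simp add: is_cone_def)
    then obtain X \<phi> where X: "B = (X, \<phi>, S)" "Re.psh small X" "is_sheaf {0..} X" "\<phi> \<in> Re.hm X S"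
      by (auto simp: Re.slice_sheaf_obj_iff)
    \<comment> \<open>\<open>\<mu> j\<close> is a triple of slice objects and a sheaf map; \<open>m j\<close> is the action of that map\<close>
    define m where "m j = app (fst (snd (\<mu> j)))" for j
    have \<mu>: "\<mu> j = (B, (X, m j, lan (omap K j)), (lan (omap K j), lan_proj (omap K j), S))"
      and m: "m j \<in> Re.hm X (lan (omap K j))"
      and m_proj: "\<And>l x. 0 \<le> l \<Longrightarrow> x \<in> Sec X l \<Longrightarrow> lan_proj (omap K j) l (m j l x) = \<phi> l x"
      if j: "j \<in> Obj J" for j
    proof -
      have "\<mu> j \<in> hom Slice B (omap lan_functor (omap K j))" using c j by (simp add: is_cone_def)
      then show "\<mu> j = (B, (X, m j, lan (omap K j)), (lan (omap K j), lan_proj (omap K j), S))"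
        "m j \<in> Re.hm X (lan (omap K j))"
        "\<And>l x. 0 \<le> l \<Longrightarrow> x \<in> Sec X l \<Longrightarrow> lan_proj (omap K j) l (m j l x) = \<phi> l x"
        by (auto simp: Re.slice_sheaf_hom_iff X(1) m_def)
    qed
    have m_compat: "lan_map (omap K i) (app (amap K u)) l (m i l x) = m j l x"
      if u: "u \<in> hom J i j" and l: "0 \<le> l" and x: "x \<in> Sec X l" for i j u l x
    proof -
      obtain \<alpha> where \<alpha>: "amap K u = (omap K i, \<alpha>, omap K j)" using functor_hom[OF K u] by (auto simp: Na.sheaf_hom_iff)
      have "amap lan_functor (amap K u) \<cdot>\<^bsub>Slice\<^esub> \<mu> i = \<mu> j" using c u by (simp add: is_cone_def)
      then have "(\<lambda>l\<in>{0..}. \<lambda>x\<in>Sec X l. lan_map (omap K i) \<alpha> l (m i l x)) = m j"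
        using \<mu>[OF homD(1)[OF J u]] \<mu>[OF homD(2)[OF J u]] by (simp add: \<alpha>)
      from fun_cong[OF fun_cong[OF this, of l], of x] show ?thesis using l x by (simp add: \<alpha>)
    qed
    define P where "P l x a \<longleftrightarrow> a \<in> Sec (lan A) l \<and> lan_proj A l a = \<phi> l x \<and>
        (\<forall>j\<in>Obj J. lan_map A (app (\<pi> j)) l a = m j l x)" for l x a
    have ex1: "\<exists>!a. P l x a" if l: "0 \<le> l" and x: "x \<in> Sec X l" for l x
    proof -
      define \<theta> where "\<theta> = phase (\<phi> l x)"
      define N where "N = cl (\<theta> + l)"
      have \<theta>: "0 \<le> \<theta>" "\<theta> < 1" unfolding \<theta>_def by (rule phase_unit)+
      have "\<phi> l x \<in> range ph" using Re.hm_in[OF X(4), of l x] l x by (simp add: Sync_Sec)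
      then have ph: "\<phi> l x = ph \<theta>" unfolding \<theta>_def by (simp only: ph_phase)
      have N: "N \<in> \<nat>" using l \<theta> by (simp add: N_def cl_Nats)
      define y where "y j = snd (inv pr (m j l x))" for j
      have y: "m j l x = pr (ph \<theta>, y j)" "y j \<in> Sec (omap K j) N" if j: "j \<in> Obj J" for j
      proof -
        have "m j l x \<in> Sec (lan (omap K j)) l" using Re.hm_in[OF m[OF j], of l x] l x by simp
        then obtain \<theta>' z where z: "m j l x = pr (ph \<theta>', z)" "0 \<le> \<theta>'" "\<theta>' < 1" "z \<in> Sec (omap K j) (cl (\<theta>' + l))"
          using l by (rule lan_SecE)
        have "ph \<theta>' = ph \<theta>" using m_proj[OF j l x] z l ph by (simp add: lan_proj_apply)
        then have "\<theta>' = \<theta>" using \<theta> z by (simp add: ph_unit_eq_iff)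
        then show "m j l x = pr (ph \<theta>, y j)" "y j \<in> Sec (omap K j) N"
          using z by (simp_all add: y_def N_def)
      qed
      have "app (amap K u) N (y i) = y j" if u: "u \<in> hom J i j" for i j u
        using m_compat[OF u l x] y[OF homD(1)[OF J u]] y[OF homD(2)[OF J u]] l \<theta>
        by (simp add: lan_map_apply N_def)
      then have ex: "\<exists>!z. z \<in> Sec A N \<and> (\<forall>j\<in>Obj J. app (\<pi> j) N z = y j)"
        using y by (intro limit_pointwise[OF K lim N]) auto
      have P_iff: "P l x a \<longleftrightarrow> (\<exists>z. a = pr (ph \<theta>, z) \<and> z \<in> Sec A N \<and> (\<forall>j\<in>Obj J. app (\<pi> j) N z = y j))" for a
      proof
        assume P: "P l x a"
        then have "a \<in> Sec (lan A) l" by (simp add: P_def)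
        then obtain \<theta>' z where z: "a = pr (ph \<theta>', z)" "0 \<le> \<theta>'" "\<theta>' < 1" "z \<in> Sec A (cl (\<theta>' + l))"
          using l by (rule lan_SecE)
        have "ph \<theta>' = ph \<theta>" using P z l ph by (simp add: P_def lan_proj_apply)
        then have "\<theta>' = \<theta>" using \<theta> z by (simp add: ph_unit_eq_iff)
        then show "\<exists>z. a = pr (ph \<theta>, z) \<and> z \<in> Sec A N \<and> (\<forall>j\<in>Obj J. app (\<pi> j) N z = y j)"
          using P z l y by (intro exI[of _ z]) (auto simp: P_def N_def lan_map_apply)
      next
        assume "\<exists>z. a = pr (ph \<theta>, z) \<and> z \<in> Sec A N \<and> (\<forall>j\<in>Obj J. app (\<pi> j) N z = y j)"
        then show "P l x a"
          using l \<theta> y ph by (auto simp: P_def N_def lan_SecI lan_proj_apply lan_map_apply)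
      qed
      obtain z where "z \<in> Sec A N \<and> (\<forall>j\<in>Obj J. app (\<pi> j) N z = y j)" using ex by blast
      then have "P l x (pr (ph \<theta>, z))" unfolding P_iff by blast
      moreover have "a = a'" if "P l x a" "P l x a'" for a a'
        using that ex unfolding P_iff by blast
      ultimately show ?thesis by blast
    qed
    define h where "h l x = (THE a. P l x a)" for l x
    have Ph: "P l x (h l x)" if "0 \<le> l" "x \<in> Sec X l" for l x
      unfolding h_def by (rule theI'[OF ex1[OF that]])
    let ?h = "\<lambda>l\<in>{0..}. \<lambda>x\<in>Sec X l. h l x"
    have h: "?h \<in> Re.hm X (lan A)"
    proof (rule Re.hmI[OF X(2)])
      show "h l x \<in> Sec (lan A) l" if "l \<in> {0..}" "x \<in> Sec X l" for l x
        using Ph[of l x] that by (simp add: P_def)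
    next
      fix l' p l x assume l: "l' \<in> {0..}" "p \<in> {0..}" "l \<in> {0..}" "p + l' \<le> l" and x: "x \<in> Sec X l"
      have r: "Res X (l', p, l) x \<in> Sec X l'" by (rule Re.res_in[OF X(2) l x])
      have P: "h l x \<in> Sec (lan A) l" "lan_proj A l (h l x) = \<phi> l x"
          "\<And>j. j \<in> Obj J \<Longrightarrow> lan_map A (app (\<pi> j)) l (h l x) = m j l x"
        using Ph[of l x] l x by (simp_all add: P_def)
      have "P l' (Res X (l', p, l) x) (Res (lan A) (l', p, l) (h l x))"
        unfolding P_def
      proof (intro conjI ballI)
        show "Res (lan A) (l', p, l) (h l x) \<in> Sec (lan A) l'"
          by (rule Re.res_in[OF psh_lan[OF A(1)] l P(1)])
        show "lan_proj A l' (Res (lan A) (l', p, l) (h l x)) = \<phi> l' (Res X (l', p, l) x)"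
          using Re.hm_natural[OF lan_proj_hm[OF A(1)] l P(1)] Re.hm_natural[OF X(4) l x] P(2) by simp
        show "lan_map A (app (\<pi> j)) l' (Res (lan A) (l', p, l) (h l x)) = m j l' (Res X (l', p, l) x)"
          if j: "j \<in> Obj J" for j
          using Re.hm_natural[OF lan_map_hm[OF A(1) Kj(1)[OF j] \<pi>(2)[OF j]] l P(1)]
            Re.hm_natural[OF m[OF j] l x] P(3)[OF j] by simp
      qed
      then show "h l' (Res X (l', p, l) x) = Res (lan A) (l', p, l) (h l x)"
        unfolding h_def[of l'] using l by (intro the1_equality[OF ex1[OF _ r]]) auto
    qed
    have H: "(B, (X, ?h, lan A), (lan A, lan_proj A, S)) \<in> hom Slice B (omap lan_functor A)"
      using h X A Ph by (auto simp: Re.slice_sheaf_hom_iff psh_Sync is_sheaf_Sync psh_lan is_sheaf_lan lan_proj_hm P_def)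
    have comp: "amap lan_functor (\<pi> j) \<cdot>\<^bsub>Slice\<^esub> (B, (X, ?h, lan A), (lan A, lan_proj A, S)) = \<mu> j" if j: "j \<in> Obj J" for j
    proof -
      have "(\<lambda>l\<in>{0..}. \<lambda>x\<in>Sec X l. lan_map A (app (\<pi> j)) l (h l x)) = (\<lambda>l\<in>{0..}. \<lambda>x\<in>Sec X l. m j l x)"
        using Ph j by (intro restrict_ext) (simp add: P_def)
      also have "\<dots> = m j" by (rule Re.hm_restrict[OF m[OF j]])
      finally show ?thesis by (simp add: lan_\<pi>[OF j] \<mu>[OF j] cong: restrict_cong)
    qed
    have unique: "G = (B, (X, ?h, lan A), (lan A, lan_proj A, S))"
      if G': "G \<in> hom Slice B (omap lan_functor A)" and G_comp: "\<forall>j\<in>Obj J. amap lan_functor (\<pi> j) \<cdot>\<^bsub>Slice\<^esub> G = \<mu> j" for G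
    proof -
      obtain g where g: "G = (B, (X, g, lan A), (lan A, lan_proj A, S))" "g \<in> Re.hm X (lan A)"
          "\<forall>l\<in>{0..}. \<forall>x\<in>Sec X l. lan_proj A l (g l x) = \<phi> l x"
        using G' by (auto simp: Re.slice_sheaf_hom_iff X(1))
      have "g l x = h l x" if l: "l \<in> {0..}" and x: "x \<in> Sec X l" for l x
      proof -
        have "lan_map A (app (\<pi> j)) l (g l x) = m j l x" if j: "j \<in> Obj J" for j
        proof -
          have "(\<lambda>l\<in>{0..}. \<lambda>x\<in>Sec X l. lan_map A (app (\<pi> j)) l (g l x)) = m j"
            using bspec[OF G_comp j] by (simp add: lan_\<pi>[OF j] \<mu>[OF j] g(1))
          from fun_cong[OF fun_cong[OF this, of l], of x] show ?thesis using l x by simp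
        qed
        then have "P l x (g l x)" using Re.hm_in[OF g(2) l x] g(3) l x by (simp add: P_def)
        then show ?thesis unfolding h_def using l x by (intro the1_equality[OF ex1, symmetric]) auto
      qed
      then have "g = ?h" by (intro Re.hm_eqI[OF g(2) h]) simp
      then show ?thesis using g(1) by simp
    qed
    show ?thesis using H comp unique by blast
  qed
  then show ?thesis
    unfolding is_limit_def using is_cone_functor[OF is_functor_lan K cone] by blast
qed

lemma geometric_morphism_lan_fiber: "geometric_morphism (IntNSh small) Slice lan_fiber_adj"
  unfolding geometric_morphism_def preserves_finite_limits_def lan_fiber_adj_simps
  using adjunction_lan_fiber lan_functor_preserves_limit by blast

end

theorem proposition3p3p7:
  fixes small :: "'u set \<Rightarrow> bool"
    and pr :: "'u \<times> 'u \<Rightarrow> 'u"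
    and crc :: "real set \<Rightarrow> 'u"
  assumes "set_universe small pr crc"
  shows "(\<exists>T. adjunction (IntNSh small) (IntSh small) T \<and> radj T = Delta_i) \<and>
    (\<forall>T. adjunction (IntNSh small) (IntSh small) T \<and> radj T = Delta_i \<longrightarrow>
      (\<exists>T'. geometric_morphism (IntNSh small) (slice (IntSh small) (Sync crc)) T' \<and>
        fully_faithful (IntNSh small) (slice (IntSh small) (Sync crc)) (ladj T') \<and>
        adj_iso (IntNSh small) (IntSh small)
          (adj_comp (IntNSh small) (IntSh small) T' (slice_adj small pr IntC (Sync crc))) T))"
proof -
  interpret set_universe small pr crc by fact
  let ?S = "adj_comp (IntNSh small) (IntSh small) lan_fiber_adj (slice_adj small pr IntC (Sync crc))"
  have adj: "adjunction (IntNSh small) (IntSh small) ?S"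
    by (rule adjunction_comp[OF adjunction_lan_fiber Re.adjunction_slice_adj[OF psh_Sync is_sheaf_Sync]])
  have iso: "nat_iso (IntSh small) (IntNSh small) (radj ?S) Delta_i fiber_prod_fst"
    using nat_iso_fiber_prod_fst by (simp add: Re.slice_adj_simps(2))
  have "\<exists>T. adjunction (IntNSh small) (IntSh small) T \<and> radj T = Delta_i"
    by (rule adjunction_transport[OF adj is_functor_Delta_i iso])
  moreover have "adj_iso (IntNSh small) (IntSh small) ?S T"
    if "adjunction (IntNSh small) (IntSh small) T" "radj T = Delta_i" for T
    using adj_iso_of_radj_iso[OF adj that(1)] iso that(2) by simp
  moreover have "fully_faithful (IntNSh small) Slice (ladj lan_fiber_adj)"
    using fully_faithful_lan by simp
  ultimately show ?thesis using geometric_morphism_lan_fiber by blast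
qed

end
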